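(* For any sequential $\aleph_0$-space $X$, the free abelian topological group $A(X)$ over $X$ and the free locally convex linear topological space $L(X)$ over $X$ are both $\mathfrak P_0$-spaces.
   Context: "Regular" means $T_3$. Linear spaces are real. A topological space $X$ is sequential if for each non-closed subset $A\subset X$ there is a sequence in $A$ convergent to some point of $X\setminus A$. A family $\mathcal N$ of subsets of $X$ is a $k$-network if for each open set $U\subset X$ and each compact subset $K\subset U$ there is a finite subfamily $\mathcal F\subset\mathcal N$ such that $K\subset\bigcup\mathcal F\subset U$. An $\aleph_0$-space is a regular space with a countable $k$-network. A free abelian topological group over a topological space $X$ is a pair $(A(X),i_X)$ consisting of an abelian topological group $A(X)$ and a continuous map $i_X:X\to A(X)$ such that for every continuous map $f:X\to G$ to an abelian topological group $G$ there exists a unique continuous group homomorphism $h:A(X)\to G$ such that $f=h\circ i_X$. A free locally convex space over $X$ is a pair $(L(X),j_X)$ consisting of a locally convex linear topological space $L(X)$ and a continuous map $j_X:X\to L(X)$ such that for every continuous map $f:X\to Y$ to a locally convex linear topological space $Y$ there exists a unique continuous linear operator $\lambda:L(X)\to Y$ such that $f=\lambda\circ j_X$. A subset $A$ of a topological space $X$ accumulates at a point $x\in X$ if each neighborhood of $x$ contains infinitely many points of $A$. A family $\mathcal N$ of subsets of $X$ is a network at $x\in X$ if for any neighborhood $O_x$ of $x$ there is $N\in\mathcal N$ with $x\in N\subset O_x$. It is a Pytkeev network at $x$ if it is a network at $x$ and for each neighborhood $O_x$ of $x$ and each subset $A\subset X$ accumulating at $x$ there is $N\in\mathcal N$ such that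 $N\subset O_x$ and $N\cap A$ is infinite. It is a Pytkeev network for $X$ if it is a Pytkeev network at each point $x\in X$. A $\mathfrak P_0$-space is a regular space with a countable Pytkeev network. *)

theory Defs
  imports "HOL-Analysis.Analysis" "HOL-Algebra.Module" "HOL-Algebra.Generated_Groups"
begin

section \<open>Sequential spaces, \<open>\<aleph>\<^sub>0\<close>-spaces and \<open>\<PP>\<^sub>0\<close>-spaces\<close>

text \<open>In the library \<^const>\<open>regular_space\<close> does not include any separation of points, so that
  \<open>T\<^sub>3\<close> is the conjunction below.\<close>

definition t3_space :: "'a topology \<Rightarrow> bool" where
  "t3_space X \<longleftrightarrow> regular_space X \<and> t1_space X"

definition sequential_space :: "'a topology \<Rightarrow> bool" where
  "sequential_space X \<longleftrightarrow>
    (\<forall>A. A \<subseteq> topspace X \<and> \<not> closedin X A \<longrightarrow>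
      (\<exists>\<sigma> x. range \<sigma> \<subseteq> A \<and> x \<in> topspace X - A \<and> limitin X \<sigma> x sequentially))"

definition k_network :: "'a topology \<Rightarrow> 'a set set \<Rightarrow> bool" where
  "k_network X \<N> \<longleftrightarrow> \<N> \<subseteq> Pow (topspace X) \<and>
    (\<forall>U K. openin X U \<and> compactin X K \<and> K \<subseteq> U \<longrightarrow>
      (\<exists>\<F>. finite \<F> \<and> \<F> \<subseteq> \<N> \<and> K \<subseteq> \<Union>\<F> \<and> \<Union>\<F> \<subseteq> U))"

definition aleph0_space :: "'a topology \<Rightarrow> bool" where
  "aleph0_space X \<longleftrightarrow> t3_space X \<and> (\<exists>\<N>. countable \<N> \<and> k_network X \<N>)"

definition accumulates_at :: "'a topology \<Rightarrow> 'a set \<Rightarrow> 'a \<Rightarrow> bool" where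
  "accumulates_at X A x \<longleftrightarrow> (\<forall>U. openin X U \<and> x \<in> U \<longrightarrow> infinite (U \<inter> A))"

definition network_at :: "'a topology \<Rightarrow> 'a set set \<Rightarrow> 'a \<Rightarrow> bool" where
  "network_at X \<N> x \<longleftrightarrow> (\<forall>U. openin X U \<and> x \<in> U \<longrightarrow> (\<exists>N\<in>\<N>. x \<in> N \<and> N \<subseteq> U))"

definition pytkeev_network_at :: "'a topology \<Rightarrow> 'a set set \<Rightarrow> 'a \<Rightarrow> bool" where
  "pytkeev_network_at X \<N> x \<longleftrightarrow> network_at X \<N> x \<and>
    (\<forall>U A. openin X U \<and> x \<in> U \<and> A \<subseteq> topspace X \<and> accumulates_at X A x \<longrightarrow>
      (\<exists>N\<in>\<N>. N \<subseteq> U \<and> infinite (N \<inter> A)))"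

definition pytkeev_network :: "'a topology \<Rightarrow> 'a set set \<Rightarrow> bool" where
  "pytkeev_network X \<N> \<longleftrightarrow>
    \<N> \<subseteq> Pow (topspace X) \<and> (\<forall>x\<in>topspace X. pytkeev_network_at X \<N> x)"

definition P0_space :: "'a topology \<Rightarrow> bool" where
  "P0_space X \<longleftrightarrow> t3_space X \<and> (\<exists>\<N>. countable \<N> \<and> pytkeev_network X \<N>)"


section \<open>Free abelian topological groups\<close>

text \<open>Abelian groups are written multiplicatively, as in \<^locale>\<open>comm_group\<close>. No separation axiom
  is imposed on a group topology.\<close>

definition abelian_topological_group :: "'g monoid \<Rightarrow> 'g topology \<Rightarrow> bool" where
  "abelian_topological_group G T \<longleftrightarrow>
    comm_group G \<and> topspace T = carrier G \<and>
    continuous_map (prod_topology T T) T (\<lambda>(x, y). x \<otimes>\<^bsub>G\<^esub> y) \<and>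
    continuous_map T T (\<lambda>x. inv\<^bsub>G\<^esub> x)"

text \<open>Every continuous map from \<open>X\<close> to \<open>G\<close> factors uniquely through \<open>i\<close>. Requiring \<open>h\<close> to be
  \<^const>\<open>extensional\<close> disregards its values outside of the carrier.\<close>

definition group_factorization ::
    "'a topology \<Rightarrow> 'b monoid \<Rightarrow> 'b topology \<Rightarrow> ('a \<Rightarrow> 'b) \<Rightarrow> 'g monoid \<Rightarrow> 'g topology \<Rightarrow> bool" where
  "group_factorization X A TA i G TG \<longleftrightarrow>
    (\<forall>f. continuous_map X TG f \<longrightarrow>
      (\<exists>!h. h \<in> extensional (carrier A) \<and> h \<in> hom A G \<and> continuous_map TA TG h \<and>
            (\<forall>x\<in>topspace X. f x = h (i x))))"

text \<open>A formula cannot quantify over all types, so the test groups \<open>G\<close> are taken with (arbitrary)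
  carriers in two types: that of \<open>A\<close> itself, and one in which every group generated by an image of
  \<open>X\<close> can be realized. Lemma \<open>free_abelian_topological_group_universal\<close> below shows that this
  entails the universal property for test groups over every type.\<close>

definition free_abelian_topological_group ::
    "'a topology \<Rightarrow> 'b monoid \<Rightarrow> 'b topology \<Rightarrow> ('a \<Rightarrow> 'b) \<Rightarrow> bool" where
  "free_abelian_topological_group X A TA i \<longleftrightarrow>
    abelian_topological_group A TA \<and> continuous_map X TA i \<and>
    (\<forall>(G :: 'b monoid) TG. abelian_topological_group G TG \<longrightarrow> group_factorization X A TA i G TG) \<and>
    (\<forall>(G :: ('a \<Rightarrow> int) monoid) TG.
      abelian_topological_group G TG \<longrightarrow> group_factorization X A TA i G TG)"


section \<open>Free locally convex spaces\<close>

text \<open>Real linear spaces are modules over the field of reals; the fields \<^const>\<open>monoid.mult\<close> and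
  \<^const>\<open>monoid.one\<close> of the record are irrelevant.\<close>

definition real_ring :: "real ring" where
  "real_ring = \<lparr>carrier = UNIV, monoid.mult = (*), one = 1, ring.zero = 0, add = (+)\<rparr>"

definition convex_in :: "(real, 'v) module \<Rightarrow> 'v set \<Rightarrow> bool" where
  "convex_in V C \<longleftrightarrow> C \<subseteq> carrier V \<and>
    (\<forall>x\<in>C. \<forall>y\<in>C. \<forall>t. 0 \<le> t \<and> t \<le> 1 \<longrightarrow> ((1 - t) \<odot>\<^bsub>V\<^esub> x) \<oplus>\<^bsub>V\<^esub> (t \<odot>\<^bsub>V\<^esub> y) \<in> C)"

definition linear_topological_space :: "(real, 'v) module \<Rightarrow> 'v topology \<Rightarrow> bool" where
  "linear_topological_space V T \<longleftrightarrow>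
    module real_ring V \<and> topspace T = carrier V \<and>
    continuous_map (prod_topology T T) T (\<lambda>(x, y). x \<oplus>\<^bsub>V\<^esub> y) \<and>
    continuous_map (prod_topology euclideanreal T) T (\<lambda>(c, x). c \<odot>\<^bsub>V\<^esub> x)"

definition locally_convex_space :: "(real, 'v) module \<Rightarrow> 'v topology \<Rightarrow> bool" where
  "locally_convex_space V T \<longleftrightarrow>
    linear_topological_space V T \<and> neighbourhood_base_at \<zero>\<^bsub>V\<^esub> (convex_in V) T"

definition linear_operators :: "(real, 'v) module \<Rightarrow> (real, 'w) module \<Rightarrow> ('v \<Rightarrow> 'w) set" where
  "linear_operators V W =
    {h \<in> carrier V \<rightarrow> carrier W.
      (\<forall>x\<in>carrier V. \<forall>y\<in>carrier V. h (x \<oplus>\<^bsub>V\<^esub> y) = h x \<oplus>\<^bsub>W\<^esub> h y) \<and>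
      (\<forall>c. \<forall>x\<in>carrier V. h (c \<odot>\<^bsub>V\<^esub> x) = c \<odot>\<^bsub>W\<^esub> h x)}"

definition linear_factorization ::
    "'a topology \<Rightarrow> (real, 'b) module \<Rightarrow> 'b topology \<Rightarrow> ('a \<Rightarrow> 'b) \<Rightarrow>
     (real, 'v) module \<Rightarrow> 'v topology \<Rightarrow> bool" where
  "linear_factorization X L TL j Y TY \<longleftrightarrow>
    (\<forall>f. continuous_map X TY f \<longrightarrow>
      (\<exists>!h. h \<in> extensional (carrier L) \<and> h \<in> linear_operators L Y \<and> continuous_map TL TY h \<and>
            (\<forall>x\<in>topspace X. f x = h (j x))))"

text \<open>The test spaces are treated like the test groups above; see lemma
  \<open>free_locally_convex_space_universal\<close>.\<close>

definition free_locally_convex_space ::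
    "'a topology \<Rightarrow> (real, 'b) module \<Rightarrow> 'b topology \<Rightarrow> ('a \<Rightarrow> 'b) \<Rightarrow> bool" where
  "free_locally_convex_space X L TL j \<longleftrightarrow>
    locally_convex_space L TL \<and> continuous_map X TL j \<and>
    (\<forall>(Y :: (real, 'b) module) TY.
      locally_convex_space Y TY \<longrightarrow> linear_factorization X L TL j Y TY) \<and>
    (\<forall>(Y :: (real, 'a \<Rightarrow> real) module) TY.
      locally_convex_space Y TY \<longrightarrow> linear_factorization X L TL j Y TY)"


section \<open>The universal properties hold for test objects over arbitrary types\<close>

lemma continuous_map_binop:
  assumes "continuous_map (prod_topology T1 T2) T (\<lambda>(x, y). m x y)"
    and "continuous_map S T1 f" and "continuous_map S T2 g"
  shows "continuous_map S T (\<lambda>z. m (f z) (g z))"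
proof -
  have "continuous_map S (prod_topology T1 T2) (\<lambda>z. (f z, g z))"
    using assms(2,3) by (simp add: continuous_map_pairwise o_def)
  from continuous_map_compose[OF this assms(1)] show ?thesis
    by (simp add: o_def)
qed

lemma ex1_extensionalI:
  assumes "h \<in> extensional S" "P h" "\<And>k. k \<in> extensional S \<Longrightarrow> P k \<Longrightarrow> \<forall>x\<in>S. k x = h x"
  shows "\<exists>!h. h \<in> extensional S \<and> P h"
  proof (rule ex1I[of _ h])
  show "h \<in> extensional S \<and> P h" using assms(1,2) by simp
  fix k assume "k \<in> extensional S \<and> P k"
  then show "k = h" using assms(1) assms(3)[of k] by (intro extensionalityI[of k S h]) auto
qed

subsection \<open>Groups\<close>

definition group_pull :: "'g set \<Rightarrow> ('g \<Rightarrow> 'h) \<Rightarrow> 'h monoid \<Rightarrow> 'g monoid" where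
  "group_pull C p G = \<lparr>carrier = C, monoid.mult = (\<lambda>x y. inv_into C p (p x \<otimes>\<^bsub>G\<^esub> p y)),
                      one = inv_into C p \<one>\<^bsub>G\<^esub>\<rparr>"

lemma abelian_topological_group_pull:
  fixes G :: "'h monoid" and C :: "'g set"
  assumes G: "abelian_topological_group G TG" and H: "subgroup H G" and p: "bij_betw p C H"
  defines "G' \<equiv> group_pull C p G" and "T' \<equiv> pullback_topology C p TG"
  shows "abelian_topological_group G' T'" and "p \<in> hom G' G" and "continuous_map T' TG p"
proof -
  define q where "q = inv_into C p"
  interpret G: comm_group G using G by (simp add: abelian_topological_group_def)
  interpret H: subgroup H G by (rule H)
  have topG: "topspace TG = carrier G" using G by (simp add: abelian_topological_group_def)
  have pH: "p x \<in> H" if "x \<in> C" for x using that p by (auto simp: bij_betw_def)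
  have pG: "p x \<in> carrier G" if "x \<in> C" for x using that pH H.subset by auto
  have qC: "q y \<in> C" if "y \<in> H" for y
    using that p unfolding q_def by (metis bij_betw_def inv_into_into)
  have pq: "p (q y) = y" if "y \<in> H" for y
    using that p unfolding q_def by (metis bij_betw_inv_into_right)
  have qp: "q (p x) = x" if "x \<in> C" for x
    using that p unfolding q_def by (metis bij_betw_inv_into_left)
  have inj: "x = y" if "p x = p y" "x \<in> C" "y \<in> C" for x y using that qp by metis
  have car: "carrier G' = C" by (simp add: G'_def group_pull_def)
  have mul: "x \<otimes>\<^bsub>G'\<^esub> y = q (p x \<otimes>\<^bsub>G\<^esub> p y)" for x y
    by (simp add: G'_def group_pull_def q_def)
  have one: "\<one>\<^bsub>G'\<^esub> = q \<one>\<^bsub>G\<^esub>" by (simp add: G'_def group_pull_def q_def)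
  have cg: "comm_group G'"
  proof (rule comm_groupI, unfold car mul one)
    fix x y z assume "x \<in> C" "y \<in> C" "z \<in> C"
    then show "q (p (q (p x \<otimes>\<^bsub>G\<^esub> p y)) \<otimes>\<^bsub>G\<^esub> p z) = q (p x \<otimes>\<^bsub>G\<^esub> p (q (p y \<otimes>\<^bsub>G\<^esub> p z)))"
      by (simp add: pq pH pG G.m_assoc)
  next
    fix x assume "x \<in> C"
    then have "q (inv\<^bsub>G\<^esub> p x) \<in> C" "q (p (q (inv\<^bsub>G\<^esub> p x)) \<otimes>\<^bsub>G\<^esub> p x) = q \<one>\<^bsub>G\<^esub>"
      by (simp_all add: qC pq pH pG)
    then show "\<exists>y\<in>C. q (p y \<otimes>\<^bsub>G\<^esub> p x) = q \<one>\<^bsub>G\<^esub>" by blast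
  next
    fix x y assume "x \<in> C" "y \<in> C"
    then show "q (p x \<otimes>\<^bsub>G\<^esub> p y) = q (p y \<otimes>\<^bsub>G\<^esub> p x)" by (simp add: G.m_comm pG)
  qed (auto simp: qC pq pH qp pG)
  interpret G': comm_group G' by (rule cg)
  have topT': "topspace T' = C"
    unfolding T'_def topspace_pullback_topology using topG pG by auto
  have cp: "continuous_map T' TG p"
    using continuous_map_pullback[OF continuous_map_id, of C p TG] by (simp add: T'_def)
  have cI: "continuous_map S T' g"
    if "continuous_map S TG (\<lambda>x. p (g x))" "\<And>x. x \<in> topspace S \<Longrightarrow> g x \<in> C" for S and g :: "'z \<Rightarrow> 'g"
    unfolding T'_def by (rule continuous_map_pullback') (use that in \<open>auto simp: o_def\<close>)
  have cmul: "continuous_map (prod_topology TG TG) TG (\<lambda>(x, y). x \<otimes>\<^bsub>G\<^esub> y)"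
    and cinv: "continuous_map TG TG (\<lambda>x. inv\<^bsub>G\<^esub> x)"
    using G by (auto simp: abelian_topological_group_def)
  have hom: "p \<in> hom G' G"
    by (auto simp: hom_def car mul pG pq pH)
  have pinv: "p (inv\<^bsub>G'\<^esub> x) = inv\<^bsub>G\<^esub> p x" if "x \<in> C" for x
  proof -
    have "group_hom G' G p"
      by (simp add: group_hom_def group_hom_axioms_def hom G.is_group G'.is_group)
    from group_hom.hom_inv[OF this] that show ?thesis by (simp add: car)
  qed
  have "continuous_map (prod_topology T' T') T' (\<lambda>z. fst z \<otimes>\<^bsub>G'\<^esub> snd z)"
  proof (rule cI)
    have "continuous_map (prod_topology T' T') TG (\<lambda>z. p (fst z) \<otimes>\<^bsub>G\<^esub> p (snd z))"
      by (rule continuous_map_binop[OF cmul])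
        (auto intro: continuous_map_compose[OF continuous_map_fst cp, unfolded o_def]
           continuous_map_compose[OF continuous_map_snd cp, unfolded o_def])
    then show "continuous_map (prod_topology T' T') TG (\<lambda>z. p (fst z \<otimes>\<^bsub>G'\<^esub> snd z))"
      by (rule continuous_map_eq) (auto simp: topT' mul pq pH)
  qed (auto simp: topT' mul qC pH)
  moreover have "continuous_map T' T' (\<lambda>x. inv\<^bsub>G'\<^esub> x)"
  proof (rule cI)
    have "continuous_map T' TG (\<lambda>x. inv\<^bsub>G\<^esub> p x)"
      using continuous_map_compose[OF cp cinv] by (simp add: o_def)
    then show "continuous_map T' TG (\<lambda>x. p (inv\<^bsub>G'\<^esub> x))"
      by (rule continuous_map_eq) (auto simp: topT' pinv)
  qed (use G'.inv_closed in \<open>auto simp: topT' car\<close>)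
  ultimately show "abelian_topological_group G' T'"
    by (simp add: abelian_topological_group_def cg topT' car case_prod_unfold)
  show "p \<in> hom G' G" "continuous_map T' TG p" by (fact hom cp)+
qed

lemma (in comm_group) generate_representation:
  fixes f :: "'c \<Rightarrow> 'a"
  assumes f: "f \<in> S \<rightarrow> carrier G"
  shows "\<exists>p :: ('c \<Rightarrow> int) \<Rightarrow> 'a. \<exists>C. bij_betw p C (generate G (f ` S))"
proof -
  define supp :: "('c \<Rightarrow> int) \<Rightarrow> 'c set" where "supp c = {x. c x \<noteq> 0}" for c
  define D where "D = {c. finite (supp c) \<and> supp c \<subseteq> S}"
  define p where "p c = (\<Otimes>x\<in>supp c. f x [^] c x)" for c :: "'c \<Rightarrow> int"
  have p_eq: "p c = (\<Otimes>x\<in>F. f x [^] c x)" if "finite F" "supp c \<subseteq> F" "F \<subseteq> S" for c F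
    unfolding p_def using that f
    by (intro finprod_mono_neutral_cong_left) (auto simp: supp_def)
  have "generate G (f ` S) \<subseteq> p ` D"
  proof
    fix y assume "y \<in> generate G (f ` S)"
    then show "y \<in> p ` D"
    proof induction
      case one
      have "p (\<lambda>x. 0) = \<one>" "(\<lambda>x. 0) \<in> D" by (auto simp: p_def supp_def D_def)
      then show ?case by force
    next
      case (incl h)
      then obtain x where x: "x \<in> S" "h = f x" by auto
      have "p (\<lambda>y. if y = x then 1 else 0) = (\<Otimes>y\<in>{x}. f y [^] (if y = x then 1 else 0 :: int))"
        by (rule p_eq) (use x in \<open>auto simp: supp_def\<close>)
      then have "p (\<lambda>y. if y = x then 1 else 0) = h" using x f by (auto simp: Pi_iff int_pow_1)
      moreover have "(\<lambda>y. if y = x then 1 else 0) \<in> D" using x by (auto simp: D_def supp_def)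
      ultimately show ?case by force
    next
      case (inv h)
      then obtain x where x: "x \<in> S" "h = f x" by auto
      have "p (\<lambda>y. if y = x then -1 else 0) = (\<Otimes>y\<in>{x}. f y [^] (if y = x then -1 else 0 :: int))"
        by (rule p_eq) (use x in \<open>auto simp: supp_def\<close>)
      then have "p (\<lambda>y. if y = x then -1 else 0) = inv h"
        using x f by (auto simp: Pi_iff int_pow_neg int_pow_1)
      moreover have "(\<lambda>y. if y = x then -1 else 0) \<in> D" using x by (auto simp: D_def supp_def)
      ultimately show ?case by force
    next
      case (eng h1 h2)
      then obtain c d where c: "c \<in> D" "h1 = p c" and d: "d \<in> D" "h2 = p d" by auto
      define F where "F = supp c \<union> supp d"
      have F: "finite F" "F \<subseteq> S" using c d by (auto simp: F_def D_def)
      have sub: "supp (\<lambda>x. c x + d x) \<subseteq> F" by (auto simp: F_def supp_def)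
      have fF: "f x \<in> carrier G" if "x \<in> F" for x using that F f by auto
      have "p (\<lambda>x. c x + d x) = (\<Otimes>x\<in>F. f x [^] (c x + d x))" by (rule p_eq[OF F(1) sub F(2)])
      also have "\<dots> = (\<Otimes>x\<in>F. f x [^] c x \<otimes> f x [^] d x)"
        by (rule finprod_cong') (auto simp: fF int_pow_mult)
      also have "\<dots> = (\<Otimes>x\<in>F. f x [^] c x) \<otimes> (\<Otimes>x\<in>F. f x [^] d x)"
        by (rule finprod_multf) (auto simp: fF)
      also have "\<dots> = h1 \<otimes> h2"
        using p_eq[of F c] p_eq[of F d] F c d by (simp add: F_def)
      finally have "p (\<lambda>x. c x + d x) = h1 \<otimes> h2" .
      moreover have "(\<lambda>x. c x + d x) \<in> D"
        using F sub by (auto simp: D_def intro: finite_subset)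
      ultimately show ?case by force
    qed
  qed
  then obtain C where "C \<subseteq> D" "inj_on p C" "generate G (f ` S) = p ` C"
    unfolding subset_image_inj by blast
  then show ?thesis by (metis bij_betw_def)
qed

lemma free_abelian_topological_group_factor:
  fixes X :: "'a topology" and G :: "'g monoid"
  assumes A: "free_abelian_topological_group X A TA i"
    and G: "abelian_topological_group G TG" and f: "continuous_map X TG f"
  shows "\<exists>h. h \<in> extensional (carrier A) \<and> h \<in> hom A G \<and> continuous_map TA TG h \<and>
            (\<forall>x\<in>topspace X. f x = h (i x)) \<and> h ` carrier A \<subseteq> generate G (f ` topspace X)"
proof -
  interpret G: comm_group G using G by (simp add: abelian_topological_group_def)
  have A': "abelian_topological_group A TA" and i: "continuous_map X TA i"
    using A by (auto simp: free_abelian_topological_group_def)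
  have topA: "topspace TA = carrier A" and topG: "topspace TG = carrier G"
    using A' G by (auto simp: abelian_topological_group_def)
  define H where "H = generate G (f ` topspace X)"
  have fG: "f \<in> topspace X \<rightarrow> carrier G" using f topG by (auto simp: continuous_map_def)
  then have H: "subgroup H G" unfolding H_def by (intro G.generate_is_subgroup) auto
  from G.generate_representation[OF fG]
  obtain p :: "('a \<Rightarrow> int) \<Rightarrow> 'g" and C where p: "bij_betw p C H" unfolding H_def by blast
  define G' where "G' = group_pull C p G"
  define T' where "T' = pullback_topology C p TG"
  have G': "abelian_topological_group G' T'" and hom: "p \<in> hom G' G" and cp: "continuous_map T' TG p"
    using abelian_topological_group_pull[OF G H p] by (auto simp: G'_def T'_def)
  have car: "carrier G' = C" by (simp add: G'_def group_pull_def)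
  define q where "q = inv_into C p"
  have fH: "f x \<in> H" if "x \<in> topspace X" for x using that by (auto simp: H_def intro: generate.incl)
  have qC: "q y \<in> C" and pq: "p (q y) = y" if "y \<in> H" for y
    using that p unfolding q_def by (auto simp: bij_betw_inv_into_right bij_betw_def inv_into_into)
  have "continuous_map X T' (\<lambda>x. q (f x))"
    unfolding T'_def
  proof (rule continuous_map_pullback')
    show "continuous_map X TG (p \<circ> (\<lambda>x. q (f x)))"
      using f by (rule continuous_map_eq) (simp add: pq fH)
  qed (auto simp: qC fH)
  moreover have "group_factorization X A TA i G' T'"
    using A G' unfolding free_abelian_topological_group_def by blast
  ultimately obtain k where k: "k \<in> hom A G'" "continuous_map TA T' k"
    "\<forall>x\<in>topspace X. q (f x) = k (i x)"
    unfolding group_factorization_def by blast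
  define h where "h = restrict (p \<circ> k) (carrier A)"
  have A_group: "comm_group A" using A' by (simp add: abelian_topological_group_def)
  interpret A: comm_group A by (rule A_group)
  have "p \<circ> k \<in> hom A G" using hom_compose[OF k(1) hom] .
  then have "h \<in> hom A G" by (auto simp: hom_def h_def)
  moreover have "continuous_map TA TG h"
    using continuous_map_compose[OF k(2) cp] by (rule continuous_map_eq) (simp add: h_def topA)
  moreover have "\<forall>x\<in>topspace X. f x = h (i x)"
  proof
    fix x assume x: "x \<in> topspace X"
    then have "i x \<in> carrier A" using i topA by (auto simp: continuous_map_def)
    then show "f x = h (i x)" using x k(3) pq[OF fH[OF x]] by (auto simp: h_def)
  qed
  moreover have "h ` carrier A \<subseteq> H"
    using k(1) p by (auto simp: h_def hom_def car bij_betw_def)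
  moreover have "h \<in> extensional (carrier A)" by (simp add: h_def)
  ultimately show ?thesis unfolding H_def by blast
qed

lemma free_abelian_topological_group_generated:
  assumes A: "free_abelian_topological_group X A TA i"
  shows "generate A (i ` topspace X) = carrier A"
proof -
  have A': "abelian_topological_group A TA" and i: "continuous_map X TA i"
    using A by (auto simp: free_abelian_topological_group_def)
  have topA: "topspace TA = carrier A" using A' by (auto simp: abelian_topological_group_def)
  interpret A: comm_group A using A' by (simp add: abelian_topological_group_def)
  have iA: "i x \<in> carrier A" if "x \<in> topspace X" for x
    using that i topA by (auto simp: continuous_map_def)
  from free_abelian_topological_group_factor[OF A A' i] obtain h where
    h: "h \<in> extensional (carrier A)" "h \<in> hom A A" "continuous_map TA TA h"
      "\<forall>x\<in>topspace X. i x = h (i x)" and hA: "h ` carrier A \<subseteq> generate A (i ` topspace X)"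
    by blast
  define e where "e = restrict id (carrier A)"
  have e: "e \<in> extensional (carrier A)" "e \<in> hom A A" "\<forall>x\<in>topspace X. i x = e (i x)"
    using iA by (auto simp: e_def hom_def)
  have "continuous_map TA TA e"
    using continuous_map_id by (rule continuous_map_eq) (simp add: e_def topA)
  moreover have "group_factorization X A TA i A TA"
    using A A' unfolding free_abelian_topological_group_def by blast
  ultimately have "h = e"
    using h e i unfolding group_factorization_def by blast
  then have "carrier A \<subseteq> generate A (i ` topspace X)" using hA by (auto simp: e_def)
  moreover have "generate A (i ` topspace X) \<subseteq> carrier A"
    by (rule A.generate_incl) (auto simp: iA)
  ultimately show ?thesis by blast
qed

theorem free_abelian_topological_group_universal:
  fixes G :: "'g monoid"
  assumes A: "free_abelian_topological_group X A TA i" and G: "abelian_topological_group G TG"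
  shows "group_factorization X A TA i G TG"
  unfolding group_factorization_def
proof (intro allI impI)
  fix f assume f: "continuous_map X TG f"
  have A': "abelian_topological_group A TA" and i: "continuous_map X TA i"
    using A by (auto simp: free_abelian_topological_group_def)
  have topA: "topspace TA = carrier A" using A' by (auto simp: abelian_topological_group_def)
  have A_group: "comm_group A" and G_group: "comm_group G"
    using A' G by (auto simp: abelian_topological_group_def)
  interpret A: comm_group A by (rule A_group)
  interpret G: comm_group G by (rule G_group)
  have iA: "i x \<in> carrier A" if "x \<in> topspace X" for x
    using that i topA by (auto simp: continuous_map_def)
  from free_abelian_topological_group_factor[OF A G f] obtain h where
    h: "h \<in> extensional (carrier A)"
      "h \<in> hom A G \<and> continuous_map TA TG h \<and> (\<forall>x\<in>topspace X. f x = h (i x))"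
    by blast
  show "\<exists>!h. h \<in> extensional (carrier A) \<and>
          h \<in> hom A G \<and> continuous_map TA TG h \<and> (\<forall>x\<in>topspace X. f x = h (i x))"
  proof (rule ex1_extensionalI[where P =
        "\<lambda>h. h \<in> hom A G \<and> continuous_map TA TG h \<and> (\<forall>x\<in>topspace X. f x = h (i x))", OF h])
    fix k assume k: "k \<in> hom A G \<and> continuous_map TA TG k \<and> (\<forall>x\<in>topspace X. f x = k (i x))"
    interpret h: group_hom A G h
      using h(2) by (simp add: group_hom_def group_hom_axioms_def A.is_group G.is_group)
    interpret k: group_hom A G k
      using k by (simp add: group_hom_def group_hom_axioms_def A.is_group G.is_group)
    show "\<forall>a\<in>carrier A. k a = h a"
    proof
      fix a assume "a \<in> carrier A"
      then have "a \<in> generate A (i ` topspace X)"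
        by (simp add: free_abelian_topological_group_generated[OF A])
      then have "a \<in> carrier A \<and> k a = h a"
        by induction (use iA h(2) k in \<open>auto\<close>)
      then show "k a = h a" by blast
    qed
  qed
qed


subsection \<open>Locally convex spaces\<close>

lemma real_ring_simps [simp]:
  "carrier real_ring = UNIV" "\<zero>\<^bsub>real_ring\<^esub> = 0" "\<one>\<^bsub>real_ring\<^esub> = 1"
  "x \<oplus>\<^bsub>real_ring\<^esub> y = x + y" "x \<otimes>\<^bsub>real_ring\<^esub> y = x * y"
  by (simp_all add: real_ring_def)

lemma cring_real_ring: "cring real_ring"
proof (rule cringI)
  show "abelian_group real_ring"
  proof (rule abelian_groupI)
    show "\<exists>y\<in>carrier real_ring. y \<oplus>\<^bsub>real_ring\<^esub> x = \<zero>\<^bsub>real_ring\<^esub>" for x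
      by (rule bexI[of _ "- x"]) simp_all
  qed auto
  show "comm_monoid real_ring" by (rule comm_monoidI) auto
qed (auto simp: algebra_simps)

definition span_in :: "(real, 'v) module \<Rightarrow> 'v set \<Rightarrow> 'v set" where
  "span_in V S = \<Inter>{K. submodule K real_ring V \<and> S \<subseteq> K}"

lemma span_in_superset: "S \<subseteq> span_in V S"
  by (auto simp: span_in_def)

lemma span_in_minimal: "submodule K real_ring V \<Longrightarrow> S \<subseteq> K \<Longrightarrow> span_in V S \<subseteq> K"
  by (auto simp: span_in_def)

lemma submodule_span_in:
  assumes V: "module real_ring V" and S: "S \<subseteq> carrier V"
  shows "submodule (span_in V S) real_ring V"
proof -
  interpret V: module real_ring V by (rule V)
  show ?thesis
  proof (rule V.submoduleI)
    show "span_in V S \<subseteq> carrier V"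
      by (rule span_in_minimal[OF V.carrier_is_submodule S])
    have K: "\<zero>\<^bsub>V\<^esub> \<in> K" if "submodule K real_ring V" for K
      using subgroup.one_closed[OF submodule.axioms(1)[OF that]] by simp
    then show "\<zero>\<^bsub>V\<^esub> \<in> span_in V S" by (auto simp: span_in_def)
  qed (auto simp: span_in_def V.submoduleE)
qed

definition module_pull :: "'v set \<Rightarrow> ('v \<Rightarrow> 'w) \<Rightarrow> (real, 'w) module \<Rightarrow> (real, 'v) module" where
  "module_pull C p V = \<lparr>carrier = C, monoid.mult = (\<lambda>x y. x), one = inv_into C p \<zero>\<^bsub>V\<^esub>,
     ring.zero = inv_into C p \<zero>\<^bsub>V\<^esub>, add = (\<lambda>x y. inv_into C p (p x \<oplus>\<^bsub>V\<^esub> p y)),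
     smult = (\<lambda>c x. inv_into C p (c \<odot>\<^bsub>V\<^esub> p x))\<rparr>"

lemma locally_convex_space_pull:
  fixes V :: "(real, 'w) module" and C :: "'v set"
  assumes V: "locally_convex_space V TV" and H: "submodule H real_ring V" and p: "bij_betw p C H"
  defines "V' \<equiv> module_pull C p V" and "T' \<equiv> pullback_topology C p TV"
  shows "locally_convex_space V' T'" and "p \<in> linear_operators V' V" and "continuous_map T' TV p"
proof -
  define q where "q = inv_into C p"
  interpret V: module real_ring V
    using V by (simp add: locally_convex_space_def linear_topological_space_def)
  have topV: "topspace TV = carrier V"
    using V by (simp add: locally_convex_space_def linear_topological_space_def)
  note subE = V.submoduleE[OF H]
  have H0: "\<zero>\<^bsub>V\<^esub> \<in> H" using subgroup.one_closed[OF submodule.axioms(1)[OF H]] by simp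
  have Hs: "c \<odot>\<^bsub>V\<^esub> x \<in> H" if "x \<in> H" for c x using subE(4)[OF _ that] by simp
  have pH: "p x \<in> H" if "x \<in> C" for x using that p by (auto simp: bij_betw_def)
  have pV: "p x \<in> carrier V" if "x \<in> C" for x using that pH subE(1) by auto
  have qC: "q y \<in> C" if "y \<in> H" for y
    using that p unfolding q_def by (metis bij_betw_def inv_into_into)
  have pq: "p (q y) = y" if "y \<in> H" for y
    using that p unfolding q_def by (metis bij_betw_inv_into_right)
  have qp: "q (p x) = x" if "x \<in> C" for x
    using that p unfolding q_def by (metis bij_betw_inv_into_left)
  have car: "carrier V' = C" by (simp add: V'_def module_pull_def)
  have add: "x \<oplus>\<^bsub>V'\<^esub> y = q (p x \<oplus>\<^bsub>V\<^esub> p y)" for x y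
    by (simp add: V'_def module_pull_def q_def)
  have zero: "\<zero>\<^bsub>V'\<^esub> = q \<zero>\<^bsub>V\<^esub>" by (simp add: V'_def module_pull_def q_def)
  have smult: "c \<odot>\<^bsub>V'\<^esub> x = q (c \<odot>\<^bsub>V\<^esub> p x)" for c x
    by (simp add: V'_def module_pull_def q_def)
  note closed = qC pq pH qp pV subE(5) Hs H0
  have ag: "abelian_group V'"
  proof (rule abelian_groupI, unfold car add zero)
    fix x y z assume "x \<in> C" "y \<in> C" "z \<in> C"
    then show "q (p (q (p x \<oplus>\<^bsub>V\<^esub> p y)) \<oplus>\<^bsub>V\<^esub> p z) = q (p x \<oplus>\<^bsub>V\<^esub> p (q (p y \<oplus>\<^bsub>V\<^esub> p z)))"
      by (simp add: closed V.a_assoc)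
  next
    fix x assume "x \<in> C"
    then have "q (\<ominus>\<^bsub>V\<^esub> p x) \<in> C" "q (p (q (\<ominus>\<^bsub>V\<^esub> p x)) \<oplus>\<^bsub>V\<^esub> p x) = q \<zero>\<^bsub>V\<^esub>"
      by (simp_all add: closed subE(3) V.l_neg)
    then show "\<exists>y\<in>C. q (p y \<oplus>\<^bsub>V\<^esub> p x) = q \<zero>\<^bsub>V\<^esub>" by blast
  next
    fix x y assume "x \<in> C" "y \<in> C"
    then show "q (p x \<oplus>\<^bsub>V\<^esub> p y) = q (p y \<oplus>\<^bsub>V\<^esub> p x)" by (simp add: V.a_comm pV)
  qed (auto simp: closed)
  have V': "module real_ring V'"
  proof (rule moduleI[OF cring_real_ring ag], unfold car add smult real_ring_simps)
    fix a b x assume x: "x \<in> C"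
    show "q ((a + b) \<odot>\<^bsub>V\<^esub> p x) = q (p (q (a \<odot>\<^bsub>V\<^esub> p x)) \<oplus>\<^bsub>V\<^esub> p (q (b \<odot>\<^bsub>V\<^esub> p x)))"
      using V.smult_l_distr[of a b "p x"] x by (simp add: closed)
    show "q ((a * b) \<odot>\<^bsub>V\<^esub> p x) = q (a \<odot>\<^bsub>V\<^esub> p (q (b \<odot>\<^bsub>V\<^esub> p x)))"
      using V.smult_assoc1[of a b "p x"] x by (simp add: closed)
    show "q (1 \<odot>\<^bsub>V\<^esub> p x) = x"
      using V.smult_one[of "p x"] x by (simp add: closed)
    fix y assume y: "y \<in> C"
    show "q (a \<odot>\<^bsub>V\<^esub> p (q (p x \<oplus>\<^bsub>V\<^esub> p y))) = q (p (q (a \<odot>\<^bsub>V\<^esub> p x)) \<oplus>\<^bsub>V\<^esub> p (q (a \<odot>\<^bsub>V\<^esub> p y)))"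
      using V.smult_r_distr[of a "p x" "p y"] x y by (simp add: closed)
  qed (auto simp: closed)
  have topT': "topspace T' = C"
    unfolding T'_def topspace_pullback_topology using topV pV by auto
  have cp: "continuous_map T' TV p"
    using continuous_map_pullback[OF continuous_map_id, of C p TV] by (simp add: T'_def)
  have cI: "continuous_map S T' g"
    if "continuous_map S TV (\<lambda>x. p (g x))" "\<And>x. x \<in> topspace S \<Longrightarrow> g x \<in> C" for S and g :: "'z \<Rightarrow> 'v"
    unfolding T'_def by (rule continuous_map_pullback') (use that in \<open>auto simp: o_def\<close>)
  have cadd: "continuous_map (prod_topology TV TV) TV (\<lambda>(x, y). x \<oplus>\<^bsub>V\<^esub> y)"
    and csm: "continuous_map (prod_topology euclideanreal TV) TV (\<lambda>(c, x). c \<odot>\<^bsub>V\<^esub> x)"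
    using V by (auto simp: locally_convex_space_def linear_topological_space_def)
  have lin: "p \<in> linear_operators V' V"
    by (auto simp: linear_operators_def car add smult closed)
  have "continuous_map (prod_topology T' T') T' (\<lambda>z. fst z \<oplus>\<^bsub>V'\<^esub> snd z)"
  proof (rule cI)
    have "continuous_map (prod_topology T' T') TV (\<lambda>z. p (fst z) \<oplus>\<^bsub>V\<^esub> p (snd z))"
      by (rule continuous_map_binop[OF cadd])
        (auto intro: continuous_map_compose[OF continuous_map_fst cp, unfolded o_def]
           continuous_map_compose[OF continuous_map_snd cp, unfolded o_def])
    then show "continuous_map (prod_topology T' T') TV (\<lambda>z. p (fst z \<oplus>\<^bsub>V'\<^esub> snd z))"
      by (rule continuous_map_eq) (auto simp: topT' add closed)
  qed (auto simp: topT' add closed)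
  moreover have "continuous_map (prod_topology euclideanreal T') T' (\<lambda>z. fst z \<odot>\<^bsub>V'\<^esub> snd z)"
  proof (rule cI)
    have "continuous_map (prod_topology euclideanreal T') TV (\<lambda>z. fst z \<odot>\<^bsub>V\<^esub> p (snd z))"
      by (rule continuous_map_binop[OF csm])
        (auto intro: continuous_map_fst continuous_map_compose[OF continuous_map_snd cp, unfolded o_def])
    then show "continuous_map (prod_topology euclideanreal T') TV (\<lambda>z. p (fst z \<odot>\<^bsub>V'\<^esub> snd z))"
      by (rule continuous_map_eq) (auto simp: topT' smult closed)
  qed (auto simp: topT' smult closed)
  moreover have "neighbourhood_base_at \<zero>\<^bsub>V'\<^esub> (convex_in V') T'"
    unfolding neighbourhood_base_at_def
  proof (intro allI impI)
    fix W assume W: "openin T' W \<and> \<zero>\<^bsub>V'\<^esub> \<in> W"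
    then obtain U where U: "openin TV U" "W = p -` U \<inter> C"
      by (auto simp: T'_def openin_pullback_topology)
    have "\<zero>\<^bsub>V\<^esub> \<in> U" using W U by (auto simp: zero closed)
    moreover have "neighbourhood_base_at \<zero>\<^bsub>V\<^esub> (convex_in V) TV"
      using V by (simp add: locally_convex_space_def)
    ultimately obtain U' K where K: "openin TV U'" "convex_in V K" "\<zero>\<^bsub>V\<^esub> \<in> U'" "U' \<subseteq> K" "K \<subseteq> U"
      using U(1) unfolding neighbourhood_base_at_def by meson
    have "openin T' (p -` U' \<inter> C)" using K(1) by (auto simp: T'_def openin_pullback_topology)
    moreover have "convex_in V' (p -` K \<inter> C)"
      using K(2) by (auto simp: convex_in_def car add smult closed)
    moreover have "\<zero>\<^bsub>V'\<^esub> \<in> p -` U' \<inter> C" using K(3) by (simp add: zero closed)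
    moreover have "p -` U' \<inter> C \<subseteq> p -` K \<inter> C" "p -` K \<inter> C \<subseteq> W" using K U by auto
    ultimately show "\<exists>U K. openin T' U \<and> convex_in V' K \<and> \<zero>\<^bsub>V'\<^esub> \<in> U \<and> U \<subseteq> K \<and> K \<subseteq> W"
      by blast
  qed
  ultimately show "locally_convex_space V' T'"
    by (simp add: locally_convex_space_def linear_topological_space_def V' topT' car case_prod_unfold)
  show "p \<in> linear_operators V' V" "continuous_map T' TV p" by (fact lin cp)+
qed

lemma span_representation:
  fixes f :: "'c \<Rightarrow> 'v"
  assumes V: "module real_ring V" and f: "f \<in> S \<rightarrow> carrier V"
  shows "\<exists>p :: ('c \<Rightarrow> real) \<Rightarrow> 'v. \<exists>C. bij_betw p C (span_in V (f ` S))"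
proof -
  interpret V: module real_ring V by (rule V)
  define supp :: "('c \<Rightarrow> real) \<Rightarrow> 'c set" where "supp c = {x. c x \<noteq> 0}" for c
  define D where "D = {c. finite (supp c) \<and> supp c \<subseteq> S}"
  define p where "p c = (\<Oplus>\<^bsub>V\<^esub>x\<in>supp c. c x \<odot>\<^bsub>V\<^esub> f x)" for c :: "'c \<Rightarrow> real"
  have fS: "f x \<in> carrier V" if "x \<in> S" for x using that f by auto
  have cf: "c \<odot>\<^bsub>V\<^esub> f x \<in> carrier V" if "x \<in> S" for c x
    using V.smult_closed[of c "f x"] fS[OF that] by simp
  have null: "0 \<odot>\<^bsub>V\<^esub> v = \<zero>\<^bsub>V\<^esub>" if "v \<in> carrier V" for v using V.smult_l_null[OF that] by simp
  have p_eq: "p c = (\<Oplus>\<^bsub>V\<^esub>x\<in>F. c x \<odot>\<^bsub>V\<^esub> f x)" if "finite F" "supp c \<subseteq> F" "F \<subseteq> S" for c F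
    unfolding p_def using that
    by (intro V.add.finprod_mono_neutral_cong_left) (auto simp: supp_def null fS cf subset_iff)
  have pD: "p c \<in> carrier V" if "c \<in> D" for c
    unfolding p_def using that by (intro V.finsum_closed) (auto simp: D_def cf)
  have p_smult: "p (\<lambda>x. a * c x) = a \<odot>\<^bsub>V\<^esub> p c \<and> (\<lambda>x. a * c x) \<in> D" if c: "c \<in> D" for a c
  proof
    have F: "finite (supp c)" "supp c \<subseteq> S" using c by (auto simp: D_def)
    have sub: "supp (\<lambda>x. a * c x) \<subseteq> supp c" by (auto simp: supp_def)
    then show "(\<lambda>x. a * c x) \<in> D" using F by (auto simp: D_def intro: finite_subset)
    have "a \<odot>\<^bsub>V\<^esub> p c = (\<Oplus>\<^bsub>V\<^esub>x\<in>supp c. a \<odot>\<^bsub>V\<^esub> (c x \<odot>\<^bsub>V\<^esub> f x))"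
      unfolding p_def using F by (intro V.finsum_smult_ldistr) (auto simp: cf)
    also have "\<dots> = (\<Oplus>\<^bsub>V\<^esub>x\<in>supp c. (a * c x) \<odot>\<^bsub>V\<^esub> f x)"
    proof (rule V.add.finprod_cong')
      fix x assume "x \<in> supp c"
      then have "f x \<in> carrier V" using F fS by auto
      then show "a \<odot>\<^bsub>V\<^esub> (c x \<odot>\<^bsub>V\<^esub> f x) = (a * c x) \<odot>\<^bsub>V\<^esub> f x"
        using V.smult_assoc1[of a "c x" "f x"] by simp
    qed (use F cf in auto)
    also have "\<dots> = p (\<lambda>x. a * c x)" by (rule p_eq[OF F(1) sub F(2), symmetric])
    finally show "p (\<lambda>x. a * c x) = a \<odot>\<^bsub>V\<^esub> p c" by simp
  qed
  have p_add: "p (\<lambda>x. c x + d x) = p c \<oplus>\<^bsub>V\<^esub> p d \<and> (\<lambda>x. c x + d x) \<in> D"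
    if c: "c \<in> D" and d: "d \<in> D" for c d
  proof
    define F where "F = supp c \<union> supp d"
    have F: "finite F" "F \<subseteq> S" using c d by (auto simp: F_def D_def)
    have sub: "supp (\<lambda>x. c x + d x) \<subseteq> F" by (auto simp: F_def supp_def)
    then show "(\<lambda>x. c x + d x) \<in> D" using F by (auto simp: D_def intro: finite_subset)
    have cfF: "r \<odot>\<^bsub>V\<^esub> f x \<in> carrier V" if "x \<in> F" for r x using that F cf by auto
    have "p (\<lambda>x. c x + d x) = (\<Oplus>\<^bsub>V\<^esub>x\<in>F. (c x + d x) \<odot>\<^bsub>V\<^esub> f x)" by (rule p_eq[OF F(1) sub F(2)])
    also have "\<dots> = (\<Oplus>\<^bsub>V\<^esub>x\<in>F. c x \<odot>\<^bsub>V\<^esub> f x \<oplus>\<^bsub>V\<^esub> d x \<odot>\<^bsub>V\<^esub> f x)"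
    proof (rule V.add.finprod_cong')
      fix x assume "x \<in> F"
      then have "f x \<in> carrier V" using F fS by auto
      then show "(c x + d x) \<odot>\<^bsub>V\<^esub> f x = c x \<odot>\<^bsub>V\<^esub> f x \<oplus>\<^bsub>V\<^esub> d x \<odot>\<^bsub>V\<^esub> f x"
        using V.smult_l_distr[of "c x" "d x" "f x"] by simp
    qed (use cfF in auto)
    also have "\<dots> = (\<Oplus>\<^bsub>V\<^esub>x\<in>F. c x \<odot>\<^bsub>V\<^esub> f x) \<oplus>\<^bsub>V\<^esub> (\<Oplus>\<^bsub>V\<^esub>x\<in>F. d x \<odot>\<^bsub>V\<^esub> f x)"
      by (rule V.finsum_addf) (auto simp: cfF)
    also have "\<dots> = p c \<oplus>\<^bsub>V\<^esub> p d"
      using p_eq[of F c] p_eq[of F d] F by (simp add: F_def)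
    finally show "p (\<lambda>x. c x + d x) = p c \<oplus>\<^bsub>V\<^esub> p d" .
  qed
  have p_zero: "p (\<lambda>x. 0) = \<zero>\<^bsub>V\<^esub> \<and> (\<lambda>x. 0) \<in> D" by (auto simp: p_def supp_def D_def)
  have "submodule (p ` D) real_ring V"
  proof (rule V.submoduleI)
    show "p ` D \<subseteq> carrier V" using pD by auto
    show "\<zero>\<^bsub>V\<^esub> \<in> p ` D" using p_zero by force
    show sm: "a \<odot>\<^bsub>V\<^esub> y \<in> p ` D" if y: "y \<in> p ` D" for a y
    proof -
      obtain c where c: "y = p c" "c \<in> D" using y by blast
      then show ?thesis using p_smult[OF c(2), of a] by (metis imageI)
    qed
    have neg: "(-1) \<odot>\<^bsub>V\<^esub> y = \<ominus>\<^bsub>V\<^esub> y" if "y \<in> carrier V" for y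
    proof -
      have "(-1) \<odot>\<^bsub>V\<^esub> y \<oplus>\<^bsub>V\<^esub> y = (-1) \<odot>\<^bsub>V\<^esub> y \<oplus>\<^bsub>V\<^esub> 1 \<odot>\<^bsub>V\<^esub> y"
        using V.smult_one[OF that] by simp
      also have "\<dots> = \<zero>\<^bsub>V\<^esub>"
        using V.smult_l_distr[of "-1" 1 y] that null[OF that] by simp
      finally show ?thesis
        using V.minus_equality[of "(-1) \<odot>\<^bsub>V\<^esub> y" y] V.smult_closed[of "-1" y] that by simp
    qed
    show "\<ominus>\<^bsub>V\<^esub> y \<in> p ` D" if y: "y \<in> p ` D" for y
    proof -
      have "y \<in> carrier V" using y pD by blast
      then show ?thesis using neg[of y] sm[OF y, of "-1"] by simp
    qed
    show "y \<oplus>\<^bsub>V\<^esub> z \<in> p ` D" if y: "y \<in> p ` D" and z: "z \<in> p ` D" for y z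
    proof -
      obtain c d where c: "y = p c" "c \<in> D" and d: "z = p d" "d \<in> D" using y z by blast
      then show ?thesis using p_add[OF c(2) d(2)] by (metis imageI)
    qed
  qed
  moreover have "f ` S \<subseteq> p ` D"
  proof (rule image_subsetI)
    fix x assume x: "x \<in> S"
    have "p (\<lambda>y. if y = x then 1 else 0) = (\<Oplus>\<^bsub>V\<^esub>y\<in>{x}. (if y = x then 1 else 0) \<odot>\<^bsub>V\<^esub> f y)"
      by (rule p_eq) (use x in \<open>auto simp: supp_def\<close>)
    also have "\<dots> = f x" using V.smult_one[OF fS[OF x]] fS[OF x] by (simp add: V.finsum_insert)
    finally have "p (\<lambda>y. if y = x then 1 else 0) = f x" .
    moreover have "(\<lambda>y. if y = x then 1 else 0) \<in> D" using x by (auto simp: D_def supp_def)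
    ultimately show "f x \<in> p ` D" by force
  qed
  ultimately have "span_in V (f ` S) \<subseteq> p ` D" by (rule span_in_minimal)
  then obtain C where "C \<subseteq> D" "inj_on p C" "span_in V (f ` S) = p ` C"
    unfolding subset_image_inj by blast
  then show ?thesis by (metis bij_betw_def)
qed

lemma free_locally_convex_space_factor:
  fixes X :: "'a topology" and Y :: "(real, 'v) module"
  assumes L: "free_locally_convex_space X L TL j"
    and Y: "locally_convex_space Y TY" and f: "continuous_map X TY f"
  shows "\<exists>h. h \<in> extensional (carrier L) \<and> h \<in> linear_operators L Y \<and> continuous_map TL TY h \<and>
            (\<forall>x\<in>topspace X. f x = h (j x)) \<and> h ` carrier L \<subseteq> span_in Y (f ` topspace X)"
proof -
  have Ymod: "module real_ring Y" and topY: "topspace TY = carrier Y"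
    using Y by (auto simp: locally_convex_space_def linear_topological_space_def)
  have L': "locally_convex_space L TL" and j: "continuous_map X TL j"
    using L by (auto simp: free_locally_convex_space_def)
  have Lmod: "module real_ring L" and topL: "topspace TL = carrier L"
    using L' by (auto simp: locally_convex_space_def linear_topological_space_def)
  interpret L: module real_ring L by (rule Lmod)
  define H where "H = span_in Y (f ` topspace X)"
  have fY: "f \<in> topspace X \<rightarrow> carrier Y" using f topY by (auto simp: continuous_map_def)
  then have H: "submodule H real_ring Y" unfolding H_def by (intro submodule_span_in[OF Ymod]) auto
  from span_representation[OF Ymod fY]
  obtain p :: "('a \<Rightarrow> real) \<Rightarrow> 'v" and C where p: "bij_betw p C H" unfolding H_def by blast
  define Y' where "Y' = module_pull C p Y"
  define T' where "T' = pullback_topology C p TY"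
  have Y': "locally_convex_space Y' T'" and lin: "p \<in> linear_operators Y' Y"
    and cp: "continuous_map T' TY p"
    using locally_convex_space_pull[OF Y H p] by (auto simp: Y'_def T'_def)
  have car: "carrier Y' = C" by (simp add: Y'_def module_pull_def)
  define q where "q = inv_into C p"
  have fH: "f x \<in> H" if "x \<in> topspace X" for x
    using that span_in_superset[of "f ` topspace X" Y] by (auto simp: H_def)
  have qC: "q y \<in> C" and pq: "p (q y) = y" if "y \<in> H" for y
    using that p unfolding q_def by (auto simp: bij_betw_inv_into_right bij_betw_def inv_into_into)
  have "continuous_map X T' (\<lambda>x. q (f x))"
    unfolding T'_def
  proof (rule continuous_map_pullback')
    show "continuous_map X TY (p \<circ> (\<lambda>x. q (f x)))"
      using f by (rule continuous_map_eq) (simp add: pq fH)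
  qed (auto simp: qC fH)
  moreover have "linear_factorization X L TL j Y' T'"
    using L Y' unfolding free_locally_convex_space_def by blast
  ultimately obtain k where k: "k \<in> linear_operators L Y'" "continuous_map TL T' k"
    "\<forall>x\<in>topspace X. q (f x) = k (j x)"
    unfolding linear_factorization_def by blast
  define h where "h = restrict (p \<circ> k) (carrier L)"
  have Lsm: "c \<odot>\<^bsub>L\<^esub> x \<in> carrier L" if "x \<in> carrier L" for c x
    using L.smult_closed[of c x] that by simp
  have "h \<in> linear_operators L Y"
    using k(1) lin unfolding linear_operators_def h_def by (auto simp: Pi_iff Lsm)
  moreover have "continuous_map TL TY h"
    using continuous_map_compose[OF k(2) cp] by (rule continuous_map_eq) (simp add: h_def topL)
  moreover have "\<forall>x\<in>topspace X. f x = h (j x)"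
  proof
    fix x assume x: "x \<in> topspace X"
    then have "j x \<in> carrier L" using j topL by (auto simp: continuous_map_def)
    then show "f x = h (j x)" using x k(3) pq[OF fH[OF x]] by (auto simp: h_def)
  qed
  moreover have "h ` carrier L \<subseteq> H"
    using k(1) p by (auto simp: h_def linear_operators_def car bij_betw_def)
  moreover have "h \<in> extensional (carrier L)" by (simp add: h_def)
  ultimately show ?thesis unfolding H_def by blast
qed

lemma free_locally_convex_space_spanned:
  assumes L: "free_locally_convex_space X L TL j"
  shows "carrier L \<subseteq> span_in L (j ` topspace X)"
proof -
  have L': "locally_convex_space L TL" and j: "continuous_map X TL j"
    using L by (auto simp: free_locally_convex_space_def)
  have topL: "topspace TL = carrier L" and Lmod: "module real_ring L"
    using L' by (auto simp: locally_convex_space_def linear_topological_space_def)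
  interpret L: module real_ring L by (rule Lmod)
  have jL: "j x \<in> carrier L" if "x \<in> topspace X" for x
    using that j topL by (auto simp: continuous_map_def)
  have Lsm: "c \<odot>\<^bsub>L\<^esub> x \<in> carrier L" if "x \<in> carrier L" for c x
    using L.smult_closed[of c x] that by simp
  from free_locally_convex_space_factor[OF L L' j] obtain h where
    h: "h \<in> extensional (carrier L)" "h \<in> linear_operators L L" "continuous_map TL TL h"
      "\<forall>x\<in>topspace X. j x = h (j x)" and hL: "h ` carrier L \<subseteq> span_in L (j ` topspace X)"
    by blast
  define e where "e = restrict id (carrier L)"
  have e: "e \<in> extensional (carrier L)" "e \<in> linear_operators L L" "\<forall>x\<in>topspace X. j x = e (j x)"
    using jL by (auto simp: e_def linear_operators_def Lsm)
  have "continuous_map TL TL e"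
    using continuous_map_id by (rule continuous_map_eq) (simp add: e_def topL)
  moreover have "linear_factorization X L TL j L TL"
    using L L' unfolding free_locally_convex_space_def by blast
  ultimately have "h = e"
    using h e j unfolding linear_factorization_def by blast
  then show ?thesis using hL by (auto simp: e_def)
qed

theorem free_locally_convex_space_universal:
  fixes Y :: "(real, 'v) module"
  assumes L: "free_locally_convex_space X L TL j" and Y: "locally_convex_space Y TY"
  shows "linear_factorization X L TL j Y TY"
  unfolding linear_factorization_def
proof (intro allI impI)
  fix f assume f: "continuous_map X TY f"
  have L': "locally_convex_space L TL" and j: "continuous_map X TL j"
    using L by (auto simp: free_locally_convex_space_def)
  have topL: "topspace TL = carrier L" and Lmod: "module real_ring L" and Ymod: "module real_ring Y"
    using L' Y by (auto simp: locally_convex_space_def linear_topological_space_def)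
  interpret L: module real_ring L by (rule Lmod)
  interpret Y: module real_ring Y by (rule Ymod)
  have jL: "j x \<in> carrier L" if "x \<in> topspace X" for x
    using that j topL by (auto simp: continuous_map_def)
  have Lsm: "c \<odot>\<^bsub>L\<^esub> x \<in> carrier L" if "x \<in> carrier L" for c x
    using L.smult_closed[of c x] that by simp
  from free_locally_convex_space_factor[OF L Y f] obtain h where
    h: "h \<in> extensional (carrier L)"
      "h \<in> linear_operators L Y \<and> continuous_map TL TY h \<and> (\<forall>x\<in>topspace X. f x = h (j x))"
    by blast
  show "\<exists>!h. h \<in> extensional (carrier L) \<and>
          h \<in> linear_operators L Y \<and> continuous_map TL TY h \<and> (\<forall>x\<in>topspace X. f x = h (j x))"
  proof (rule ex1_extensionalI[where P = "\<lambda>h. h \<in> linear_operators L Y \<and>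
        continuous_map TL TY h \<and> (\<forall>x\<in>topspace X. f x = h (j x))", OF h])
    fix k assume k: "k \<in> linear_operators L Y \<and> continuous_map TL TY k \<and>
      (\<forall>x\<in>topspace X. f x = k (j x))"
    define E where "E = {a \<in> carrier L. k a = h a}"
    have add: "g (a \<oplus>\<^bsub>L\<^esub> b) = g a \<oplus>\<^bsub>Y\<^esub> g b" and sm: "g (c \<odot>\<^bsub>L\<^esub> a) = c \<odot>\<^bsub>Y\<^esub> g a"
      if "g \<in> linear_operators L Y" "a \<in> carrier L" "b \<in> carrier L" for g a b c
      using that by (auto simp: linear_operators_def)
    have E_sm: "c \<odot>\<^bsub>L\<^esub> a \<in> E" if "a \<in> E" for a c
      using that sm[of k a a c] sm[of h a a c] h(2) k by (auto simp: E_def Lsm)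
    have neg: "\<ominus>\<^bsub>L\<^esub> a = (-1) \<odot>\<^bsub>L\<^esub> a" if "a \<in> carrier L" for a
    proof -
      have "(-1) \<odot>\<^bsub>L\<^esub> a \<oplus>\<^bsub>L\<^esub> a = (-1) \<odot>\<^bsub>L\<^esub> a \<oplus>\<^bsub>L\<^esub> 1 \<odot>\<^bsub>L\<^esub> a"
        using L.smult_one[OF that] by simp
      also have "\<dots> = \<zero>\<^bsub>L\<^esub>"
        using L.smult_l_distr[of "-1" 1 a] that L.smult_l_null[OF that] by simp
      finally show ?thesis
        using L.minus_equality[of "(-1) \<odot>\<^bsub>L\<^esub> a" a] Lsm[OF that] that by simp
    qed
    have E0: "\<zero>\<^bsub>L\<^esub> \<in> E"
    proof -
      have z: "g \<zero>\<^bsub>L\<^esub> = \<zero>\<^bsub>Y\<^esub>" if g: "g \<in> linear_operators L Y" for g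
      proof -
        have "g \<zero>\<^bsub>L\<^esub> \<in> carrier Y" using g L.zero_closed by (auto simp: linear_operators_def)
        then show ?thesis
          using sm[OF g L.zero_closed L.zero_closed, of 0] Y.smult_l_null L.smult_l_null[OF L.zero_closed]
          by simp
      qed
      show ?thesis using z[of h] z[of k] h(2) k by (simp add: E_def)
    qed
    have "submodule E real_ring L"
    proof (rule L.submoduleI)
      show "\<ominus>\<^bsub>L\<^esub> a \<in> E" if "a \<in> E" for a using E_sm[OF that] neg[of a] that by (simp add: E_def)
      show "a \<oplus>\<^bsub>L\<^esub> b \<in> E" if "a \<in> E" "b \<in> E" for a b
        using that add[of k a b] add[of h a b] h(2) k by (auto simp: E_def)
    qed (auto simp: E0 E_sm, auto simp: E_def)
    moreover have "j ` topspace X \<subseteq> E" using jL h(2) k by (auto simp: E_def)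
    ultimately have "span_in L (j ` topspace X) \<subseteq> E" by (rule span_in_minimal)
    then show "\<forall>a\<in>carrier L. k a = h a"
      using free_locally_convex_space_spanned[OF L] by (auto simp: E_def)
  qed
qed

end

theory Submission
  imports Defs
begin

text \<open>Write a free object additively as \<open>F\<close>, with canonical map \<open>i\<close>; it is either \<open>A(X)\<close> or \<open>L(X)\<close>.
Its topology is handled through \<^emph>\<open>strings\<close>: sequences \<open>V\<close> of symmetric sets containing \<open>0\<close> with
\<open>V (m + 1) + V (m + 1) \<subseteq> V m\<close>. Every neighbourhood of \<open>0\<close> contains \<open>V 0\<close> for a string \<open>V\<close> of
neighbourhoods. Conversely, a string is a neighbourhood base at \<open>0\<close> of a group topology on \<open>F\<close>, so
by the universal property (applied to \<open>F\<close> with that topology) all \<open>V m\<close> are neighbourhoods of \<open>0\<close> as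
soon as \<open>i\<close> is continuous for it; as \<open>X\<close> is sequential, it suffices that \<open>x\<^sub>n \<longlonglongrightarrow> x\<close> implies
\<open>i x\<^sub>n - i x \<in> V m\<close> eventually, for each \<open>m\<close>. In \<open>L(X)\<close> the strings are the dilates \<open>2\<^sup>-\<^sup>m B\<close> of an
absolutely convex set \<open>B\<close>, and \<open>B\<close> also has to absorb the points \<open>i x\<close>.

The heart of the proof is a countable Pytkeev network at \<open>0\<close>. Fix a countable family \<open>\<N>\<close> of subsets
of \<open>X\<close> such that whenever \<open>x\<^sub>n \<longlonglongrightarrow> x \<in> U\<close> with \<open>U\<close> open, some \<open>N \<in> \<N>\<close> with \<open>N \<subseteq> U\<close> contains \<open>x\<close> and
almost all \<open>x\<^sub>n\<close>; finite unions of members of a \<open>k\<close>-network are such a family. Consider the countably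
many conditions \<open>i N - i N \<subseteq> V m\<close> on a string \<open>V\<close> (in \<open>L(X)\<close> also \<open>2\<^sup>-\<^sup>r i N \<subseteq> V 0\<close>), and for a
finite set \<open>\<F>\<close> of conditions let \<open>P \<F>\<close> be the intersection of the sets \<open>V 0\<close> over all strings \<open>V\<close> of
neighbourhoods satisfying \<open>\<F>\<close>. These sets \<open>P \<F>\<close> are the network. To see this, let \<open>A\<close> accumulate at
\<open>0\<close>, let \<open>V\<close> be a string of neighbourhoods and let \<open>\<F>\<^sub>n\<close> consist of the first \<open>n\<close> conditions that \<open>V\<close>
satisfies; then \<open>P \<F>\<^sub>n \<subseteq> V 0\<close>. Having a countable network, \<open>F\<close> is countably tight, so \<open>A\<close> may be taken to
be a sequence of distinct points \<open>a\<^sub>k\<close>. If every \<open>P \<F>\<^sub>n \<inter> A\<close> were finite, then for almost every \<open>k\<close>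
there would be a string \<open>W\<^sub>k\<close> of neighbourhoods with \<open>a\<^sub>k \<notin> W\<^sub>k 0\<close> that satisfies \<open>\<F>\<^sub>n\<close> for an \<open>n = n(k)\<close>
tending to infinity with \<open>k\<close>. If \<open>x\<^sub>n \<longlonglongrightarrow> x\<close>, continuity of \<open>i\<close> gives \<open>N \<in> \<N>\<close> that contains \<open>x\<close> and
almost all \<open>x\<^sub>n\<close> and satisfies \<open>i N - i N \<subseteq> V m\<close>; so \<open>i N - i N \<subseteq> W\<^sub>k m\<close> for almost all \<open>k\<close>. The other
\<open>W\<^sub>k m\<close> are finitely many neighbourhoods of \<open>0\<close>, hence \<open>i x\<^sub>n - i x\<close> lies in all \<open>W\<^sub>k m\<close> at once for
almost all \<open>n\<close>. By the first paragraph the intersection of all \<open>W\<^sub>k 0\<close> is a neighbourhood of \<open>0\<close>, although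
it contains only finitely many \<open>a\<^sub>k\<close>: a contradiction. The lemmas are
\<open>pytkeev_network_at_from_strings\<close>, \<open>eventually_in_all_strings\<close>,
\<open>free_abelian_topological_group_string\<close> and \<open>free_locally_convex_space_neighbourhood\<close>.

This resembles a passage to the bidual: \<open>P \<F>\<close> plays the role of the polar of a neighbourhood of a compact
set of functions on \<open>X\<close>, with strings in place of functionals, so that groups and linear spaces are
treated alike.

It remains to go from \<open>0\<close> to all points. \<open>F\<close> has a countable network \<open>\<B>\<close>, made of finite sums of the
sets \<open>i N\<close> and \<open>- i N\<close> (in \<open>L(X)\<close>, of \<open>M i N\<close> for \<open>M\<close> in a countable base of \<open>\<real>\<close>), and the sets \<open>B + P \<F>\<close> with \<open>B \<in> \<B>\<close> form a Pytkeev network of \<open>F\<close>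
(\<open>P0_space_from_one\<close>). Topological groups are regular, and \<open>F\<close> is \<open>T\<^sub>1\<close> because \<open>X\<close>, being regular and
Lindelof, is completely regular: a nonzero finite combination of points of \<open>X\<close> is not annihilated by a
continuous function that separates one of its points from the others.\<close>

section \<open>Countable networks\<close>

text \<open>The part of the \<open>k\<close>-network property that concerns convergent sequences. In a sequential space these
determine continuity, so this part is what the universal properties can be fed with.\<close>

definition cs_network :: "'a topology \<Rightarrow> 'a set set \<Rightarrow> bool" where
  "cs_network X \<N> \<longleftrightarrow>
    (\<forall>\<sigma> x U. limitin X \<sigma> x sequentially \<and> openin X U \<and> x \<in> U \<longrightarrow>
      (\<exists>N\<in>\<N>. N \<subseteq> U \<and> x \<in> N \<and> (\<forall>\<^sub>F n in sequentially. \<sigma> n \<in> N)))"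

lemma cs_networkE:
  assumes "cs_network X \<N>" "limitin X \<sigma> x sequentially" "openin X U" "x \<in> U"
  obtains N where "N \<in> \<N>" "N \<subseteq> U" "x \<in> N" "\<forall>\<^sub>F n in sequentially. \<sigma> n \<in> N"
  using assms unfolding cs_network_def by blast

lemma cs_network_network_at:
  assumes "cs_network X \<N>" "x \<in> topspace X"
  shows "network_at X \<N> x"
  unfolding network_at_def
proof (intro allI impI)
  fix U assume "openin X U \<and> x \<in> U"
  moreover have "limitin X (\<lambda>n. x) x sequentially"
    using assms(2) by simp
  ultimately show "\<exists>N\<in>\<N>. x \<in> N \<and> N \<subseteq> U"
    using cs_networkE[OF assms(1)] by metis
qed

text \<open>A convergent sequence inside an open set is, with its limit, a compact subset of that set.\<close>

lemma k_network_cs_network: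
  assumes "k_network X \<N>"
  shows "cs_network X {\<Union>\<F> |\<F>. finite \<F> \<and> \<F> \<subseteq> \<N>}"
  unfolding cs_network_def
proof (intro allI impI, elim conjE)
  fix \<sigma> x U
  assume lim: "limitin X \<sigma> x sequentially" and U: "openin X U" "x \<in> U"
  then have ev: "\<forall>\<^sub>F n in sequentially. \<sigma> n \<in> U" by (auto simp: limitin_def)
  define K where "K = insert x (range \<sigma> \<inter> U)"
  have "range \<sigma> \<inter> U \<subseteq> topspace X" using openin_subset[OF U(1)] by auto
  with lim have "compactin X K"
    unfolding K_def by (intro compactin_sequence_with_limit[of X \<sigma>]) auto
  moreover have "K \<subseteq> U" using U by (auto simp: K_def)
  ultimately obtain \<F> where \<F>: "finite \<F>" "\<F> \<subseteq> \<N>" "K \<subseteq> \<Union>\<F>" "\<Union>\<F> \<subseteq> U"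
    using assms U(1) unfolding k_network_def by meson
  have "\<forall>\<^sub>F n in sequentially. \<sigma> n \<in> \<Union>\<F>"
    using ev by eventually_elim (use \<F>(3) in \<open>auto simp: K_def\<close>)
  with \<F> show "\<exists>N\<in>{\<Union>\<F> |\<F>. finite \<F> \<and> \<F> \<subseteq> \<N>}. N \<subseteq> U \<and> x \<in> N \<and> (\<forall>\<^sub>F n in sequentially. \<sigma> n \<in> N)"
    by (intro bexI[of _ "\<Union>\<F>"]) (auto simp: K_def)
qed

lemma aleph0_space_cs_network:
  assumes "aleph0_space X"
  obtains \<N> where "countable \<N>" "\<Union>\<N> \<subseteq> topspace X" "cs_network X \<N>"
proof -
  obtain \<N> where \<N>: "countable \<N>" "k_network X \<N>"
    using assms by (auto simp: aleph0_space_def)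
  have "{\<Union>\<F> |\<F>. finite \<F> \<and> \<F> \<subseteq> \<N>} = Union ` {\<F>. finite \<F> \<and> \<F> \<subseteq> \<N>}"
    by auto
  then have "countable {\<Union>\<F> |\<F>. finite \<F> \<and> \<F> \<subseteq> \<N>}"
    using countable_Collect_finite_subset[OF \<N>(1)] by simp
  moreover have "\<Union>{\<Union>\<F> |\<F>. finite \<F> \<and> \<F> \<subseteq> \<N>} \<subseteq> topspace X"
    using \<N>(2) by (auto simp: k_network_def)
  ultimately show ?thesis by (rule that[OF _ _ k_network_cs_network[OF \<N>(2)]])
qed

lemma network_at_image:
  assumes f: "continuous_map X Y f" and \<N>: "network_at X \<N> x" and x: "x \<in> topspace X"
  shows "network_at Y ((`) f ` \<N>) (f x)"
  unfolding network_at_def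
proof (intro allI impI, elim conjE)
  fix U assume U: "openin Y U" "f x \<in> U"
  have "openin X {y \<in> topspace X. f y \<in> U}" by (rule openin_continuous_map_preimage[OF f U(1)])
  moreover have "x \<in> {y \<in> topspace X. f y \<in> U}" using U(2) x by simp
  ultimately obtain N where "N \<in> \<N>" "x \<in> N" "N \<subseteq> {y \<in> topspace X. f y \<in> U}"
    using \<N> unfolding network_at_def by meson
  then show "\<exists>N\<in>(`) f ` \<N>. f x \<in> N \<and> N \<subseteq> U" by blast
qed

lemma network_at_mono:
  assumes "network_at X \<N> x" "\<N> \<subseteq> \<M>"
  shows "network_at X \<M> x"
  using assms unfolding network_at_def by (meson subsetD)

lemma network_at_prod:
  assumes "network_at X \<M> x" "network_at Y \<N> y"
  shows "network_at (prod_topology X Y) ((\<lambda>(M, N). M \<times> N) ` (\<M> \<times> \<N>)) (x, y)"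
  unfolding network_at_def
proof (intro allI impI, elim conjE)
  fix U assume "openin (prod_topology X Y) U" "(x, y) \<in> U"
  then obtain P Q where PQ: "openin X P" "openin Y Q" "x \<in> P" "y \<in> Q" "P \<times> Q \<subseteq> U"
    unfolding openin_prod_topology_alt by meson
  obtain M where M: "M \<in> \<M>" "x \<in> M" "M \<subseteq> P"
    using assms(1) PQ(1,3) unfolding network_at_def by meson
  obtain N where N: "N \<in> \<N>" "y \<in> N" "N \<subseteq> Q"
    using assms(2) PQ(2,4) unfolding network_at_def by meson
  have "M \<times> N \<subseteq> U" using M(3) N(3) PQ(5) by blast
  then show "\<exists>N\<in>(\<lambda>(M, N). M \<times> N) ` (\<M> \<times> \<N>). (x, y) \<in> N \<and> N \<subseteq> U"
    using M(1,2) N(1,2) by (intro bexI[of _ "M \<times> N"]) auto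
qed

lemma countable_network_Lindelof_space:
  assumes \<N>: "countable \<N>" "\<And>x. x \<in> topspace X \<Longrightarrow> network_at X \<N> x"
  shows "Lindelof_space X"
  unfolding Lindelof_space_def
proof (intro allI impI, elim conjE)
  fix \<U> assume \<U>: "\<forall>U\<in>\<U>. openin X U" "\<Union>\<U> = topspace X"
  define \<M> where "\<M> = {N \<in> \<N>. \<exists>U\<in>\<U>. N \<subseteq> U}"
  define pick where "pick N = (SOME U. U \<in> \<U> \<and> N \<subseteq> U)" for N
  have pick: "pick N \<in> \<U>" "N \<subseteq> pick N" if "N \<in> \<M>" for N
    using someI_ex[of "\<lambda>U. U \<in> \<U> \<and> N \<subseteq> U"] that unfolding pick_def \<M>_def by blast+
  have "topspace X \<subseteq> \<Union>(pick ` \<M>)"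
  proof
    fix x assume x: "x \<in> topspace X"
    then obtain U where U: "U \<in> \<U>" "x \<in> U" using \<U>(2) by blast
    then obtain N where "N \<in> \<N>" "x \<in> N" "N \<subseteq> U"
      using \<N>(2)[OF x] \<U>(1) unfolding network_at_def by blast
    with U have "N \<in> \<M>" by (auto simp: \<M>_def)
    with pick(2) \<open>x \<in> N\<close> show "x \<in> \<Union>(pick ` \<M>)" by blast
  qed
  moreover have "pick ` \<M> \<subseteq> \<U>" using pick(1) by blast
  moreover have "countable (pick ` \<M>)" using \<N>(1) by (simp add: \<M>_def)
  ultimately show "\<exists>\<V>. countable \<V> \<and> \<V> \<subseteq> \<U> \<and> \<Union>\<V> = topspace X"
    using \<U>(2) by (intro exI[of _ "pick ` \<M>"]) blast
qed

text \<open>A regular space with a countable network is Lindelof, hence normal.\<close>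

lemma aleph0_space_completely_regular_space:
  assumes "aleph0_space X"
  shows "completely_regular_space X"
proof -
  obtain \<N> where "countable \<N>" "cs_network X \<N>"
    using aleph0_space_cs_network[OF assms] by metis
  then have "Lindelof_space X"
    using countable_network_Lindelof_space cs_network_network_at by metis
  moreover have "regular_space X" using assms by (simp add: aleph0_space_def t3_space_def)
  ultimately show ?thesis
    by (intro normal_imp_completely_regular_space_B regular_Lindelof_imp_normal_space)
qed

lemma separate_point_from_finite:
  assumes "completely_regular_space X" "t1_space X" "x \<in> topspace X" "finite F" "F \<subseteq> topspace X"
    "x \<notin> F"
  obtains f where "continuous_map X euclideanreal f" "f x = 1" "\<And>y. y \<in> F \<Longrightarrow> f y = 0"
proof -
  have "closedin X F" using iffD1[OF t1_space_closedin_finite assms(2)] assms(4,5) by blast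
  then obtain g where g: "continuous_map X euclideanreal g" "g x = 0" "g ` F \<subseteq> {1}"
    using assms(1,3,6) unfolding completely_regular_space_alt by (metis DiffI)
  show ?thesis
  proof (rule that[of "\<lambda>y. 1 - g y"])
    show "continuous_map X euclideanreal (\<lambda>y. 1 - g y)"
      by (intro continuous_map_diff g(1)) simp
    show "1 - g x = 1" using g(2) by simp
    show "1 - g y = 0" if "y \<in> F" for y using g(3) that by (simp add: image_subset_iff)
  qed
qed

text \<open>Countable tightness, for accumulation: one point of \<open>A - {x}\<close> chosen in each member of the network
that meets this set suffices. If only finitely many chosen points lay in a neighbourhood \<open>U\<close> of \<open>x\<close>,
removing them would leave a neighbourhood of \<open>x\<close>, in which some member of the network contains a point of
\<open>A - {x}\<close>, and then also a chosen point.\<close>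

lemma countable_network_countable_accumulation:
  assumes \<N>: "countable \<N>" "\<And>x. x \<in> topspace X \<Longrightarrow> network_at X \<N> x" and t1: "t1_space X"
    and A: "A \<subseteq> topspace X" "accumulates_at X A x"
  shows "\<exists>D. countable D \<and> D \<subseteq> A \<and> accumulates_at X D x"
proof -
  define \<M> where "\<M> = {N \<in> \<N>. N \<inter> A - {x} \<noteq> {}}"
  define pick where "pick N = (SOME a. a \<in> N \<inter> A - {x})" for N
  have pick: "pick N \<in> N \<inter> A - {x}" if "N \<in> \<M>" for N
  proof -
    have "\<exists>a. a \<in> N \<inter> A - {x}" using that unfolding \<M>_def by blast
    then show ?thesis unfolding pick_def by (rule someI_ex)
  qed
  define D where "D = pick ` \<M>"
  have DA: "D \<subseteq> A" "x \<notin> D" using pick unfolding D_def by blast+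
  have "infinite (U \<inter> D)" if U: "openin X U" "x \<in> U" for U
  proof
    assume fin: "finite (U \<inter> D)"
    have "U \<inter> D \<subseteq> topspace X" using DA(1) A(1) by blast
    with fin have "closedin X (U \<inter> D)" by (simp add: iffD1[OF t1_space_closedin_finite t1])
    then have V: "openin X (U - U \<inter> D)" by (rule openin_diff[OF U(1)])
    moreover have "x \<in> U - U \<inter> D" using U(2) DA(2) by blast
    ultimately have "infinite ((U - U \<inter> D) \<inter> A)" using A(2) by (simp add: accumulates_at_def)
    then have "infinite ((U - U \<inter> D) \<inter> A - {x})" by simp
    then obtain a where a: "a \<in> U - U \<inter> D" "a \<in> A" "a \<noteq> x"
      using infinite_imp_nonempty by blast
    from a(2) A(1) have "network_at X \<N> a" by (intro \<N>(2)) blast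
    with V a(1) obtain N where N: "N \<in> \<N>" "a \<in> N" "N \<subseteq> U - U \<inter> D"
      unfolding network_at_def by meson
    with a have "N \<in> \<M>" by (auto simp: \<M>_def)
    with pick[OF this] N(3) show False by (auto simp: D_def)
  qed
  then have acc: "accumulates_at X D x" unfolding accumulates_at_def by blast
  have "\<M> \<subseteq> \<N>" unfolding \<M>_def by blast
  then have cM: "countable \<M>" using \<N>(1) by (rule countable_subset)
  have "countable D" unfolding D_def using cM by (rule countable_image)
  with acc DA(1) show ?thesis by blast
qed

lemma sequential_space_continuous_map:
  assumes X: "sequential_space X" and f: "f \<in> topspace X \<rightarrow> topspace Y"
    and lim: "\<And>\<sigma> x. range \<sigma> \<subseteq> topspace X \<Longrightarrow> limitin X \<sigma> x sequentially \<Longrightarrow>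
      limitin Y (\<lambda>n. f (\<sigma> n)) (f x) sequentially"
  shows "continuous_map X Y f"
  unfolding continuous_map_closedin
proof (intro conjI allI impI f)
  fix C assume C: "closedin Y C"
  let ?A = "{x \<in> topspace X. f x \<in> C}"
  show "closedin X ?A"
  proof (rule ccontr)
    assume "\<not> closedin X ?A"
    then have "\<exists>\<sigma> x. range \<sigma> \<subseteq> ?A \<and> x \<in> topspace X - ?A \<and> limitin X \<sigma> x sequentially"
      using X[unfolded sequential_space_def, rule_format, of ?A] by simp
    then obtain \<sigma> x
      where \<sigma>: "range \<sigma> \<subseteq> ?A" "x \<in> topspace X - ?A" "limitin X \<sigma> x sequentially"
      by (elim exE conjE)
    have "range \<sigma> \<subseteq> topspace X" using \<sigma>(1) by blast
    from lim[OF this \<sigma>(3)] have l: "limitin Y (\<lambda>n. f (\<sigma> n)) (f x) sequentially" .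
    have "f (\<sigma> n) \<in> C" for n using \<sigma>(1) by blast
    then have "f x \<in> C"
      by (intro limitin_closedin[OF l C]) simp_all
    with \<sigma>(2) show False by blast
  qed
qed


section \<open>A countable Pytkeev network from countably many conditions\<close>

text \<open>Each \<open>V \<in> \<V>\<close> stands for the neighbourhood \<open>V 0\<close> of \<open>e\<close> and may satisfy some of the conditions
\<open>(E, m) \<in> C\<close>, meaning \<open>E \<subseteq> V m\<close>. The assumption \<open>inter\<close> is a form of compactness: a sequence in \<open>\<V>\<close>
that eventually satisfies each condition satisfied by \<open>V\<close> has a common neighbourhood of \<open>e\<close> in its
zeroth members. It lets countably many neighbourhoods, one missing each point of a sequence \<open>d\<close>, be
replaced by a single neighbourhood, which then contradicts the accumulation of the sequence at \<open>e\<close>.\<close>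

lemma pytkeev_network_at_from_strings:
  fixes T :: "'g topology" and \<V> :: "(nat \<Rightarrow> 'g set) set" and C :: "('g set \<times> nat) set"
  assumes net: "countable \<B>" "\<And>x. x \<in> topspace T \<Longrightarrow> network_at T \<B> x" and t1: "t1_space T"
    and e: "e \<in> topspace T"
    and base: "\<And>U. openin T U \<Longrightarrow> e \<in> U \<Longrightarrow> \<exists>V\<in>\<V>. V 0 \<subseteq> U"
    and mem: "\<And>V. V \<in> \<V> \<Longrightarrow> e \<in> V 0"
    and C: "countable C"
    and inter: "\<And>V W. V \<in> \<V> \<Longrightarrow> (\<And>k. W k \<in> \<V>) \<Longrightarrow>
      (\<And>E m. (E, m) \<in> C \<Longrightarrow> E \<subseteq> V m \<Longrightarrow> \<forall>\<^sub>F k in sequentially. E \<subseteq> W k m) \<Longrightarrow>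
      \<exists>Q. openin T Q \<and> e \<in> Q \<and> (\<forall>k::nat. Q \<subseteq> W k 0)"
  shows "\<exists>\<N>. countable \<N> \<and> \<N> \<subseteq> Pow (topspace T) \<and> pytkeev_network_at T \<N> e"
proof -
  define sat :: "('g set \<times> nat) set \<Rightarrow> (nat \<Rightarrow> 'g set) \<Rightarrow> bool"
    where "sat F V \<longleftrightarrow> (\<forall>(E, m)\<in>F. E \<subseteq> V m)" for F V
  define P where "P F = {a \<in> topspace T. \<forall>V\<in>\<V>. sat F V \<longrightarrow> a \<in> V 0}" for F
  define \<N> where "\<N> = P ` {F. finite F \<and> F \<subseteq> C}"
  have sat_mono: "sat F V" if "sat F' V" "F \<subseteq> F'" for F F' V
    using that unfolding sat_def by blast
  have eP: "e \<in> P F" for F using e mem by (simp add: P_def)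
  have PV: "P F \<subseteq> V 0" if "V \<in> \<V>" "sat F V" for F V
    using that by (auto simp: P_def)
  have "countable \<N>"
    unfolding \<N>_def by (rule countable_image[OF countable_Collect_finite_subset[OF C]])
  moreover have "\<N> \<subseteq> Pow (topspace T)" by (auto simp: \<N>_def P_def)
  moreover have "pytkeev_network_at T \<N> e"
    unfolding pytkeev_network_at_def
  proof (intro conjI allI impI; (elim conjE)?)
    show "network_at T \<N> e"
      unfolding network_at_def
    proof (intro allI impI, elim conjE)
      fix U assume "openin T U" "e \<in> U"
      then obtain V where V: "V \<in> \<V>" "V 0 \<subseteq> U" using base by meson
      have "P {} \<subseteq> U" using PV[OF V(1), of "{}"] V(2) by (simp add: sat_def)
      then show "\<exists>N\<in>\<N>. e \<in> N \<and> N \<subseteq> U"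
        using eP[of "{}"] by (intro bexI[of _ "P {}"]) (simp_all add: \<N>_def)
    qed
    fix U A
    assume U: "openin T U" "e \<in> U" and A: "A \<subseteq> topspace T" "accumulates_at T A e"
    show "\<exists>N\<in>\<N>. N \<subseteq> U \<and> infinite (N \<inter> A)"
    proof (rule ccontr)
      assume none: "\<not> (\<exists>N\<in>\<N>. N \<subseteq> U \<and> infinite (N \<inter> A))"
      obtain D where D: "countable D" "D \<subseteq> A" "accumulates_at T D e"
        using countable_network_countable_accumulation[OF net t1 A] by blast
      have acc: "infinite (Q \<inter> D)" if "openin T Q" "e \<in> Q" for Q
        using D(3) that by (simp add: accumulates_at_def)
      have infD: "infinite D" using acc[OF openin_topspace e] finite_Int by metis
      define d where "d = from_nat_into D"
      have d: "bij_betw d UNIV D"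
        unfolding d_def by (rule bij_betw_from_nat_into[OF D(1) infD])
      obtain V where V: "V \<in> \<V>" "V 0 \<subseteq> U" using base[OF U] by blast
      define S where "S = {(E, m) \<in> C. E \<subseteq> V m}"
      have S: "countable S" "S \<subseteq> C"
        using C by (auto simp: S_def intro: countable_subset[of _ C])
      define F where "F n = {c \<in> S. to_nat_on S c < n}" for n
      have Fmono: "F m \<subseteq> F n" if "m \<le> n" for m n using that by (auto simp: F_def)
      have finF: "finite (F n)" for n
      proof (rule finite_imageD)
        show "finite (to_nat_on S ` F n)" by (rule finite_subset[of _ "{..<n}"]) (auto simp: F_def)
        show "inj_on (to_nat_on S) (F n)"
          by (rule inj_on_subset[OF inj_on_to_nat_on[OF S(1)]]) (auto simp: F_def)
      qed
      have satV: "sat (F n) V" for n unfolding sat_def F_def S_def by blast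
      have finP: "finite (P (F n) \<inter> D)" for n
      proof -
        have "P (F n) \<in> \<N>" unfolding \<N>_def using finF[of n] S(2) by (auto simp: F_def)
        moreover have "P (F n) \<subseteq> U" using PV[OF V(1) satV[of n]] V(2) by blast
        ultimately have "finite (P (F n) \<inter> A)" using none by blast
        then show ?thesis by (rule rev_finite_subset) (use D(2) in blast)
      qed
      \<comment> \<open>\<open>N k\<close> is the largest \<open>n \<le> k\<close> such that \<open>P (F n)\<close> misses \<open>d k\<close>, or \<open>0\<close> if there is none; each set \<open>P (F n)\<close> contains only finitely many \<open>d k\<close>, so \<open>N k\<close> tends to infinity. The bound \<open>n \<le> k\<close> keeps the maximum defined for a point \<open>d k\<close> that all these sets miss.\<close>
    define N where "N k = Max {n. n \<le> k \<and> (n = 0 \<or> d k \<notin> P (F n))}" for k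
      have Nfin: "finite {n. n \<le> k \<and> (n = 0 \<or> d k \<notin> P (F n))}" for k
        by (rule finite_subset[of _ "{..k}"]) auto
      have N: "N k = 0 \<or> d k \<notin> P (F (N k))" for k
        using Max_in[OF Nfin[of k]] unfolding N_def by blast
      have "\<exists>W. W \<in> \<V> \<and> sat (F (N k)) W \<and> (d k \<notin> P (F (N k)) \<longrightarrow> d k \<notin> W 0)" for k
      proof (cases "d k \<in> P (F (N k))")
        case True then show ?thesis using V(1) satV by blast
      next
        case False
        moreover have "d k \<in> topspace T"
          using d D(2) A(1) by (auto simp: bij_betw_def)
        ultimately show ?thesis unfolding P_def by blast
      qed
      then obtain W where W: "\<And>k. W k \<in> \<V>" "\<And>k. sat (F (N k)) (W k)"
        "\<And>k. d k \<notin> P (F (N k)) \<Longrightarrow> d k \<notin> W k 0" by metis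
      have "\<forall>\<^sub>F k in sequentially. E \<subseteq> W k m" if c: "(E, m) \<in> C" "E \<subseteq> V m" for E m
      proof -
        define j where "j = Suc (to_nat_on S (E, m))"
        have cF: "(E, m) \<in> F j" using c by (simp add: F_def S_def j_def)
        have "d -` P (F j) = d -` (P (F j) \<inter> D)" using d by (auto simp: bij_betw_def)
        moreover have "finite (d -` (P (F j) \<inter> D))"
          by (rule finite_vimageI[OF finP]) (use d in \<open>simp add: bij_betw_def\<close>)
        ultimately have "\<forall>\<^sub>F k in sequentially. d k \<notin> P (F j)"
          unfolding cofinite_eq_sequentially[symmetric] eventually_cofinite by (simp add: vimage_def)
        with eventually_ge_at_top[of j] show ?thesis
        proof eventually_elim
          fix k assume "j \<le> k" "d k \<notin> P (F j)"
          then have "j \<le> N k" unfolding N_def by (intro Max_ge[OF Nfin]) simp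
          with cF Fmono have "(E, m) \<in> F (N k)" by blast
          with W(2)[of k] show "E \<subseteq> W k m" unfolding sat_def by blast
        qed
      qed
      then obtain Q where Q: "openin T Q" "e \<in> Q" "\<And>k. Q \<subseteq> W k 0"
        using inter[OF V(1), of W] W(1) by blast
      \<comment> \<open>A point of \<open>D\<close> in all \<open>W k 0\<close> escaped being missed, so its index \<open>N k\<close> is \<open>0\<close>.\<close>
    have "Q \<inter> D \<subseteq> P (F 0) \<inter> D"
      proof
        fix a assume a: "a \<in> Q \<inter> D"
        then obtain k where k: "a = d k" using d by (auto simp: bij_betw_def)
        then have "d k \<in> P (F (N k))" using W(3)[of k] Q(3)[of k] a by blast
        with N[of k] k a show "a \<in> P (F 0) \<inter> D" by auto
      qed
      with finP[of 0] acc[OF Q(1,2)] show False using finite_subset by blast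
    qed
  qed
  ultimately show ?thesis by blast
qed

section \<open>Topological abelian groups\<close>

locale topological_comm_group =
  fixes G :: "'g monoid" (structure) and T :: "'g topology"
  assumes topological_group: "abelian_topological_group G T"

sublocale topological_comm_group \<subseteq> comm_group G
  using topological_group by (simp add: abelian_topological_group_def)

context topological_comm_group
begin

lemma topspace_T [simp]: "topspace T = carrier G"
  using topological_group by (simp add: abelian_topological_group_def)

lemma openin_carrier: "openin T U \<Longrightarrow> x \<in> U \<Longrightarrow> x \<in> carrier G"
  using openin_subset by fastforce

lemma continuous_mult:
  "continuous_map S T f \<Longrightarrow> continuous_map S T g \<Longrightarrow> continuous_map S T (\<lambda>x. f x \<otimes> g x)"
  using topological_group by (auto simp: abelian_topological_group_def intro: continuous_map_binop)

lemma continuous_inv: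
  assumes "continuous_map S T f" shows "continuous_map S T (\<lambda>x. inv (f x))"
proof -
  have "continuous_map T T (\<lambda>x. inv x)"
    using topological_group by (simp add: abelian_topological_group_def)
  from continuous_map_compose[OF assms this] show ?thesis by (simp add: o_def)
qed

lemma openin_translate:
  assumes "openin T U" "a \<in> carrier G"
  shows "openin T {b \<in> carrier G. a \<otimes> b \<in> U}"
proof -
  have "continuous_map T T (\<lambda>b. a \<otimes> b)"
    by (intro continuous_mult continuous_map_id[unfolded id_def]) (simp add: assms)
  from openin_continuous_map_preimage[OF this assms(1)] show ?thesis by simp
qed

lemma openin_inverse:
  assumes "openin T U"
  shows "openin T {b \<in> carrier G. inv b \<in> U}"
  using openin_continuous_map_preimage[OF continuous_inv[OF continuous_map_id] assms]
  by simp

lemma mult_neighbourhoods: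
  assumes "openin T U" "a \<otimes> b \<in> U" "a \<in> carrier G" "b \<in> carrier G"
  obtains P Q where "openin T P" "a \<in> P" "openin T Q" "b \<in> Q"
    "\<And>x y. x \<in> P \<Longrightarrow> y \<in> Q \<Longrightarrow> x \<otimes> y \<in> U"
proof -
  have "continuous_map (prod_topology T T) T (\<lambda>(x, y). x \<otimes> y)"
    using topological_group by (simp add: abelian_topological_group_def)
  from openin_continuous_map_preimage[OF this assms(1)]
  have "openin (prod_topology T T) {z \<in> carrier G \<times> carrier G. fst z \<otimes> snd z \<in> U}"
    by (simp add: case_prod_unfold)
  from iffD1[OF openin_prod_topology_alt this, rule_format, of a b]
  obtain P Q where PQ: "openin T P" "openin T Q" "a \<in> P" "b \<in> Q"
    "P \<times> Q \<subseteq> {z \<in> carrier G \<times> carrier G. fst z \<otimes> snd z \<in> U}"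
    using assms(2-4) by auto
  have "x \<otimes> y \<in> U" if "x \<in> P" "y \<in> Q" for x y
    using subsetD[OF PQ(5), of "(x, y)"] that by simp
  with PQ show ?thesis by (intro that) 
qed

text \<open>If \<open>a Q\<close> misses the closed set \<open>C\<close> for a neighbourhood \<open>Q\<close> of \<open>\<one>\<close>, then \<open>a N\<close> and \<open>C N\<close> are disjoint
whenever \<open>N N\<^sup>-\<^sup>1 \<subseteq> Q\<close>.\<close>

lemma regular_space_T: "regular_space T"
  unfolding regular_space_def
proof (intro allI impI, elim conjE)
  fix C a assume C: "closedin T C" and "a \<in> topspace T - C"
  then have a: "a \<in> carrier G" "a \<notin> C" by auto
  have Cc: "c \<in> carrier G" if "c \<in> C" for c using closedin_subset[OF C] that by auto
  have "openin T (carrier G - C)" using openin_diff[OF openin_topspace C] by simp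
  moreover have "a \<otimes> \<one> \<in> carrier G - C" using a by simp
  ultimately obtain Q where Q: "openin T Q" "\<one> \<in> Q"
    "\<And>y. y \<in> Q \<Longrightarrow> a \<otimes> y \<in> carrier G - C"
    using mult_neighbourhoods[of _ a \<one>] a(1) by (metis one_closed)
  from Q(2) have "\<one> \<otimes> \<one> \<in> Q" by simp
  with Q(1) obtain P R where PR: "openin T P" "\<one> \<in> P" "openin T R" "\<one> \<in> R"
    "\<And>x y. x \<in> P \<Longrightarrow> y \<in> R \<Longrightarrow> x \<otimes> y \<in> Q"
    using mult_neighbourhoods[of Q \<one> \<one>] by (metis one_closed)
  define N where "N = P \<inter> {b \<in> carrier G. inv b \<in> R}"
  have N: "openin T N" "\<one> \<in> N" unfolding N_def using PR(1-4) openin_inverse by auto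
  define U where "U = {b \<in> carrier G. inv a \<otimes> b \<in> N}"
  define V where "V = (\<Union>c\<in>C. {b \<in> carrier G. inv c \<otimes> b \<in> N})"
  have "openin T U" unfolding U_def using N(1) a(1) by (intro openin_translate) simp_all
  moreover have "openin T V"
    unfolding V_def using N(1) Cc by (intro openin_Union) (auto intro: openin_translate)
  moreover have "a \<in> U" using a(1) N(2) by (simp add: U_def)
  moreover have "C \<subseteq> V" using Cc N(2) by (auto simp: V_def intro!: bexI)
  moreover have "disjnt U V"
    unfolding disjnt_iff
  proof (intro allI notI, elim conjE)
    fix b assume "b \<in> U" "b \<in> V"
    then obtain c where b: "b \<in> carrier G" "inv a \<otimes> b \<in> N" and c: "c \<in> C" "inv c \<otimes> b \<in> N"
      by (auto simp: U_def V_def)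
    have cG: "c \<in> carrier G" by (rule Cc[OF c(1)])
    have "(inv a \<otimes> b) \<otimes> inv (inv c \<otimes> b) \<in> Q"
      using b(2) c(2) by (intro PR(5)) (simp_all add: N_def)
    moreover have "a \<otimes> ((inv a \<otimes> b) \<otimes> inv (inv c \<otimes> b)) = c"
    proof -
      have "inv (inv c \<otimes> b) = c \<otimes> inv b" using b(1) cG by (simp add: inv_mult)
      then have "(inv a \<otimes> b) \<otimes> inv (inv c \<otimes> b) = inv a \<otimes> (b \<otimes> (inv b \<otimes> c))"
        using a(1) b(1) cG by (simp add: m_assoc m_comm[of c])
      also have "\<dots> = inv a \<otimes> c" using b(1) cG by (simp add: m_assoc[symmetric])
      finally show ?thesis using a(1) cG by (simp add: m_assoc[symmetric])
    qed
    ultimately show False using Q(3) c(1) by force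
  qed
  ultimately show "\<exists>U V. openin T U \<and> openin T V \<and> a \<in> U \<and> C \<subseteq> V \<and> disjnt U V"
    by blast
qed

lemma t1_spaceI:
  assumes "\<And>a. a \<in> carrier G \<Longrightarrow> a \<noteq> \<one> \<Longrightarrow> \<exists>U. openin T U \<and> \<one> \<in> U \<and> a \<notin> U"
  shows "t1_space T"
  unfolding t1_space_def
proof (intro ballI impI, unfold topspace_T)
  fix x y assume xy: "x \<in> carrier G" "y \<in> carrier G" "x \<noteq> y"
  then have "inv x \<otimes> y \<noteq> \<one>" using inv_equality[of "inv x" y] by (metis inv_closed inv_inv inv_solve_left r_one one_closed)
  then obtain U where U: "openin T U" "\<one> \<in> U" "inv x \<otimes> y \<notin> U"
    using assms[of "inv x \<otimes> y"] xy(1,2) by auto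
  have "openin T {b \<in> carrier G. inv x \<otimes> b \<in> U}"
    using U(1) xy by (intro openin_translate) simp_all
  moreover have "x \<in> {b \<in> carrier G. inv x \<otimes> b \<in> U}" "y \<notin> {b \<in> carrier G. inv x \<otimes> b \<in> U}"
    using xy U by simp_all
  ultimately show "\<exists>U. openin T U \<and> x \<in> U \<and> y \<notin> U" by blast
qed

lemma network_at_set_mult:
  assumes "network_at T \<M> a" "network_at T \<N> b" "a \<in> carrier G" "b \<in> carrier G"
    and "openin T U" "a \<otimes> b \<in> U"
  obtains M N where "M \<in> \<M>" "N \<in> \<N>" "a \<in> M" "b \<in> N" "M <#> N \<subseteq> U"
proof -
  obtain P Q where PQ: "openin T P" "a \<in> P" "openin T Q" "b \<in> Q"
    "\<And>x y. x \<in> P \<Longrightarrow> y \<in> Q \<Longrightarrow> x \<otimes> y \<in> U"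
    using mult_neighbourhoods[OF assms(5,6,3,4)] by metis
  obtain M where M: "M \<in> \<M>" "a \<in> M" "M \<subseteq> P"
    using assms(1) PQ(1,2) unfolding network_at_def by meson
  obtain N where N: "N \<in> \<N>" "b \<in> N" "N \<subseteq> Q"
    using assms(2) PQ(3,4) unfolding network_at_def by meson
  have "M <#> N \<subseteq> U" using M(3) N(3) PQ(5) unfolding set_mult_def by blast
  with M N show ?thesis by (intro that)
qed

text \<open>The network consists of the finite products of members of \<open>\<M>\<close>. The assumption \<open>gen\<close> is the induction
principle of a group generated by \<open>S\<close> as a monoid.\<close>

lemma countable_network_generated:
  assumes \<M>: "countable \<M>" "\<Union>\<M> \<subseteq> carrier G" "\<And>s. s \<in> S \<Longrightarrow> network_at T \<M> s"
    and S: "S \<subseteq> carrier G"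
    and gen: "\<And>P a. P \<one> \<Longrightarrow> (\<And>b s. b \<in> carrier G \<Longrightarrow> s \<in> S \<Longrightarrow> P b \<Longrightarrow> P (s \<otimes> b)) \<Longrightarrow>
      a \<in> carrier G \<Longrightarrow> P a"
  shows "\<exists>\<B>. countable \<B> \<and> \<B> \<subseteq> Pow (carrier G) \<and> (\<forall>a\<in>carrier G. network_at T \<B> a)"
proof (intro exI conjI ballI)
  define \<B> where "\<B> = (\<lambda>Ms. foldr (<#>) Ms {\<one>}) ` lists \<M>"
  show "countable \<B>" unfolding \<B>_def using \<M>(1) by (intro countable_image countable_lists)
  have "foldr (<#>) Ms {\<one>} \<subseteq> carrier G" if "Ms \<in> lists \<M>" for Ms
    using that
  proof induction
    case (Cons M Ms)
    moreover have "M \<subseteq> carrier G" using \<M>(2) Cons by blast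
    ultimately show ?case by (simp add: set_mult_closed)
  qed simp
  then show "\<B> \<subseteq> Pow (carrier G)" by (auto simp: \<B>_def)
  fix a assume "a \<in> carrier G"
  then show "network_at T \<B> a"
  proof (rule gen[rotated 2])
    have "{\<one>} \<in> \<B>" unfolding \<B>_def by (rule image_eqI[of _ _ "[]"]) simp_all
    then show "network_at T \<B> \<one>" by (auto simp: network_at_def)
  next
    fix b s assume b: "b \<in> carrier G" and s: "s \<in> S" and nb: "network_at T \<B> b"
    show "network_at T \<B> (s \<otimes> b)"
      unfolding network_at_def
    proof (intro allI impI, elim conjE)
      fix U assume U: "openin T U" "s \<otimes> b \<in> U"
      obtain M B where MB: "M \<in> \<M>" "B \<in> \<B>" "s \<in> M" "b \<in> B" "M <#> B \<subseteq> U"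
        using network_at_set_mult[OF \<M>(3)[OF s] nb _ b U] s S by blast
      then obtain Ms where "Ms \<in> lists \<M>" "B = foldr (<#>) Ms {\<one>}" by (auto simp: \<B>_def)
      with MB(1) have "M <#> B \<in> \<B>" unfolding \<B>_def by (intro image_eqI[of _ _ "M # Ms"]) simp_all
      moreover have "s \<otimes> b \<in> M <#> B" using MB(3,4) unfolding set_mult_def by blast
      ultimately show "\<exists>N\<in>\<B>. s \<otimes> b \<in> N \<and> N \<subseteq> U" using MB(5) by blast
    qed
  qed
qed

text \<open>A countable Pytkeev network at \<open>\<one>\<close> alone would give, by translation, one network for each point. The
countable network \<open>\<B>\<close> makes countably many sets enough: for \<open>b \<in> B \<in> \<B>\<close> the set \<open>B N\<close> contains the
translate \<open>b N\<close>, and it is small when \<open>B\<close> and \<open>N\<close> are.\<close>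

lemma P0_space_from_one:
  assumes t1: "t1_space T"
    and \<B>: "countable \<B>" "\<B> \<subseteq> Pow (carrier G)" "\<And>a. a \<in> carrier G \<Longrightarrow> network_at T \<B> a"
    and \<N>: "countable \<N>" "\<N> \<subseteq> Pow (carrier G)" "pytkeev_network_at T \<N> \<one>"
  shows "P0_space T"
proof -
  define \<P> where "\<P> = (\<lambda>(B, N). B <#> N) ` (\<B> \<times> \<N>)"
  have "countable \<P>" unfolding \<P>_def using \<B>(1) \<N>(1) by (intro countable_image countable_SIGMA)
  moreover have "\<P> \<subseteq> Pow (topspace T)"
    using \<B>(2) \<N>(2) by (auto simp: \<P>_def set_mult_def subset_iff Pow_iff)
  moreover have "pytkeev_network_at T \<P> b" if b: "b \<in> carrier G" for b
    unfolding pytkeev_network_at_def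
  proof (intro conjI allI impI; (elim conjE)?)
    have nN: "network_at T \<N> \<one>" using \<N>(3) by (simp add: pytkeev_network_at_def)
    show "network_at T \<P> b"
      unfolding network_at_def
    proof (intro allI impI, elim conjE)
      fix U assume U: "openin T U" "b \<in> U"
      obtain B N where BN: "B \<in> \<B>" "N \<in> \<N>" "b \<in> B" "\<one> \<in> N" "B <#> N \<subseteq> U"
        using network_at_set_mult[OF \<B>(3)[OF b] nN b one_closed U(1)] U(2) b by (metis r_one)
      have "b \<in> B <#> N" using BN(3,4) b unfolding set_mult_def by force
      with BN show "\<exists>N\<in>\<P>. b \<in> N \<and> N \<subseteq> U" unfolding \<P>_def by blast
    qed
    fix U A assume U: "openin T U" "b \<in> U" and A: "A \<subseteq> topspace T" "accumulates_at T A b"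
    have "b \<otimes> \<one> \<in> U" using U b by simp
    from mult_neighbourhoods[OF U(1) this b one_closed]
    obtain P Q where PQ: "openin T P" "b \<in> P" "openin T Q" "\<one> \<in> Q"
      "\<And>x y. x \<in> P \<Longrightarrow> y \<in> Q \<Longrightarrow> x \<otimes> y \<in> U" by metis
    obtain B where B: "B \<in> \<B>" "b \<in> B" "B \<subseteq> P"
      using \<B>(3)[OF b] PQ(1,2) unfolding network_at_def by meson
    define A' where "A' = {c \<in> carrier G. b \<otimes> c \<in> A}"
    have inj: "inj_on (\<lambda>c. b \<otimes> c) (carrier G)" by (rule inj_onI) (simp add: b)
    have img: "(\<lambda>c. b \<otimes> c) ` {c \<in> carrier G. b \<otimes> c \<in> R} = R" if "R \<subseteq> carrier G" for R
    proof (intro equalityI subsetI)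
      fix r assume r: "r \<in> R"
      then have "r \<in> carrier G" using that by blast
      then have "r = b \<otimes> (inv b \<otimes> r)" "inv b \<otimes> r \<in> carrier G" using b by (simp_all add: m_assoc[symmetric])
      with r show "r \<in> (\<lambda>c. b \<otimes> c) ` {c \<in> carrier G. b \<otimes> c \<in> R}" by force
    qed auto
    have "accumulates_at T A' \<one>"
      unfolding accumulates_at_def
    proof (intro allI impI, elim conjE)
      fix R assume R: "openin T R" "\<one> \<in> R"
      define R' where "R' = {c \<in> carrier G. inv b \<otimes> c \<in> R}"
      have "openin T R'" unfolding R'_def using R(1) b by (intro openin_translate) simp_all
      moreover have "b \<in> R'" using R(2) b by (simp add: R'_def)
      ultimately have inf: "infinite (R' \<inter> A)" using A(2) by (simp add: accumulates_at_def)
      have "R' \<inter> A \<subseteq> (\<lambda>c. b \<otimes> c) ` (R \<inter> A')"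
      proof
        fix r assume r: "r \<in> R' \<inter> A"
        then have "r \<in> carrier G" "inv b \<otimes> r \<in> R" "r \<in> A" by (auto simp: R'_def)
        moreover have "r = b \<otimes> (inv b \<otimes> r)" using b \<open>r \<in> carrier G\<close> by (simp add: m_assoc[symmetric])
        ultimately have "inv b \<otimes> r \<in> R \<inter> A'" using b by (simp add: A'_def)
        with \<open>r = b \<otimes> (inv b \<otimes> r)\<close> show "r \<in> (\<lambda>c. b \<otimes> c) ` (R \<inter> A')" by (rule image_eqI)
      qed
      with inf show "infinite (R \<inter> A')" using finite_subset finite_imageI by metis
    qed
    moreover have "A' \<subseteq> topspace T" by (auto simp: A'_def)
    ultimately obtain N where N: "N \<in> \<N>" "N \<subseteq> Q" "infinite (N \<inter> A')"
      using \<N>(3) PQ(3,4) unfolding pytkeev_network_at_def by meson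
    have "(\<lambda>c. b \<otimes> c) ` (N \<inter> A') \<subseteq> (B <#> N) \<inter> A"
      using B(2) unfolding set_mult_def A'_def by blast
    moreover have "infinite ((\<lambda>c. b \<otimes> c) ` (N \<inter> A'))"
    proof
      assume "finite ((\<lambda>c. b \<otimes> c) ` (N \<inter> A'))"
      moreover have "inj_on (\<lambda>c. b \<otimes> c) (N \<inter> A')"
        by (rule inj_on_subset[OF inj]) (auto simp: A'_def)
      ultimately show False using N(3) finite_imageD by blast
    qed
    ultimately have "infinite ((B <#> N) \<inter> A)" using finite_subset by blast
    moreover have "B <#> N \<subseteq> U" using B(3) N(2) PQ(5) unfolding set_mult_def by blast
    ultimately show "\<exists>N\<in>\<P>. N \<subseteq> U \<and> infinite (N \<inter> A)"
      using B(1) N(1) unfolding \<P>_def by blast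
  qed
  ultimately show ?thesis
    using t1 regular_space_T unfolding P0_space_def t3_space_def pytkeev_network_def by auto
qed

end


section \<open>Group topologies given by strings\<close>

definition group_string :: "'g monoid \<Rightarrow> (nat \<Rightarrow> 'g set) \<Rightarrow> bool" where
  "group_string G V \<longleftrightarrow>
    (\<forall>m. \<one>\<^bsub>G\<^esub> \<in> V m \<and> V m \<subseteq> carrier G \<and> (\<forall>a\<in>V m. inv\<^bsub>G\<^esub> a \<in> V m) \<and>
      (\<forall>a\<in>V (Suc m). \<forall>b\<in>V (Suc m). a \<otimes>\<^bsub>G\<^esub> b \<in> V m))"

text \<open>The group topology in which the sets \<open>V m\<close> form a neighbourhood base at \<open>\<one>\<close>. The sets \<open>V m\<close> themselves
need not be open.\<close>

definition string_topology :: "'g monoid \<Rightarrow> (nat \<Rightarrow> 'g set) \<Rightarrow> 'g topology" where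
  "string_topology G V =
    topology (\<lambda>U. U \<subseteq> carrier G \<and> (\<forall>a\<in>U. \<exists>m. \<forall>v\<in>V m. a \<otimes>\<^bsub>G\<^esub> v \<in> U))"

text \<open>Commutative groups on records without further fields, the ones that carry group topologies here.\<close>

locale plain_comm_group = comm_group G for G :: "'g monoid" (structure)
begin

lemma inv_mult_cancel:
  assumes "a \<in> carrier G" "b \<in> carrier G" "c \<in> carrier G"
  shows "inv (inv c \<otimes> a) \<otimes> (inv c \<otimes> b) = inv a \<otimes> b"
proof -
  have "c \<otimes> (inv c \<otimes> b) = b" using assms by (simp add: m_assoc[symmetric])
  then show ?thesis using assms by (simp add: inv_mult_group m_assoc)
qed

lemma group_string_simps:
  assumes "group_string G V"
  shows group_string_one: "\<one> \<in> V m"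
    and group_string_carrier: "a \<in> V m \<Longrightarrow> a \<in> carrier G"
    and group_string_inv: "a \<in> V m \<Longrightarrow> inv a \<in> V m"
    and group_string_mult: "a \<in> V (Suc m) \<Longrightarrow> b \<in> V (Suc m) \<Longrightarrow> a \<otimes> b \<in> V m"
  using assms unfolding group_string_def by blast+

lemma group_string_antimono:
  assumes V: "group_string G V" and "m \<le> n"
  shows "V n \<subseteq> V m"
  using \<open>m \<le> n\<close>
proof (induction n rule: dec_induct)
  case (step n)
  have "a \<in> V n" if "a \<in> V (Suc n)" for a
    using group_string_mult[OF V that group_string_one[OF V]] group_string_carrier[OF V that] by simp
  with step.IH show ?case by blast
qed simp

lemma openin_string_topology:
  assumes V: "group_string G V"
  shows "openin (string_topology G V) U \<longleftrightarrow>
    U \<subseteq> carrier G \<and> (\<forall>a\<in>U. \<exists>m. \<forall>v\<in>V m. a \<otimes> v \<in> U)"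
proof -
  have "istopology (\<lambda>U. U \<subseteq> carrier G \<and> (\<forall>a\<in>U. \<exists>m. \<forall>v\<in>V m. a \<otimes> v \<in> U))"
    unfolding istopology_def
  proof (intro conjI allI impI ballI; (elim conjE)?)
    fix S U a
    assume S: "\<forall>a\<in>S. \<exists>m. \<forall>v\<in>V m. a \<otimes> v \<in> S" and U: "\<forall>a\<in>U. \<exists>m. \<forall>v\<in>V m. a \<otimes> v \<in> U"
      and a: "a \<in> S \<inter> U"
    obtain m n where mn: "\<forall>v\<in>V m. a \<otimes> v \<in> S" "\<forall>v\<in>V n. a \<otimes> v \<in> U" using S U a by blast
    have "V (max m n) \<subseteq> V m" "V (max m n) \<subseteq> V n" using group_string_antimono[OF V] by simp_all
    with mn show "\<exists>m. \<forall>v\<in>V m. a \<otimes> v \<in> S \<inter> U" by (intro exI[of _ "max m n"]) blast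
  next
    fix \<K> a assume K: "\<forall>K\<in>\<K>. K \<subseteq> carrier G \<and> (\<forall>a\<in>K. \<exists>m. \<forall>v\<in>V m. a \<otimes> v \<in> K)" and a: "a \<in> \<Union>\<K>"
    then obtain K where K': "K \<in> \<K>" "a \<in> K" by blast
    with K obtain m where "\<forall>v\<in>V m. a \<otimes> v \<in> K" by blast
    with K'(1) show "\<exists>m. \<forall>v\<in>V m. a \<otimes> v \<in> \<Union>\<K>" by blast
  qed blast+
  then show ?thesis by (simp add: string_topology_def)
qed

lemma topspace_string_topology:
  assumes V: "group_string G V"
  shows "topspace (string_topology G V) = carrier G"
proof
  show "topspace (string_topology G V) \<subseteq> carrier G"
    using openin_topspace[of "string_topology G V"] unfolding openin_string_topology[OF V] by (rule conjunct1)
  have "openin (string_topology G V) (carrier G)"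
    unfolding openin_string_topology[OF V] using group_string_carrier[OF V] by auto
  then show "carrier G \<subseteq> topspace (string_topology G V)" by (rule openin_subset)
qed

text \<open>The interior of \<open>a V m\<close> is found explicitly: it consists of the \<open>b\<close> with \<open>b V n \<subseteq> a V m\<close> for some \<open>n\<close>, and
\<open>V (n + 1) V (n + 1) \<subseteq> V n\<close> shows that this set is open.\<close>

lemma string_topology_neighbourhood:
  assumes V: "group_string G V" and a: "a \<in> carrier G"
  obtains Q where "openin (string_topology G V) Q" "a \<in> Q" "\<And>b. b \<in> Q \<Longrightarrow> inv a \<otimes> b \<in> V m"
proof -
  note Vc = group_string_carrier[OF V]
  define Q where "Q = {b \<in> carrier G. \<exists>n. \<forall>v\<in>V n. inv a \<otimes> (b \<otimes> v) \<in> V m}"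
  have "openin (string_topology G V) Q"
    unfolding openin_string_topology[OF V]
  proof (intro conjI ballI)
    fix b assume "b \<in> Q"
    then obtain n where b: "b \<in> carrier G" and n: "\<forall>v\<in>V n. inv a \<otimes> (b \<otimes> v) \<in> V m"
      by (auto simp: Q_def)
    have "b \<otimes> v \<in> Q" if v: "v \<in> V (Suc n)" for v
    proof -
      have "inv a \<otimes> (b \<otimes> v \<otimes> w) \<in> V m" if w: "w \<in> V (Suc n)" for w
        using n[rule_format, OF group_string_mult[OF V v w]] b Vc[OF v] Vc[OF w] by (simp add: m_assoc)
      then show ?thesis using b Vc[OF v] unfolding Q_def by blast
    qed
    then show "\<exists>m. \<forall>v\<in>V m. b \<otimes> v \<in> Q" by blast
  qed (auto simp: Q_def)
  moreover have "inv a \<otimes> (a \<otimes> v) \<in> V m" if "v \<in> V m" for v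
    using that a Vc[OF that] by (simp add: m_assoc[symmetric])
  then have "a \<in> Q" using a unfolding Q_def by blast
  moreover have "inv a \<otimes> b \<in> V m" if "b \<in> Q" for b
  proof -
    from that obtain n where "b \<in> carrier G" "\<forall>v\<in>V n. inv a \<otimes> (b \<otimes> v) \<in> V m"
      by (auto simp: Q_def)
    then show ?thesis using group_string_one[OF V, of n] by fastforce
  qed
  ultimately show ?thesis by (rule that)
qed

lemma abelian_topological_group_string:
  assumes V: "group_string G V"
  shows "abelian_topological_group G (string_topology G V)"
proof -
  let ?T = "string_topology G V"
  note Vc = group_string_carrier[OF V] and top = topspace_string_topology[OF V]
  have open_sub: "x \<in> carrier G" if "openin ?T U" "x \<in> U" for x U
    using that unfolding openin_string_topology[OF V] by blast
  have "continuous_map (prod_topology ?T ?T) ?T (\<lambda>(x, y). x \<otimes> y)"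
    unfolding continuous_map_def
  proof (intro conjI allI impI)
    fix U assume U: "openin ?T U"
    let ?S = "{z \<in> topspace (prod_topology ?T ?T). (case z of (x, y) \<Rightarrow> x \<otimes> y) \<in> U}"
    show "openin (prod_topology ?T ?T) ?S"
      unfolding openin_prod_topology_alt
    proof (intro allI impI)
      fix a b assume "(a, b) \<in> ?S"
      then have ab: "a \<in> carrier G" "b \<in> carrier G" "a \<otimes> b \<in> U" by (simp_all add: top)
      then obtain m where m: "\<forall>v\<in>V m. a \<otimes> b \<otimes> v \<in> U"
        using U unfolding openin_string_topology[OF V] by blast
      obtain P where P: "openin ?T P" "a \<in> P" "\<And>x. x \<in> P \<Longrightarrow> inv a \<otimes> x \<in> V (Suc m)"
        using string_topology_neighbourhood[OF V ab(1)] by metis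
      obtain Q where Q: "openin ?T Q" "b \<in> Q" "\<And>y. y \<in> Q \<Longrightarrow> inv b \<otimes> y \<in> V (Suc m)"
        using string_topology_neighbourhood[OF V ab(2)] by metis
      have "(x, y) \<in> ?S" if "x \<in> P" "y \<in> Q" for x y
      proof -
        have xy: "x \<in> carrier G" "y \<in> carrier G" using that P(1) Q(1) open_sub by blast+
        have "(inv a \<otimes> x) \<otimes> (inv b \<otimes> y) \<in> V m"
          by (rule group_string_mult[OF V P(3)[OF that(1)] Q(3)[OF that(2)]])
        then have "a \<otimes> b \<otimes> ((inv a \<otimes> x) \<otimes> (inv b \<otimes> y)) \<in> U" using m by blast
        moreover have "a \<otimes> b \<otimes> ((inv a \<otimes> x) \<otimes> (inv b \<otimes> y)) = (a \<otimes> inv a) \<otimes> (b \<otimes> inv b) \<otimes> (x \<otimes> y)"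
          using ab xy by (simp add: m_ac del: r_inv l_inv)
        ultimately show ?thesis using ab xy by (simp add: top)
      qed
      then have "P \<times> Q \<subseteq> ?S" by blast
      with P Q show "\<exists>P Q. openin ?T P \<and> openin ?T Q \<and> a \<in> P \<and> b \<in> Q \<and> P \<times> Q \<subseteq> ?S"
        by (intro exI[of _ P] exI[of _ Q]) simp
    qed
  qed (simp add: top Pi_iff)
  moreover have "continuous_map ?T ?T (\<lambda>x. inv x)"
    unfolding continuous_map_def
  proof (intro conjI allI impI)
    fix U assume U: "openin ?T U"
    let ?S = "{x \<in> topspace ?T. inv x \<in> U}"
    show "openin ?T ?S"
      unfolding openin_string_topology[OF V]
    proof (intro conjI ballI)
      fix a assume "a \<in> ?S"
      then have a: "a \<in> carrier G" "inv a \<in> U" by (simp_all add: top)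
      then obtain m where m: "\<forall>v\<in>V m. inv a \<otimes> v \<in> U"
        using U unfolding openin_string_topology[OF V] by blast
      have "a \<otimes> v \<in> ?S" if v: "v \<in> V m" for v
        using m[rule_format, OF group_string_inv[OF V v]] a Vc[OF v] by (simp add: top inv_mult)
      then show "\<exists>m. \<forall>v\<in>V m. a \<otimes> v \<in> ?S" by blast
    qed (simp add: top)
  qed (simp add: top Pi_iff)
  ultimately show ?thesis
    by (simp add: abelian_topological_group_def comm_group_axioms top)
qed

lemma limitin_string_topology:
  assumes V: "group_string G V" and a: "a \<in> carrier G" and \<sigma>: "\<And>n. \<sigma> n \<in> carrier G"
    and ev: "\<And>m. \<forall>\<^sub>F n in sequentially. inv a \<otimes> \<sigma> n \<in> V m"
  shows "limitin (string_topology G V) \<sigma> a sequentially"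
  unfolding limitin_def topspace_string_topology[OF V]
proof (intro conjI allI impI a; elim conjE)
  fix U assume "openin (string_topology G V) U" "a \<in> U"
  then obtain m where m: "\<forall>v\<in>V m. a \<otimes> v \<in> U"
    unfolding openin_string_topology[OF V] by blast
  from ev[of m] show "\<forall>\<^sub>F n in sequentially. \<sigma> n \<in> U"
  proof eventually_elim
    fix n assume "inv a \<otimes> \<sigma> n \<in> V m"
    with m have "a \<otimes> (inv a \<otimes> \<sigma> n) \<in> U" by blast
    then show "\<sigma> n \<in> U" using a \<sigma>[of n] by (simp add: m_assoc[symmetric])
  qed
qed

lemma group_string_Inter:
  assumes "\<And>k. group_string G (W k)"
  shows "group_string G (\<lambda>m. \<Inter>k::nat. W k m)"
  unfolding group_string_def
proof (intro allI conjI ballI subsetI)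
  fix m
  show "\<one> \<in> (\<Inter>k. W k m)" using group_string_one[OF assms] by simp
  show "a \<in> carrier G" if "a \<in> (\<Inter>k. W k m)" for a
    using group_string_carrier[OF assms, of a 0 m] that by simp
  show "inv a \<in> (\<Inter>k. W k m)" if "a \<in> (\<Inter>k. W k m)" for a
    using group_string_inv[OF assms, of a _ m] that by simp
  show "a \<otimes> b \<in> (\<Inter>k. W k m)" if "a \<in> (\<Inter>k. W k (Suc m))" "b \<in> (\<Inter>k. W k (Suc m))" for a b
    using group_string_mult[OF assms, of a _ m b] that by simp
qed

end

definition neighbourhood_string :: "'g monoid \<Rightarrow> 'g topology \<Rightarrow> (nat \<Rightarrow> 'g set) \<Rightarrow> bool" where
  "neighbourhood_string G T V \<longleftrightarrow>
    group_string G V \<and> (\<forall>m. \<exists>Q. openin T Q \<and> \<one>\<^bsub>G\<^esub> \<in> Q \<and> Q \<subseteq> V m)"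

definition differences :: "'g monoid \<Rightarrow> ('a \<Rightarrow> 'g) \<Rightarrow> 'a set \<Rightarrow> 'g set" where
  "differences G i N = (\<lambda>(x, y). inv\<^bsub>G\<^esub> i x \<otimes>\<^bsub>G\<^esub> i y) ` (N \<times> N)"

sublocale topological_comm_group \<subseteq> plain_comm_group ..

context topological_comm_group
begin

lemma symmetric_halving:
  assumes "openin T U" "\<one> \<in> U"
  shows "\<exists>Q. openin T Q \<and> \<one> \<in> Q \<and> (\<forall>a\<in>Q. inv a \<in> Q) \<and> (\<forall>a\<in>Q. \<forall>b\<in>Q. a \<otimes> b \<in> U)"
proof -
  obtain P R where PR: "openin T P" "\<one> \<in> P" "openin T R" "\<one> \<in> R"
    "\<And>x y. x \<in> P \<Longrightarrow> y \<in> R \<Longrightarrow> x \<otimes> y \<in> U"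
    using mult_neighbourhoods[OF assms(1), of \<one> \<one>] assms(2) by (metis one_closed r_one)
  define Q where "Q = (P \<inter> R) \<inter> {b \<in> carrier G. inv b \<in> P \<inter> R}"
  have "openin T Q" unfolding Q_def using PR(1,3) openin_inverse by blast
  moreover have "\<one> \<in> Q" using PR(2,4) by (simp add: Q_def)
  moreover have "\<forall>a\<in>Q. inv a \<in> Q" by (simp add: Q_def)
  moreover have "\<forall>a\<in>Q. \<forall>b\<in>Q. a \<otimes> b \<in> U" using PR(5) by (simp add: Q_def)
  ultimately show ?thesis by blast
qed

text \<open>Continuity of the multiplication at \<open>\<one>\<close> allows halving neighbourhoods again and again. The string starts
with a first half of \<open>U\<close>, not with \<open>U\<close>, because its members have to be symmetric.\<close>

lemma neighbourhood_string_exists: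
  assumes U: "openin T U" "\<one> \<in> U"
  shows "\<exists>V. neighbourhood_string G T V \<and> V 0 \<subseteq> U"
proof -
  define good where "good Q \<longleftrightarrow> openin T Q \<and> \<one> \<in> Q \<and> (\<forall>a\<in>Q. inv a \<in> Q)" for Q
  have half: "\<exists>R. good R \<and> (\<forall>a\<in>R. \<forall>b\<in>R. a \<otimes> b \<in> Q)" if "openin T Q" "\<one> \<in> Q" for Q
    using symmetric_halving[OF that] unfolding good_def by blast
  obtain Q0 where Q0: "good Q0" "\<forall>a\<in>Q0. \<forall>b\<in>Q0. a \<otimes> b \<in> U" using half[OF U] by blast
  have "\<exists>R. good R \<and> (\<forall>a\<in>R. \<forall>b\<in>R. a \<otimes> b \<in> Q)" if "good Q" for Q
    using half that unfolding good_def by blast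
  then have "\<exists>V. \<forall>m. (good (V m) \<and> (m = 0 \<longrightarrow> V m = Q0)) \<and> (\<forall>a\<in>V (Suc m). \<forall>b\<in>V (Suc m). a \<otimes> b \<in> V m)"
    by (intro dependent_nat_choice) (use Q0 in auto)
  then obtain V where V: "\<And>m. good (V m)" "V 0 = Q0"
    "\<And>m. \<forall>a\<in>V (Suc m). \<forall>b\<in>V (Suc m). a \<otimes> b \<in> V m"
    by blast
  have "V m \<subseteq> carrier G" for m using V(1)[of m] openin_carrier unfolding good_def by blast
  then have "group_string G V"
    using V(1,3) unfolding group_string_def good_def by simp
  moreover have "\<exists>Q. openin T Q \<and> \<one> \<in> Q \<and> Q \<subseteq> V m" for m
    using V(1)[of m] unfolding good_def by (intro exI[of _ "V m"]) simp
  ultimately have "neighbourhood_string G T V" by (simp add: neighbourhood_string_def)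
  moreover have "a \<in> U" if "a \<in> Q0" for a
  proof -
    have "a \<otimes> \<one> \<in> U" using Q0 that unfolding good_def by blast
    moreover have "a \<in> carrier G" using Q0(1) that openin_carrier unfolding good_def by blast
    ultimately show ?thesis by simp
  qed
  ultimately show ?thesis using V(2) by blast
qed

lemma openin_preimage_translate:
  assumes i: "continuous_map X T i" and Q: "openin T Q" and x: "x \<in> topspace X"
  shows "openin X {y \<in> topspace X. inv (i x) \<otimes> i y \<in> Q}"
proof -
  have "i x \<in> carrier G" using i x by (auto simp: continuous_map_def)
  then have "continuous_map X T (\<lambda>y. inv (i x) \<otimes> i y)"
    by (intro continuous_mult i) simp
  from openin_continuous_map_preimage[OF this Q] show ?thesis .
qed

text \<open>The uniformity that makes an infinite intersection of neighbourhood strings work. Almost all \<open>k\<close> are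
handled by one condition on the differences of a set \<open>N\<close> that contains \<open>x\<close> and almost all \<open>\<sigma> n\<close>, the
remaining \<open>k\<close> by continuity of \<open>i\<close>.\<close>

lemma eventually_in_all_strings:
  assumes i: "continuous_map X T i" and \<N>: "cs_network X \<N>"
    and V: "neighbourhood_string G T V" and W: "\<And>k::nat. neighbourhood_string G T (W k)"
    and tail: "\<And>N m. N \<in> \<N> \<Longrightarrow> differences G i N \<subseteq> V m \<Longrightarrow>
      \<forall>\<^sub>F k in sequentially. differences G i N \<subseteq> W k m"
    and lim: "limitin X \<sigma> x sequentially"
  shows "\<forall>\<^sub>F n in sequentially. \<forall>k. inv (i x) \<otimes> i (\<sigma> n) \<in> W k m"
proof -
  have x: "x \<in> topspace X" using lim by (simp add: limitin_def)
  have ic: "i y \<in> carrier G" if "y \<in> topspace X" for y using that i by (auto simp: continuous_map_def)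
  have V': "group_string G V" using V by (simp add: neighbourhood_string_def)
  have nbhd: "\<exists>Z. openin X Z \<and> x \<in> Z \<and> Z \<subseteq> {y \<in> topspace X. inv (i x) \<otimes> i y \<in> V' m}"
    if V': "neighbourhood_string G T V'" for V' m
  proof -
    obtain Q where Q: "openin T Q" "\<one> \<in> Q" "Q \<subseteq> V' m"
      using V' unfolding neighbourhood_string_def by blast
    show ?thesis
      using openin_preimage_translate[OF i Q(1) x] Q(2,3) x ic[OF x]
      by (intro exI[of _ "{y \<in> topspace X. inv (i x) \<otimes> i y \<in> Q}"]) auto
  qed
  obtain Z where Z: "openin X Z" "x \<in> Z" "Z \<subseteq> {y \<in> topspace X. inv (i x) \<otimes> i y \<in> V (Suc m)}"
    using nbhd[OF V] by blast
  obtain N where N: "N \<in> \<N>" "N \<subseteq> Z" "x \<in> N" "\<forall>\<^sub>F n in sequentially. \<sigma> n \<in> N"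
    using cs_networkE[OF \<N> lim Z(1,2)] by metis
  \<comment> \<open>Points close to \<open>x\<close> up to \<open>V (m + 1)\<close> are close to each other up to \<open>V m\<close>.\<close>
  have "inv (i u) \<otimes> i v \<in> V m" if uv: "u \<in> N" "v \<in> N" for u v
  proof -
    have *: "u \<in> topspace X" "v \<in> topspace X" "inv (i x) \<otimes> i u \<in> V (Suc m)" "inv (i x) \<otimes> i v \<in> V (Suc m)"
      using uv N(2) Z(3) by auto
    then have "inv (inv (i x) \<otimes> i u) \<otimes> (inv (i x) \<otimes> i v) \<in> V m"
      by (intro group_string_mult[OF V' group_string_inv[OF V' *(3)] *(4)])
    then show ?thesis using ic[OF x] ic[OF *(1)] ic[OF *(2)] by (simp add: inv_mult_cancel)
  qed
  then have "differences G i N \<subseteq> V m" by (auto simp: differences_def)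
  from tail[OF N(1) this] obtain k0 where k0: "\<And>k. k0 \<le> k \<Longrightarrow> differences G i N \<subseteq> W k m"
    by (auto simp: eventually_sequentially)
  have "\<forall>\<^sub>F n in sequentially. inv (i x) \<otimes> i (\<sigma> n) \<in> W k m" for k
  proof -
    obtain Z where Z: "openin X Z" "x \<in> Z" "Z \<subseteq> {y \<in> topspace X. inv (i x) \<otimes> i y \<in> W k m}"
      using nbhd[OF W] by blast
    have "\<forall>\<^sub>F n in sequentially. \<sigma> n \<in> Z" using lim Z(1,2) by (simp add: limitin_def)
    then show ?thesis by eventually_elim (use Z(3) in blast)
  qed
  then have "\<forall>\<^sub>F n in sequentially. \<forall>k\<in>{..<k0}. inv (i x) \<otimes> i (\<sigma> n) \<in> W k m"
    by (intro eventually_ball_finite) simp_all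
  with N(4) show ?thesis
  proof eventually_elim
    fix n assume n: "\<sigma> n \<in> N" "\<forall>k\<in>{..<k0}. inv (i x) \<otimes> i (\<sigma> n) \<in> W k m"
    show "\<forall>k. inv (i x) \<otimes> i (\<sigma> n) \<in> W k m"
    proof
      fix k
      have "inv (i x) \<otimes> i (\<sigma> n) \<in> differences G i N"
        using n(1) N(3) by (auto simp: differences_def)
      then show "inv (i x) \<otimes> i (\<sigma> n) \<in> W k m" using k0[of k] n(2) by (cases "k < k0") auto
    qed
  qed
qed

end

lemma continuous_map_string_topology:
  assumes "comm_group G" and X: "sequential_space X" and V: "group_string G V"
    and i: "i \<in> topspace X \<rightarrow> carrier G"
    and ev: "\<And>\<sigma> x m. range \<sigma> \<subseteq> topspace X \<Longrightarrow> limitin X \<sigma> x sequentially \<Longrightarrow>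
      \<forall>\<^sub>F n in sequentially. inv\<^bsub>G\<^esub> i x \<otimes>\<^bsub>G\<^esub> i (\<sigma> n) \<in> V m"
  shows "continuous_map X (string_topology G V) i"
proof -
  interpret plain_comm_group G by (rule plain_comm_group.intro) fact
  show ?thesis
  proof (rule sequential_space_continuous_map[OF X])
    show "i \<in> topspace X \<rightarrow> topspace (string_topology G V)"
      using i by (simp add: topspace_string_topology[OF V])
    fix \<sigma> x assume \<sigma>: "range \<sigma> \<subseteq> topspace X" "limitin X \<sigma> x sequentially"
    have "x \<in> topspace X" using \<sigma>(2) by (simp add: limitin_def)
    then show "limitin (string_topology G V) (\<lambda>n. i (\<sigma> n)) (i x) sequentially"
      using i \<sigma>(1) ev[OF \<sigma>] by (intro limitin_string_topology[OF V]) auto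
  qed
qed

section \<open>The free abelian topological group\<close>

text \<open>The universal property is applied to the map \<open>i\<close> into \<open>A\<close> with the string topology. The resulting
homomorphism fixes the generators, hence is the identity, and its continuity says that the string topology
is coarser than the free one.\<close>

lemma free_abelian_topological_group_string:
  assumes A: "free_abelian_topological_group X A TA i" and X: "sequential_space X"
    and V: "group_string A V"
    and ev: "\<And>\<sigma> x m. range \<sigma> \<subseteq> topspace X \<Longrightarrow> limitin X \<sigma> x sequentially \<Longrightarrow>
      \<forall>\<^sub>F n in sequentially. inv\<^bsub>A\<^esub> i x \<otimes>\<^bsub>A\<^esub> i (\<sigma> n) \<in> V m"
  shows "neighbourhood_string A TA V"
proof -
  have atg: "abelian_topological_group A TA" and i: "continuous_map X TA i"
    using A by (auto simp: free_abelian_topological_group_def)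
  interpret A: topological_comm_group A TA by (rule topological_comm_group.intro[OF atg])
  have iA: "i x \<in> carrier A" if "x \<in> topspace X" for x
    using that i by (auto simp: continuous_map_def)
  let ?T = "string_topology A V"
  have "continuous_map X ?T i"
    using A.comm_group_axioms X V _ ev by (rule continuous_map_string_topology) (simp add: iA Pi_iff)
  moreover have "group_factorization X A TA i A ?T"
    by (rule free_abelian_topological_group_universal[OF A A.abelian_topological_group_string[OF V]])
  ultimately obtain h where h: "h \<in> hom A A" "continuous_map TA ?T h" "\<forall>x\<in>topspace X. i x = h (i x)"
    unfolding group_factorization_def by blast
  interpret h: group_hom A A h
    using h(1) by (simp add: group_hom_def group_hom_axioms_def A.is_group)
  have id: "h a = a" if "a \<in> carrier A" for a
  proof -
    have "a \<in> generate A (i ` topspace X)"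
      using that by (simp add: free_abelian_topological_group_generated[OF A])
    then have "a \<in> carrier A \<and> h a = a"
      by induction (use iA h(3) in auto)
    then show ?thesis by blast
  qed
  have "\<exists>Q. openin TA Q \<and> \<one>\<^bsub>A\<^esub> \<in> Q \<and> Q \<subseteq> V m" for m
  proof -
    obtain Q where Q: "openin ?T Q" "\<one>\<^bsub>A\<^esub> \<in> Q" "\<And>b. b \<in> Q \<Longrightarrow> inv\<^bsub>A\<^esub> \<one>\<^bsub>A\<^esub> \<otimes>\<^bsub>A\<^esub> b \<in> V m"
      using A.string_topology_neighbourhood[OF V A.one_closed] by metis
    have "openin TA {a \<in> carrier A. h a \<in> Q}"
      using openin_continuous_map_preimage[OF h(2) Q(1)] by simp
    moreover have "{a \<in> carrier A. h a \<in> Q} \<subseteq> V m"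
    proof
      fix a assume "a \<in> {a \<in> carrier A. h a \<in> Q}"
      then show "a \<in> V m" using Q(3)[of a] id[of a] by simp
    qed
    moreover have "\<one>\<^bsub>A\<^esub> \<in> {a \<in> carrier A. h a \<in> Q}" using Q(2) by simp
    ultimately show ?thesis by blast
  qed
  with V show ?thesis by (simp add: neighbourhood_string_def)
qed


text \<open>Collecting equal generators, so that \<open>F\<close> is a set and the exponents can be read off by a function that
vanishes on all but one point of \<open>F\<close>.\<close>

lemma (in comm_group) generate_finprod:
  assumes f: "f \<in> S \<rightarrow> carrier G" and "y \<in> generate G (f ` S)"
  shows "\<exists>F (c :: 'c \<Rightarrow> int). finite F \<and> F \<subseteq> S \<and> y = (\<Otimes>x\<in>F. f x [^] c x)"
proof -
  have fS: "f x \<in> carrier G" if "x \<in> S" for x using f that by blast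
  show ?thesis
    using assms(2)
  proof induction
    case one
    show ?case by (intro exI[of _ "{}"]) simp
  next
    case (incl h)
    then obtain x where "x \<in> S" "h = f x" by blast
    then show ?case using fS[of x]
      by (intro exI[of _ "{x}"] exI[of _ "\<lambda>_. 1"]) (simp add: int_pow_1)
  next
    case (inv h)
    then obtain x where "x \<in> S" "h = f x" by blast
    then show ?case using fS[of x]
      by (intro exI[of _ "{x}"] exI[of _ "\<lambda>_. -1"]) (simp add: int_pow_neg int_pow_1)
  next
    case (eng g h)
    then obtain D c E d where c: "finite D" "D \<subseteq> S" "g = (\<Otimes>x\<in>D. f x [^] (c x :: int))"
      and d: "finite E" "E \<subseteq> S" "h = (\<Otimes>x\<in>E. f x [^] (d x :: int))"
      by blast
    define F where "F = D \<union> E"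
    have fF: "f x \<in> carrier G" if "x \<in> F" for x using that c(2) d(2) fS unfolding F_def by blast
    have extend: "(\<Otimes>x\<in>B. f x [^] b x) = (\<Otimes>x\<in>F. f x [^] (if x \<in> B then b x else 0))"
      if "B \<subseteq> F" for B and b :: "'c \<Rightarrow> int"
      using that fF c(1) d(1)
      by (intro finprod_mono_neutral_cong_left) (auto simp: F_def)
    have "g \<otimes> h = (\<Otimes>x\<in>F. f x [^] (if x \<in> D then c x else 0) \<otimes> f x [^] (if x \<in> E then d x else 0))"
      unfolding c(3) d(3) extend[of D c, unfolded F_def, OF Un_upper1, folded F_def]
        extend[of E d, unfolded F_def, OF Un_upper2, folded F_def]
      by (rule finprod_multf[symmetric]) (simp_all add: fF Pi_iff)
    also have "\<dots> = (\<Otimes>x\<in>F. f x [^] ((if x \<in> D then c x else 0) + (if x \<in> E then d x else 0)))"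
      by (rule finprod_cong') (simp_all add: fF Pi_iff int_pow_mult)
    finally show ?case using c(1,2) d(1,2)
      by (intro exI[of _ F] exI[of _ "\<lambda>x. (if x \<in> D then c x else 0) + (if x \<in> E then d x else 0)"])
        (simp add: F_def)
  qed
qed

lemma (in comm_group) additive_finprod:
  fixes h :: "'a \<Rightarrow> real" and c :: "'c \<Rightarrow> int"
  assumes h: "\<And>a b. a \<in> carrier G \<Longrightarrow> b \<in> carrier G \<Longrightarrow> h (a \<otimes> b) = h a + h b"
    and F: "finite F" "\<And>x. x \<in> F \<Longrightarrow> f x \<in> carrier G"
  shows "h (\<Otimes>x\<in>F. f x [^] c x) = (\<Sum>x\<in>F. of_int (c x) * h (f x))"
proof -
  have h1: "h \<one> = 0" using h[of \<one> \<one>] by simp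
  have hinv: "h (inv a) = - h a" if "a \<in> carrier G" for a
    using h[of a "inv a"] that h1 by simp
  have hnat: "h (a [^] (n :: nat)) = of_nat n * h a" if "a \<in> carrier G" for a n
    by (induction n) (simp_all add: h1 h that algebra_simps)
  have hint: "h (a [^] (n :: int)) = of_int n * h a" if a: "a \<in> carrier G" for a n
  proof (cases n rule: int_cases2)
    case (nonneg m)
    then show ?thesis using hnat[OF a] by (simp add: int_pow_int)
  next
    case (nonpos m)
    then show ?thesis using hnat[OF a, of m] hinv[of "a [^] m"] a by (simp add: int_pow_neg int_pow_int)
  qed
  show ?thesis
    using F
  proof (induction F rule: finite_induct)
    case (insert x F)
    then have "f y \<in> carrier G" if "y \<in> F" for y using that by blast
    then have "(\<Otimes>x\<in>F. f x [^] c x) \<in> carrier G" by (intro finprod_closed) (simp add: Pi_iff)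
    with insert show ?case by (simp add: h hint Pi_iff)
  qed (simp add: h1)
qed

lemma abelian_topological_group_real:
  "abelian_topological_group \<lparr>carrier = UNIV, monoid.mult = (+), one = 0\<rparr> euclideanreal"
proof -
  let ?R = "\<lparr>carrier = UNIV, monoid.mult = (+), one = 0 :: real\<rparr>"
  have R: "comm_group ?R"
  proof (rule comm_groupI)
    show "\<exists>y\<in>carrier ?R. y \<otimes>\<^bsub>?R\<^esub> x = \<one>\<^bsub>?R\<^esub>" for x
      by (intro bexI[of _ "- x"]) simp_all
  qed simp_all
  then interpret R: comm_group ?R .
  have inv: "inv\<^bsub>?R\<^esub> x = - x" for x
    by (rule R.inv_equality) simp_all
  have "continuous_map (prod_topology euclideanreal euclideanreal) euclideanreal (\<lambda>z. fst z + snd z)"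
    by (intro continuous_map_add continuous_map_fst continuous_map_snd)
  moreover have "continuous_map euclideanreal euclideanreal (\<lambda>x. - x :: real)"
    by (intro continuous_map_minus continuous_map_id[unfolded id_def])
  ultimately show ?thesis
    using R by (simp add: abelian_topological_group_def inv case_prod_unfold)
qed

text \<open>If \<open>a\<close> is a product of powers with a nonzero exponent at \<open>z\<close>, the additive extension of a continuous
function that is \<open>1\<close> at \<open>z\<close> and \<open>0\<close> at the other points takes that exponent as its value at \<open>a\<close>.\<close>

lemma free_abelian_topological_group_t1_space:
  assumes A: "free_abelian_topological_group X A TA i"
    and X: "completely_regular_space X" "t1_space X"
  shows "t1_space TA"
proof -
  have atg: "abelian_topological_group A TA" and i: "continuous_map X TA i"
    using A by (auto simp: free_abelian_topological_group_def)
  interpret A: topological_comm_group A TA by (rule topological_comm_group.intro[OF atg])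
  have iA: "i x \<in> carrier A" if "x \<in> topspace X" for x
    using that i by (auto simp: continuous_map_def)
  show ?thesis
  proof (rule A.t1_spaceI)
    fix a assume a: "a \<in> carrier A" "a \<noteq> \<one>\<^bsub>A\<^esub>"
    have "i \<in> topspace X \<rightarrow> carrier A" using iA by blast
    moreover have "a \<in> generate A (i ` topspace X)"
      using a(1) by (simp add: free_abelian_topological_group_generated[OF A])
    ultimately obtain F and c :: "'a \<Rightarrow> int"
      where F: "finite F" "F \<subseteq> topspace X" "a = (\<Otimes>\<^bsub>A\<^esub>x\<in>F. i x [^]\<^bsub>A\<^esub> c x)"
      using A.generate_finprod[of i "topspace X" a] by blast
    have "\<exists>x\<in>F. c x \<noteq> 0"
    proof (rule ccontr)
      assume "\<not> (\<exists>x\<in>F. c x \<noteq> 0)"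
      then have "a = \<one>\<^bsub>A\<^esub>" unfolding F(3) by (intro A.finprod_one_eqI) simp
      with a(2) show False by simp
    qed
    then obtain z where z: "z \<in> F" "c z \<noteq> 0" by blast
    obtain f where f: "continuous_map X euclideanreal f" "f z = 1" "\<And>y. y \<in> F - {z} \<Longrightarrow> f y = 0"
      using separate_point_from_finite[OF X, of z "F - {z}"] z F(1,2) by auto
    let ?R = "\<lparr>carrier = UNIV, monoid.mult = (+), one = 0 :: real\<rparr>"
    obtain h where h: "h \<in> hom A ?R" "continuous_map TA euclideanreal h"
      "\<forall>x\<in>topspace X. f x = h (i x)"
      using free_abelian_topological_group_factor[OF A abelian_topological_group_real f(1)] by blast
    have "h a = (\<Sum>x\<in>F. of_int (c x) * h (i x))"
      unfolding F(3) by (rule A.additive_finprod) (use h(1) F(1,2) iA in \<open>auto simp: hom_def\<close>)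
    also have "\<dots> = (\<Sum>x\<in>F. if x = z then of_int (c z) else 0)"
    proof (rule sum.cong[OF refl])
      fix x assume x: "x \<in> F"
      then have "h (i x) = f x" using h(3) F(2) by auto
      then show "of_int (c x) * h (i x) = (if x = z then of_int (c z) else 0)"
        using f(2) f(3)[of x] x by simp
    qed
    also have "\<dots> = of_int (c z)" using F(1) z(1) by simp
    finally have ha: "h a \<noteq> 0" using z(2) by simp
    have h1: "h \<one>\<^bsub>A\<^esub> = 0" using h(1) A.one_closed hom_mult[OF h(1), of "\<one>\<^bsub>A\<^esub>" "\<one>\<^bsub>A\<^esub>"] by simp
    have "openin TA {b \<in> topspace TA. h b \<in> - {h a}}"
      by (rule openin_continuous_map_preimage[OF h(2)]) (simp add: open_Compl)
    then show "\<exists>U. openin TA U \<and> \<one>\<^bsub>A\<^esub> \<in> U \<and> a \<notin> U"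
      using ha h1 by (intro exI[of _ "{b \<in> topspace TA. h b \<in> - {h a}}"]) simp
  qed
qed

text \<open>Inverses of generators are included, so that finite products exhaust the group.\<close>

lemma free_abelian_topological_group_network:
  assumes A: "free_abelian_topological_group X A TA i"
    and \<N>: "countable \<N>" "\<Union>\<N> \<subseteq> topspace X" "\<And>x. x \<in> topspace X \<Longrightarrow> network_at X \<N> x"
  shows "\<exists>\<B>. countable \<B> \<and> \<B> \<subseteq> Pow (carrier A) \<and> (\<forall>a\<in>carrier A. network_at TA \<B> a)"
proof -
  have atg: "abelian_topological_group A TA" and i: "continuous_map X TA i"
    using A by (auto simp: free_abelian_topological_group_def)
  interpret A: topological_comm_group A TA by (rule topological_comm_group.intro[OF atg])
  have iA: "i x \<in> carrier A" if "x \<in> topspace X" for x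
    using that i by (auto simp: continuous_map_def)
  define i' where "i' x = inv\<^bsub>A\<^esub> i x" for x
  have i': "continuous_map X TA i'" unfolding i'_def by (rule A.continuous_inv[OF i])
  define S where "S = i ` topspace X \<union> i' ` topspace X"
  have SA: "S \<subseteq> carrier A" using iA by (auto simp: S_def i'_def)
  show ?thesis
  proof (rule A.countable_network_generated[where S = S])
    show "countable ((`) i ` \<N> \<union> (`) i' ` \<N>)" using \<N>(1) by simp
    show "\<Union>((`) i ` \<N> \<union> (`) i' ` \<N>) \<subseteq> carrier A"
      using \<N>(2) iA by (auto simp: i'_def)
    show "network_at TA ((`) i ` \<N> \<union> (`) i' ` \<N>) s" if s: "s \<in> S" for s
    proof -
      from s obtain x where x: "x \<in> topspace X" "s = i x \<or> s = i' x" by (auto simp: S_def)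
      show ?thesis
        using x(2) network_at_mono[OF network_at_image[OF i \<N>(3)[OF x(1)] x(1)]]
          network_at_mono[OF network_at_image[OF i' \<N>(3)[OF x(1)] x(1)]] by auto
    qed
    show "S \<subseteq> carrier A" by (rule SA)
    fix P a
    assume P1: "P \<one>\<^bsub>A\<^esub>" and step: "\<And>b s. b \<in> carrier A \<Longrightarrow> s \<in> S \<Longrightarrow> P b \<Longrightarrow> P (s \<otimes>\<^bsub>A\<^esub> b)"
      and a: "a \<in> carrier A"
    have "a \<in> generate A (i ` topspace X)"
      using a by (simp add: free_abelian_topological_group_generated[OF A])
    then have "a \<in> carrier A \<and> (\<forall>b\<in>carrier A. P b \<longrightarrow> P (a \<otimes>\<^bsub>A\<^esub> b))"
    proof induction
      case (incl h)
      then have "h \<in> S" by (simp add: S_def)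
      with SA step show ?case by blast
    next
      case (inv h)
      then have "inv\<^bsub>A\<^esub> h \<in> S" by (auto simp: S_def i'_def)
      with SA step show ?case by blast
    next
      case (eng g h)
      then show ?case by (simp add: A.m_assoc)
    qed simp
    then have "P (a \<otimes>\<^bsub>A\<^esub> \<one>\<^bsub>A\<^esub>)" using P1 by blast
    then show "P a" using a by simp
  qed
qed

theorem free_abelian_topological_group_P0_space:
  assumes X: "sequential_space X" "aleph0_space X"
    and A: "free_abelian_topological_group X A TA i"
  shows "P0_space TA"
proof -
  have atg: "abelian_topological_group A TA" and i: "continuous_map X TA i"
    using A by (auto simp: free_abelian_topological_group_def)
  interpret A: topological_comm_group A TA by (rule topological_comm_group.intro[OF atg])
  obtain \<N> where \<N>: "countable \<N>" "\<Union>\<N> \<subseteq> topspace X" "cs_network X \<N>"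
    by (rule aleph0_space_cs_network[OF X(2)])
  have t1: "t1_space TA"
    using free_abelian_topological_group_t1_space[OF A aleph0_space_completely_regular_space[OF X(2)]]
      X(2) by (simp add: aleph0_space_def t3_space_def)
  have "\<exists>\<B>. countable \<B> \<and> \<B> \<subseteq> Pow (carrier A) \<and> (\<forall>a\<in>carrier A. network_at TA \<B> a)"
    by (rule free_abelian_topological_group_network[OF A \<N>(1,2)]) (rule cs_network_network_at[OF \<N>(3)])
  then obtain \<B> where \<B>: "countable \<B>" "\<B> \<subseteq> Pow (carrier A)" "\<forall>a\<in>carrier A. network_at TA \<B> a"
    by (elim exE conjE)
  define C where "C = (\<lambda>(N, m :: nat). (differences A i N, m)) ` (\<N> \<times> UNIV)"
  have "\<exists>\<N>. countable \<N> \<and> \<N> \<subseteq> Pow (topspace TA) \<and> pytkeev_network_at TA \<N> \<one>\<^bsub>A\<^esub>"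
  proof (rule pytkeev_network_at_from_strings[where \<B> = \<B> and C = C and \<V> = "Collect (neighbourhood_string A TA)"])
    show "countable C" unfolding C_def using \<N>(1) by (intro countable_image countable_SIGMA) simp_all
    show "\<exists>V\<in>Collect (neighbourhood_string A TA). V 0 \<subseteq> U" if "openin TA U" "\<one>\<^bsub>A\<^esub> \<in> U" for U
      using A.neighbourhood_string_exists[OF that] by simp
    show "\<one>\<^bsub>A\<^esub> \<in> V 0" if "V \<in> Collect (neighbourhood_string A TA)" for V
      using that A.group_string_one by (simp add: neighbourhood_string_def)
    fix V W
    assume "V \<in> Collect (neighbourhood_string A TA)"
      and "\<And>k. W k \<in> Collect (neighbourhood_string A TA)"
      and tail: "\<And>E m. (E, m) \<in> C \<Longrightarrow> E \<subseteq> V m \<Longrightarrow> \<forall>\<^sub>F k in sequentially. E \<subseteq> W k m"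
    then have V: "neighbourhood_string A TA V" and W: "\<And>k. neighbourhood_string A TA (W k)" by simp_all
    have "neighbourhood_string A TA (\<lambda>m. \<Inter>k::nat. W k m)"
    proof (rule free_abelian_topological_group_string[OF A X(1)])
      show "group_string A (\<lambda>m. \<Inter>k. W k m)"
        using W by (intro A.group_string_Inter) (simp add: neighbourhood_string_def)
      fix \<sigma> x m assume lim: "limitin X \<sigma> x sequentially"
      have "\<forall>\<^sub>F n in sequentially. \<forall>k. inv\<^bsub>A\<^esub> i x \<otimes>\<^bsub>A\<^esub> i (\<sigma> n) \<in> W k m"
      proof (rule A.eventually_in_all_strings[OF i \<N>(3) V W _ lim])
        fix N m assume "N \<in> \<N>" and sub: "differences A i N \<subseteq> V m"
        then have "(differences A i N, m) \<in> C" by (force simp: C_def)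
        from tail[OF this sub] show "\<forall>\<^sub>F k in sequentially. differences A i N \<subseteq> W k m" .
      qed
      then show "\<forall>\<^sub>F n in sequentially. inv\<^bsub>A\<^esub> i x \<otimes>\<^bsub>A\<^esub> i (\<sigma> n) \<in> (\<Inter>k. W k m)" by simp
    qed
    then obtain Q where "openin TA Q" "\<one>\<^bsub>A\<^esub> \<in> Q" "Q \<subseteq> (\<Inter>k. W k 0)"
      unfolding neighbourhood_string_def by blast
    then show "\<exists>Q. openin TA Q \<and> \<one>\<^bsub>A\<^esub> \<in> Q \<and> (\<forall>k::nat. Q \<subseteq> W k 0)"
      by (intro exI[of _ Q]) blast
  qed (use \<B> t1 in simp_all)
  then obtain \<P> where "countable \<P>" "\<P> \<subseteq> Pow (carrier A)" "pytkeev_network_at TA \<P> \<one>\<^bsub>A\<^esub>"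
    by auto
  then show ?thesis using \<B> by (intro A.P0_space_from_one[OF t1 \<B>(1,2)]) simp_all
qed


section \<open>Absolutely convex sets and their strings\<close>

text \<open>The additive group as a record that no longer contains the scalar multiplication, so that the notions
for groups apply.\<close>

definition additive_group :: "(real, 'v) module \<Rightarrow> 'v monoid" where
  "additive_group V = \<lparr>carrier = carrier V, monoid.mult = add V, one = ring.zero V\<rparr>"

lemma additive_group_simps [simp]:
  "carrier (additive_group V) = carrier V"
  "x \<otimes>\<^bsub>additive_group V\<^esub> y = x \<oplus>\<^bsub>V\<^esub> y"
  "\<one>\<^bsub>additive_group V\<^esub> = \<zero>\<^bsub>V\<^esub>"
  by (simp_all add: additive_group_def)

lemma inv_additive_group [simp]: "inv\<^bsub>additive_group V\<^esub> x = \<ominus>\<^bsub>V\<^esub> x"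
  by (simp add: a_inv_def m_inv_def)

locale real_linear_space = module real_ring V for V :: "(real, 'v) module" (structure)
begin

lemma smult_in_carrier [simp]: "x \<in> carrier V \<Longrightarrow> a \<odot> x \<in> carrier V"
  using smult_closed[of a x] by simp

lemma smult_add_left: "x \<in> carrier V \<Longrightarrow> (a + b) \<odot> x = a \<odot> x \<oplus> b \<odot> x"
  using smult_l_distr[of a b x] by simp

lemma smult_add_right: "x \<in> carrier V \<Longrightarrow> y \<in> carrier V \<Longrightarrow> a \<odot> (x \<oplus> y) = a \<odot> x \<oplus> a \<odot> y"
  using smult_r_distr[of a x y] by simp

lemma smult_smult [simp]: "x \<in> carrier V \<Longrightarrow> a \<odot> (b \<odot> x) = (a * b) \<odot> x"
  using smult_assoc1[of a b x] by simp

lemma one_smult [simp]: "x \<in> carrier V \<Longrightarrow> 1 \<odot> x = x"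
  using smult_one[of x] by simp

lemma zero_smult [simp]: "x \<in> carrier V \<Longrightarrow> 0 \<odot> x = \<zero>"
  using smult_l_null[of x] by simp

lemma smult_zero [simp]: "a \<odot> \<zero> = \<zero>"
  using smult_r_null[of a] by simp

lemma minus_eq_smult: "x \<in> carrier V \<Longrightarrow> \<ominus> x = (-1) \<odot> x"
  using smult_add_left[of x "-1" 1] minus_equality[of "(-1) \<odot> x" x] by simp

lemma minus_zero_eq [simp]: "\<ominus> \<zero> = \<zero>"
  by (simp add: minus_eq_smult)

lemma comm_group_additive_group: "comm_group (additive_group V)"
proof (rule comm_groupI)
  show "\<exists>y\<in>carrier (additive_group V). y \<otimes>\<^bsub>additive_group V\<^esub> x = \<one>\<^bsub>additive_group V\<^esub>"
    if "x \<in> carrier (additive_group V)" for x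
    using that by (intro bexI[of _ "\<ominus> x"]) (simp_all add: l_neg)
qed (simp_all add: a_ac)

lemma plain_comm_group_add: "plain_comm_group (additive_group V)"
  by (rule plain_comm_group.intro) (rule comm_group_additive_group)

end

text \<open>The single inequality on \<open>\<bar>s\<bar> + \<bar>t\<bar>\<close> combines convexity and balancedness.\<close>

definition abs_convex :: "(real, 'v) module \<Rightarrow> 'v set \<Rightarrow> bool" where
  "abs_convex V B \<longleftrightarrow> B \<subseteq> carrier V \<and> \<zero>\<^bsub>V\<^esub> \<in> B \<and>
    (\<forall>x\<in>B. \<forall>y\<in>B. \<forall>s t. \<bar>s\<bar> + \<bar>t\<bar> \<le> 1 \<longrightarrow> s \<odot>\<^bsub>V\<^esub> x \<oplus>\<^bsub>V\<^esub> t \<odot>\<^bsub>V\<^esub> y \<in> B)"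

text \<open>The string \<open>2\<^sup>-\<^sup>m B\<close>. Asking for \<open>2\<^sup>m a \<in> B\<close> commutes with intersections by definition.\<close>

definition dilates :: "(real, 'v) module \<Rightarrow> 'v set \<Rightarrow> nat \<Rightarrow> 'v set" where
  "dilates V B m = {a \<in> carrier V. 2 ^ m \<odot>\<^bsub>V\<^esub> a \<in> B}"

lemma abs_convex_Inter:
  assumes "\<And>k::nat. abs_convex V (B k)"
  shows "abs_convex V (\<Inter>k. B k)"
  unfolding abs_convex_def
proof (intro conjI ballI allI impI)
  show "(\<Inter>k. B k) \<subseteq> carrier V" using assms[of 0] by (auto simp: abs_convex_def)
  show "\<zero>\<^bsub>V\<^esub> \<in> (\<Inter>k. B k)" using assms by (simp add: abs_convex_def)
  show "s \<odot>\<^bsub>V\<^esub> x \<oplus>\<^bsub>V\<^esub> t \<odot>\<^bsub>V\<^esub> y \<in> (\<Inter>k. B k)"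
    if "x \<in> (\<Inter>k. B k)" "y \<in> (\<Inter>k. B k)" "\<bar>s\<bar> + \<bar>t\<bar> \<le> 1" for x y and s t :: real
    using assms that by (simp add: abs_convex_def)
qed

lemma dilates_Inter: "dilates V (\<Inter>k::nat. B k) m = (\<Inter>k. dilates V (B k) m)"
  by (auto simp: dilates_def)

context real_linear_space
begin

lemma abs_convex_combination:
  assumes "abs_convex V B" "x \<in> B" "y \<in> B" "\<bar>s\<bar> + \<bar>t\<bar> \<le> 1"
  shows "s \<odot> x \<oplus> t \<odot> y \<in> B"
  using assms unfolding abs_convex_def by blast

lemma abs_convex_carrier: "abs_convex V B \<Longrightarrow> x \<in> B \<Longrightarrow> x \<in> carrier V"
  unfolding abs_convex_def by blast

lemma abs_convex_smult:
  assumes B: "abs_convex V B" and "x \<in> B" "\<bar>t\<bar> \<le> 1"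
  shows "t \<odot> x \<in> B"
proof -
  have "t \<odot> x \<oplus> 0 \<odot> x \<in> B" using assms by (intro abs_convex_combination) simp_all
  then show ?thesis using abs_convex_carrier[OF B \<open>x \<in> B\<close>] by simp
qed

lemma abs_convexI:
  assumes B: "convex_in V B" and zero: "\<zero> \<in> B" and sym: "\<And>x. x \<in> B \<Longrightarrow> \<ominus> x \<in> B"
  shows "abs_convex V B"
  unfolding abs_convex_def
proof (intro conjI ballI allI impI zero)
  show sub: "B \<subseteq> carrier V" using B by (simp add: convex_in_def)
  have conv: "(1 - t) \<odot> x \<oplus> t \<odot> y \<in> B" if "x \<in> B" "y \<in> B" "0 \<le> t" "t \<le> 1" for x y t
    using B that by (simp add: convex_in_def)
  fix x y and s t :: real assume xy: "x \<in> B" "y \<in> B" and st: "\<bar>s\<bar> + \<bar>t\<bar> \<le> 1"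
  have flip: "\<exists>z\<in>B. \<bar>r\<bar> \<odot> z = r \<odot> w" if "w \<in> B" for r w
  proof (cases "0 \<le> r")
    case True
    then show ?thesis using that by (intro bexI[of _ w]) simp_all
  next
    case False
    have "w \<in> carrier V" using that sub by blast
    then show ?thesis using False sym[OF that]
      by (intro bexI[of _ "\<ominus> w"]) (simp_all add: minus_eq_smult)
  qed
  obtain x' y' where x': "x' \<in> B" "\<bar>s\<bar> \<odot> x' = s \<odot> x" and y': "y' \<in> B" "\<bar>t\<bar> \<odot> y' = t \<odot> y"
    using flip xy by metis
  define r where "r = \<bar>s\<bar> + \<bar>t\<bar>"
  have c: "x \<in> carrier V" "y \<in> carrier V" "x' \<in> carrier V" "y' \<in> carrier V" using sub xy x' y' by auto
  show "s \<odot> x \<oplus> t \<odot> y \<in> B"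
  proof (cases "r = 0")
    case True
    then have "s = 0" "t = 0" by (auto simp: r_def)
    then show ?thesis using c zero by simp
  next
    case False
    then have r: "r > 0" unfolding r_def by linarith
    \<comment> \<open>The combination is \<open>r\<close> times a convex combination of \<open>x'\<close> and \<open>y'\<close>, where \<open>r = \<bar>s\<bar> + \<bar>t\<bar> \<le> 1\<close>.\<close>
    define p where "p = (1 - \<bar>t\<bar> / r) \<odot> x' \<oplus> (\<bar>t\<bar> / r) \<odot> y'"
    have "p \<in> B" unfolding p_def using x'(1) y'(1) r by (intro conv) (auto simp: r_def)
    then have "(1 - r) \<odot> \<zero> \<oplus> r \<odot> p \<in> B" using zero st r by (intro conv) (auto simp: r_def)
    then have "r \<odot> p \<in> B" using \<open>p \<in> B\<close> sub by (simp add: subset_iff)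
    moreover have "r * (1 - \<bar>t\<bar> / r) = \<bar>s\<bar>" "r * (\<bar>t\<bar> / r) = \<bar>t\<bar>"
      using r by (simp_all add: right_diff_distrib) (simp add: r_def)
    then have "r \<odot> p = \<bar>s\<bar> \<odot> x' \<oplus> \<bar>t\<bar> \<odot> y'"
      unfolding p_def using c by (simp add: smult_add_right)
    ultimately show ?thesis using x'(2) y'(2) by simp
  qed
qed

lemma dilates_0: "abs_convex V B \<Longrightarrow> dilates V B 0 = B"
  using abs_convex_carrier by (auto simp: dilates_def)

lemma group_string_dilates:
  assumes B: "abs_convex V B"
  shows "group_string (additive_group V) (dilates V B)"
  unfolding group_string_def
proof (intro allI conjI ballI)
  fix m
  show "\<one>\<^bsub>additive_group V\<^esub> \<in> dilates V B m" using B by (simp add: dilates_def abs_convex_def)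
  show "dilates V B m \<subseteq> carrier (additive_group V)" by (auto simp: dilates_def)
  show "inv\<^bsub>additive_group V\<^esub> a \<in> dilates V B m" if "a \<in> dilates V B m" for a
  proof -
    from that have a: "a \<in> carrier V" "2 ^ m \<odot> a \<in> B" by (simp_all add: dilates_def)
    have "(-1) \<odot> (2 ^ m \<odot> a) \<in> B" by (rule abs_convex_smult[OF B a(2)]) simp
    then show ?thesis using a(1) by (simp add: dilates_def inv_additive_group minus_eq_smult)
  qed
  show "a \<otimes>\<^bsub>additive_group V\<^esub> b \<in> dilates V B m"
    if "a \<in> dilates V B (Suc m)" "b \<in> dilates V B (Suc m)" for a b
  proof -
    from that have ab: "a \<in> carrier V" "b \<in> carrier V" "2 ^ Suc m \<odot> a \<in> B" "2 ^ Suc m \<odot> b \<in> B"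
      by (simp_all add: dilates_def)
    have "(1/2) \<odot> (2 ^ Suc m \<odot> a) \<oplus> (1/2) \<odot> (2 ^ Suc m \<odot> b) \<in> B"
      by (rule abs_convex_combination[OF B ab(3,4)]) simp
    then show ?thesis using ab(1,2) by (simp add: dilates_def smult_add_right)
  qed
qed

lemma convex_in_dilates:
  assumes B: "abs_convex V B"
  shows "convex_in V (dilates V B m)"
  unfolding convex_in_def
proof (intro conjI ballI allI impI)
  show "dilates V B m \<subseteq> carrier V" by (auto simp: dilates_def)
  fix x y and t :: real assume "x \<in> dilates V B m" "y \<in> dilates V B m" and t: "0 \<le> t \<and> t \<le> 1"
  then have xy: "x \<in> carrier V" "y \<in> carrier V" "2 ^ m \<odot> x \<in> B" "2 ^ m \<odot> y \<in> B"
    by (simp_all add: dilates_def)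
  have "(1 - t) \<odot> (2 ^ m \<odot> x) \<oplus> t \<odot> (2 ^ m \<odot> y) \<in> B"
    by (rule abs_convex_combination[OF B xy(3,4)]) (use t in simp)
  then show "(1 - t) \<odot> x \<oplus> t \<odot> y \<in> dilates V B m"
    using xy(1,2) by (simp add: dilates_def smult_add_right mult.commute)
qed

lemma absorbing_mono:
  assumes B: "abs_convex V B" and x: "x \<in> carrier V" "(1 / 2 ^ m) \<odot> x \<in> B" and "m \<le> n"
  shows "(1 / 2 ^ n) \<odot> x \<in> B"
proof -
  have "(1 / 2 ^ (n - m)) \<odot> ((1 / 2 ^ m) \<odot> x) \<in> B"
    by (rule abs_convex_smult[OF B x(2)]) simp
  then show ?thesis using x(1) \<open>m \<le> n\<close> by (simp add: power_add[symmetric])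
qed

text \<open>The two error terms in the continuity of the scalar multiplication at \<open>(c, x)\<close>.\<close>

lemma smult_difference:
  assumes "x \<in> carrier V" "y \<in> carrier V"
  shows "d \<odot> y = c \<odot> x \<oplus> ((d - c) \<odot> x \<oplus> d \<odot> (\<ominus> x \<oplus> y))"
proof -
  have "d \<odot> (\<ominus> x \<oplus> y) = (- d) \<odot> x \<oplus> d \<odot> y"
    using assms by (simp add: minus_eq_smult smult_add_right)
  then have "c \<odot> x \<oplus> ((d - c) \<odot> x \<oplus> d \<odot> (\<ominus> x \<oplus> y)) =
      (c \<odot> x \<oplus> ((d - c) \<odot> x \<oplus> (- d) \<odot> x)) \<oplus> d \<odot> y"
    using assms by (simp add: a_assoc)
  also have "c \<odot> x \<oplus> ((d - c) \<odot> x \<oplus> (- d) \<odot> x) = \<zero>"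
    using assms by (simp add: smult_add_left[symmetric])
  finally show ?thesis using assms by simp
qed

text \<open>That \<open>B\<close> is absorbing is what makes \<open>c \<mapsto> c x\<close> continuous for fixed \<open>x\<close>.\<close>

lemma locally_convex_space_dilates:
  assumes B: "abs_convex V B" and abs: "\<And>x. x \<in> carrier V \<Longrightarrow> \<exists>m. (1 / 2 ^ m) \<odot> x \<in> B"
  shows "locally_convex_space V (string_topology (additive_group V) (dilates V B))"
proof -
  let ?T = "string_topology (additive_group V) (dilates V B)"
  interpret A: plain_comm_group "additive_group V" by (rule plain_comm_group_add)
  note S = group_string_dilates[OF B]
  have top: "topspace ?T = carrier V" using A.topspace_string_topology[OF S] by simp
  have atg: "abelian_topological_group (additive_group V) ?T" by (rule A.abelian_topological_group_string[OF S])
  have "continuous_map (prod_topology euclideanreal ?T) ?T (\<lambda>(c, x). c \<odot> x)"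
    unfolding continuous_map_def
  proof (intro conjI allI impI)
    fix U assume U: "openin ?T U"
    let ?S = "{z \<in> topspace (prod_topology euclideanreal ?T). (case z of (c, x) \<Rightarrow> c \<odot> x) \<in> U}"
    show "openin (prod_topology euclideanreal ?T) ?S"
      unfolding openin_prod_topology_alt
    proof (intro allI impI)
      fix c x assume "(c, x) \<in> ?S"
      then have x: "x \<in> carrier V" "c \<odot> x \<in> U" by (simp_all add: top)
      then obtain m where m: "\<forall>v\<in>dilates V B m. c \<odot> x \<oplus> v \<in> U"
        using U unfolding A.openin_string_topology[OF S] by auto
      obtain p where p: "(1 / 2 ^ p) \<odot> x \<in> B" using abs[OF x(1)] by blast
      obtain r where "\<bar>c\<bar> + 1 < 2 ^ r" using real_arch_pow[of 2 "\<bar>c\<bar> + 1"] by auto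
      then have r: "\<bar>c\<bar> + 1 \<le> 2 ^ r" by simp
      define P where "P = ball c (1 / 2 ^ (m + 1 + p))"
      obtain Q where Q: "openin ?T Q" "x \<in> Q" "\<And>y. y \<in> Q \<Longrightarrow> \<ominus> x \<oplus> y \<in> dilates V B (m + 1 + r)"
        using A.string_topology_neighbourhood[OF S, of x "m + 1 + r"] x(1) by (auto simp: inv_additive_group)
      have "(d, y) \<in> ?S" if "d \<in> P" "y \<in> Q" for d y
      proof -
        have y: "y \<in> carrier V" using openin_subset[OF Q(1)] that(2) by (auto simp: top)
        define u where "u = \<ominus> x \<oplus> y"
        have u: "u \<in> carrier V" "2 ^ (m + 1 + r) \<odot> u \<in> B"
          using Q(3)[OF that(2)] by (simp_all add: dilates_def u_def)
        have dc: "\<bar>d - c\<bar> < 1 / 2 ^ (m + 1 + p)"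
          using that(1) by (simp add: P_def dist_real_def abs_minus_commute)
        also have "\<dots> \<le> 1"
          using power_le_one[of "1 / 2 :: real" "m + 1 + p"] by (simp add: power_one_over)
        finally have "\<bar>d\<bar> \<le> 2 ^ r" using r by linarith
        then have t: "\<bar>d / 2 ^ (r + 1)\<bar> \<le> 1 / 2" by (simp add: divide_simps)
        have "\<bar>2 ^ (m + p) * (d - c)\<bar> = 2 ^ (m + p) * \<bar>d - c\<bar>" by (simp add: abs_mult)
        also have "\<dots> \<le> 2 ^ (m + p) * (1 / 2 ^ (m + 1 + p))"
          using dc by (intro mult_left_mono) simp_all
        also have "\<dots> = 1 / 2" by (simp add: power_add)
        finally have s: "\<bar>2 ^ (m + p) * (d - c)\<bar> \<le> 1 / 2" .
        \<comment> \<open>Both error terms, multiplied by \<open>2\<^sup>m\<close>, are at most half of a point of \<open>B\<close>; the constants \<open>p\<close>, \<open>r\<close> and the extra \<open>1\<close> were chosen for this.\<close>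
        have "(2 ^ (m + p) * (d - c)) \<odot> ((1 / 2 ^ p) \<odot> x) \<oplus> (d / 2 ^ (r + 1)) \<odot> (2 ^ (m + 1 + r) \<odot> u) \<in> B"
          by (rule abs_convex_combination[OF B p u(2)]) (use s t in linarith)
        moreover have "2 ^ (m + p) * (d - c) * (1 / 2 ^ p) = 2 ^ m * (d - c)"
          "d / 2 ^ (r + 1) * 2 ^ (m + 1 + r) = 2 ^ m * d"
          by (simp_all add: power_add)
        ultimately have "2 ^ m \<odot> ((d - c) \<odot> x \<oplus> d \<odot> u) \<in> B"
          using x(1) u(1) by (simp add: smult_add_right)
        then have "(d - c) \<odot> x \<oplus> d \<odot> u \<in> dilates V B m" using x(1) u(1) by (simp add: dilates_def)
        with m have "c \<odot> x \<oplus> ((d - c) \<odot> x \<oplus> d \<odot> u) \<in> U" by blast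
        then show ?thesis using smult_difference[OF x(1) y, of d c] y by (simp add: top u_def)
      qed
      then have "P \<times> Q \<subseteq> ?S" by blast
      moreover have "openin euclideanreal P" "c \<in> P" by (simp_all add: P_def)
      ultimately show "\<exists>P Q. openin euclideanreal P \<and> openin ?T Q \<and> c \<in> P \<and> x \<in> Q \<and> P \<times> Q \<subseteq> ?S"
        using Q(1,2) by (intro exI[of _ P] exI[of _ Q]) simp
    qed
  qed (simp add: top Pi_iff)
  moreover have "neighbourhood_base_at \<zero> (convex_in V) ?T"
    unfolding neighbourhood_base_at_def
  proof (intro allI impI, elim conjE)
    fix W assume W: "openin ?T W" "\<zero> \<in> W"
    then obtain m where m: "\<forall>v\<in>dilates V B m. \<zero> \<oplus> v \<in> W"
      using W unfolding A.openin_string_topology[OF S] by auto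
    have sub: "dilates V B m \<subseteq> W"
    proof
      fix v assume v: "v \<in> dilates V B m"
      then have "v \<in> carrier V" by (simp add: dilates_def)
      with m v show "v \<in> W" by force
    qed
    obtain Q where Q: "openin ?T Q" "\<zero> \<in> Q" "\<And>b. b \<in> Q \<Longrightarrow> \<ominus> \<zero> \<oplus> b \<in> dilates V B m"
      using A.string_topology_neighbourhood[OF S, of \<zero> m] by (auto simp: inv_additive_group)
    have "Q \<subseteq> dilates V B m"
    proof
      fix b assume b: "b \<in> Q"
      then have "b \<in> carrier V" using openin_subset[OF Q(1)] by (auto simp: top)
      with Q(3)[OF b] show "b \<in> dilates V B m" by (simp add: minus_eq_smult)
    qed
    with Q(1,2) sub convex_in_dilates[OF B]
    show "\<exists>U K. openin ?T U \<and> convex_in V K \<and> \<zero> \<in> U \<and> U \<subseteq> K \<and> K \<subseteq> W" by meson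
  qed
  ultimately show ?thesis
    using atg top module_axioms
    by (simp add: locally_convex_space_def linear_topological_space_def abelian_topological_group_def)
qed

end

lemma linear_topological_space_add_group:
  assumes "linear_topological_space V T"
  shows "abelian_topological_group (additive_group V) T"
proof -
  have V: "module real_ring V" using assms by (simp add: linear_topological_space_def)
  interpret real_linear_space V by (rule real_linear_space.intro[OF V])
  have top: "topspace T = carrier V"
    and add: "continuous_map (prod_topology T T) T (\<lambda>(x, y). x \<oplus>\<^bsub>V\<^esub> y)"
    and smult: "continuous_map (prod_topology euclideanreal T) T (\<lambda>(c, x). c \<odot>\<^bsub>V\<^esub> x)"
    using assms by (simp_all add: linear_topological_space_def)
  have "continuous_map T T (\<lambda>x. (-1) \<odot>\<^bsub>V\<^esub> x)"
    by (rule continuous_map_binop[OF smult]) (simp_all add: continuous_map_id[unfolded id_def])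
  then have "continuous_map T T (\<lambda>x. inv\<^bsub>additive_group V\<^esub> x)"
    by (rule continuous_map_eq) (simp add: top inv_additive_group minus_eq_smult)
  then show ?thesis
    using add top comm_group_additive_group by (simp add: abelian_topological_group_def)
qed

locale real_locally_convex_space =
  fixes V :: "(real, 'v) module" (structure) and T :: "'v topology"
  assumes locally_convex: "locally_convex_space V T"

sublocale real_locally_convex_space \<subseteq> real_linear_space
  using locally_convex
  by (intro real_linear_space.intro) (simp add: locally_convex_space_def linear_topological_space_def)

sublocale real_locally_convex_space \<subseteq> additive: topological_comm_group "additive_group V" T
  using locally_convex
  by (intro topological_comm_group.intro linear_topological_space_add_group)
    (simp add: locally_convex_space_def)

context real_locally_convex_space
begin

lemma continuous_smult:
  assumes "continuous_map S euclideanreal c" "continuous_map S T f"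
  shows "continuous_map S T (\<lambda>x. c x \<odot> f x)"
  using locally_convex continuous_map_binop[OF _ assms]
  unfolding locally_convex_space_def linear_topological_space_def by blast

lemma absorbing_open:
  assumes Q: "openin T Q" "\<zero> \<in> Q" and x: "x \<in> carrier V"
  shows "\<exists>m. (1 / 2 ^ m) \<odot> x \<in> Q"
proof -
  have "continuous_map euclideanreal T (\<lambda>c. c \<odot> x)"
    by (intro continuous_smult continuous_map_id[unfolded id_def]) (simp add: x)
  from openin_continuous_map_preimage[OF this Q(1)] have "open {c. c \<odot> x \<in> Q}" by simp
  moreover have "0 \<in> {c. c \<odot> x \<in> Q}" using Q(2) x by simp
  moreover have "(\<lambda>m. (1 / 2) ^ m :: real) \<longlonglongrightarrow> 0" by (rule LIMSEQ_realpow_zero) simp_all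
  ultimately have "\<forall>\<^sub>F m in sequentially. (1 / 2) ^ m \<in> {c. c \<odot> x \<in> Q}"
    by (intro topological_tendstoD)
  then show ?thesis by (auto simp: eventually_sequentially power_one_over)
qed

text \<open>Intersecting a convex neighbourhood with its negative suffices: convex symmetric sets containing
\<open>\<zero>\<close> are absolutely convex.\<close>

lemma abs_convex_neighbourhood_exists:
  assumes U: "openin T U" "\<zero> \<in> U"
  shows "\<exists>B Q. abs_convex V B \<and> openin T Q \<and> \<zero> \<in> Q \<and> Q \<subseteq> B \<and> B \<subseteq> U"
proof -
  have "neighbourhood_base_at \<zero> (convex_in V) T"
    using locally_convex by (simp add: locally_convex_space_def)
  with U obtain O' K where K: "openin T O'" "convex_in V K" "\<zero> \<in> O'" "O' \<subseteq> K" "K \<subseteq> U"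
    unfolding neighbourhood_base_at_def by meson
  define B where "B = {x \<in> K. \<ominus> x \<in> K}"
  define Q where "Q = O' \<inter> {b \<in> carrier V. \<ominus> b \<in> O'}"
  have Kc: "x \<in> carrier V" if "x \<in> K" for x using K(2) that by (auto simp: convex_in_def)
  have "openin T Q"
    unfolding Q_def using K(1) additive.openin_inverse[OF K(1)] by (simp add: inv_additive_group openin_Int)
  moreover have "\<zero> \<in> Q" using K(3) by (simp add: Q_def)
  moreover have "Q \<subseteq> B" using K(4) by (auto simp: Q_def B_def)
  moreover have "B \<subseteq> U" using K(5) by (auto simp: B_def)
  moreover have "abs_convex V B"
  proof (rule abs_convexI)
    show "\<zero> \<in> B" using K(3,4) by (auto simp: B_def)
    show "\<ominus> x \<in> B" if "x \<in> B" for x using that Kc by (auto simp: B_def)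
    show "convex_in V B"
      unfolding convex_in_def
    proof (intro conjI ballI allI impI)
      show "B \<subseteq> carrier V" using Kc by (auto simp: B_def)
      fix x y and t :: real assume xy: "x \<in> B" "y \<in> B" and t: "0 \<le> t \<and> t \<le> 1"
      have c: "x \<in> carrier V" "y \<in> carrier V" using xy Kc by (auto simp: B_def)
      have "(1 - t) \<odot> x \<oplus> t \<odot> y \<in> K" "(1 - t) \<odot> (\<ominus> x) \<oplus> t \<odot> (\<ominus> y) \<in> K"
        using K(2) xy t by (auto simp: convex_in_def B_def)
      moreover have "(1 - t) \<odot> (\<ominus> x) \<oplus> t \<odot> (\<ominus> y) = \<ominus> ((1 - t) \<odot> x \<oplus> t \<odot> y)"
        using c by (simp add: minus_eq_smult smult_add_right)
      ultimately show "(1 - t) \<odot> x \<oplus> t \<odot> y \<in> B" by (simp add: B_def)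
    qed
  qed
  ultimately show ?thesis by blast
qed

lemma neighbourhood_string_dilates:
  assumes B: "abs_convex V B" and Q: "openin T Q" "\<zero> \<in> Q" "Q \<subseteq> B"
  shows "neighbourhood_string (additive_group V) T (dilates V B)"
  unfolding neighbourhood_string_def
proof (intro conjI allI group_string_dilates[OF B])
  fix m
  have "continuous_map T T (\<lambda>a. 2 ^ m \<odot> a)"
    by (intro continuous_smult continuous_map_id[unfolded id_def]) simp
  from openin_continuous_map_preimage[OF this Q(1)]
  have "openin T {a \<in> carrier V. 2 ^ m \<odot> a \<in> Q}" by simp
  moreover have "{a \<in> carrier V. 2 ^ m \<odot> a \<in> Q} \<subseteq> dilates V B m"
    using Q(3) by (auto simp: dilates_def)
  ultimately show "\<exists>Q. openin T Q \<and> \<one>\<^bsub>additive_group V\<^esub> \<in> Q \<and> Q \<subseteq> dilates V B m"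
    using Q(2) by (intro exI[of _ "{a \<in> carrier V. 2 ^ m \<odot> a \<in> Q}"]) simp
qed

end


section \<open>The free locally convex space\<close>

text \<open>Every element is a finite sum of multiples of generators, stated as an induction principle. The proof is
minimality of the span, applied to the set of all \<open>a\<close> such that adding multiples of \<open>a\<close> preserves \<open>P\<close>.\<close>

lemma free_locally_convex_space_induct [consumes 2, case_names zero step]:
  assumes L: "free_locally_convex_space X L TL j" and a: "a \<in> carrier L"
    and zero: "P \<zero>\<^bsub>L\<^esub>"
    and step: "\<And>t x b. x \<in> topspace X \<Longrightarrow> b \<in> carrier L \<Longrightarrow> P b \<Longrightarrow> P (t \<odot>\<^bsub>L\<^esub> j x \<oplus>\<^bsub>L\<^esub> b)"
  shows "P a"
proof -
  have lc: "locally_convex_space L TL" and j: "continuous_map X TL j"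
    using L by (auto simp: free_locally_convex_space_def)
  interpret L: real_locally_convex_space L TL by (rule real_locally_convex_space.intro[OF lc])
  have jL: "j x \<in> carrier L" if "x \<in> topspace X" for x
    using that j L.additive.topspace_T by (auto simp: continuous_map_def)
  define E where "E = {a \<in> carrier L. \<forall>b\<in>carrier L. \<forall>t. P b \<longrightarrow> P (t \<odot>\<^bsub>L\<^esub> a \<oplus>\<^bsub>L\<^esub> b)}"
  have E_smult: "s \<odot>\<^bsub>L\<^esub> a \<in> E" if "a \<in> E" for a s
    using that by (simp add: E_def)
  have "submodule E real_ring L"
  proof (rule L.submoduleI)
    show "E \<subseteq> carrier L" by (auto simp: E_def)
    show "\<zero>\<^bsub>L\<^esub> \<in> E" by (simp add: E_def)
    show "\<ominus>\<^bsub>L\<^esub> a \<in> E" if "a \<in> E" for a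
      using E_smult[OF that, of "-1"] that by (simp add: E_def L.minus_eq_smult)
    show "a \<oplus>\<^bsub>L\<^esub> b \<in> E" if "a \<in> E" "b \<in> E" for a b
      using that by (simp add: E_def L.smult_add_right L.a_assoc)
    show "s \<odot>\<^bsub>L\<^esub> a \<in> E" if "a \<in> E" for s a by (rule E_smult[OF that])
  qed
  moreover have "j ` topspace X \<subseteq> E" using jL step by (auto simp: E_def)
  ultimately have "span_in L (j ` topspace X) \<subseteq> E" by (rule span_in_minimal)
  then have "a \<in> E" using free_locally_convex_space_spanned[OF L] a by blast
  then have "P (1 \<odot>\<^bsub>L\<^esub> a \<oplus>\<^bsub>L\<^esub> \<zero>\<^bsub>L\<^esub>)" using zero unfolding E_def by blast
  then show ?thesis using a by simp
qed

lemma (in real_linear_space) linear_operators_zero: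
  assumes "real_linear_space W" "h \<in> linear_operators V W"
  shows "h \<zero> = \<zero>\<^bsub>W\<^esub>"
proof -
  interpret W: real_linear_space W by fact
  have "h (0 \<odot> \<zero>) = 0 \<odot>\<^bsub>W\<^esub> h \<zero>" "h \<zero> \<in> carrier W"
    using assms(2) zero_closed unfolding linear_operators_def by blast+
  then show ?thesis by simp
qed

text \<open>The linear counterpart of \<open>free_abelian_topological_group_string\<close>. The topology given by the dilates of
\<open>B\<close> is a vector space topology only if \<open>B\<close> absorbs every element, which follows by induction from the
generators.\<close>

lemma free_locally_convex_space_neighbourhood:
  assumes L: "free_locally_convex_space X L TL j" and X: "sequential_space X"
    and B: "abs_convex L B" and absorb: "\<And>x. x \<in> topspace X \<Longrightarrow> \<exists>m. (1 / 2 ^ m) \<odot>\<^bsub>L\<^esub> j x \<in> B"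
    and ev: "\<And>\<sigma> x m. range \<sigma> \<subseteq> topspace X \<Longrightarrow> limitin X \<sigma> x sequentially \<Longrightarrow>
      \<forall>\<^sub>F n in sequentially. \<ominus>\<^bsub>L\<^esub> j x \<oplus>\<^bsub>L\<^esub> j (\<sigma> n) \<in> dilates L B m"
  shows "\<exists>Q. openin TL Q \<and> \<zero>\<^bsub>L\<^esub> \<in> Q \<and> Q \<subseteq> B"
proof -
  have lc: "locally_convex_space L TL" and j: "continuous_map X TL j"
    using L by (auto simp: free_locally_convex_space_def)
  interpret L: real_locally_convex_space L TL by (rule real_locally_convex_space.intro[OF lc])
  have top: "topspace TL = carrier L" using L.additive.topspace_T by simp
  have jL: "j x \<in> carrier L" if "x \<in> topspace X" for x
    using that j top by (auto simp: continuous_map_def)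
  have absorb_all: "\<exists>m. (1 / 2 ^ m) \<odot>\<^bsub>L\<^esub> a \<in> B" if "a \<in> carrier L" for a
    using L that
  proof (induction rule: free_locally_convex_space_induct)
    case zero
    then show ?case using B by (simp add: abs_convex_def)
  next
    case (step t x b)
    obtain p where p: "(1 / 2 ^ p) \<odot>\<^bsub>L\<^esub> j x \<in> B" using absorb[OF step(1)] by blast
    obtain q where q: "(1 / 2 ^ q) \<odot>\<^bsub>L\<^esub> b \<in> B" using step(3) by blast
    obtain r where r: "\<bar>t\<bar> < 2 ^ r" using real_arch_pow[of 2 "\<bar>t\<bar>"] by auto
    define n where "n = p + q + r"
    have "(1 / 2 ^ (p + q)) \<odot>\<^bsub>L\<^esub> j x \<in> B" "(1 / 2 ^ (p + q + r)) \<odot>\<^bsub>L\<^esub> b \<in> B"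
      using L.absorbing_mono[OF B jL[OF step(1)] p, of "p + q"] L.absorbing_mono[OF B step(2) q, of "p + q + r"]
      by simp_all
    then have "(t / 2 ^ (r + 1)) \<odot>\<^bsub>L\<^esub> ((1 / 2 ^ (p + q)) \<odot>\<^bsub>L\<^esub> j x) \<oplus>\<^bsub>L\<^esub>
        (1 / 2) \<odot>\<^bsub>L\<^esub> ((1 / 2 ^ (p + q + r)) \<odot>\<^bsub>L\<^esub> b) \<in> B"
      by (rule L.abs_convex_combination[OF B]) (use r in \<open>simp add: divide_simps\<close>)
    then have "(1 / 2 ^ (n + 1)) \<odot>\<^bsub>L\<^esub> (t \<odot>\<^bsub>L\<^esub> j x \<oplus>\<^bsub>L\<^esub> b) \<in> B"
      using jL[OF step(1)] step(2) by (simp add: L.smult_add_right n_def power_add mult_ac)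
    then show ?case by blast
  qed
  define S where "S = dilates L B"
  have S: "group_string (additive_group L) S" unfolding S_def by (rule L.group_string_dilates[OF B])
  let ?T = "string_topology (additive_group L) S"
  have lcT: "locally_convex_space L ?T"
    unfolding S_def using B absorb_all by (rule L.locally_convex_space_dilates)
  have "continuous_map X ?T j"
    using L.comm_group_additive_group X S
  proof (rule continuous_map_string_topology)
    show "j \<in> topspace X \<rightarrow> carrier (additive_group L)" using jL by simp
    show "\<forall>\<^sub>F n in sequentially. inv\<^bsub>additive_group L\<^esub> j x \<otimes>\<^bsub>additive_group L\<^esub> j (\<sigma> n) \<in> S m"
      if "range \<sigma> \<subseteq> topspace X" "limitin X \<sigma> x sequentially" for \<sigma> x m
      using ev[OF that, of m] by (simp add: S_def)
  qed
  moreover have "linear_factorization X L TL j L ?T"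
    by (rule free_locally_convex_space_universal[OF L lcT])
  ultimately obtain h where h: "h \<in> linear_operators L L" "continuous_map TL ?T h"
    "\<forall>x\<in>topspace X. j x = h (j x)"
    unfolding linear_factorization_def by blast
  have hadd: "h (a \<oplus>\<^bsub>L\<^esub> b) = h a \<oplus>\<^bsub>L\<^esub> h b" and hsmult: "h (t \<odot>\<^bsub>L\<^esub> a) = t \<odot>\<^bsub>L\<^esub> h a"
    if "a \<in> carrier L" "b \<in> carrier L" for a b t
    using h(1) that unfolding linear_operators_def by auto
  have id: "h a = a" if "a \<in> carrier L" for a
    using L that
  proof (induction rule: free_locally_convex_space_induct)
    case zero
    show ?case by (rule L.linear_operators_zero[OF L.real_linear_space_axioms h(1)])
  next
    case (step t x b)
    have "h (j x) = j x" using h(3) step(1) by simp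
    then show ?case using step(2,3) jL[OF step(1)] hsmult[OF jL[OF step(1)] step(2)] by (simp add: hadd)
  qed
  obtain Q where Q: "openin ?T Q" "\<zero>\<^bsub>L\<^esub> \<in> Q" "\<And>b. b \<in> Q \<Longrightarrow> \<ominus>\<^bsub>L\<^esub> \<zero>\<^bsub>L\<^esub> \<oplus>\<^bsub>L\<^esub> b \<in> S 0"
    using L.additive.string_topology_neighbourhood[OF S, of "\<zero>\<^bsub>L\<^esub>" 0] by auto
  have "openin TL {a \<in> carrier L. h a \<in> Q}"
    using openin_continuous_map_preimage[OF h(2) Q(1)] by (simp add: top)
  moreover have "{a \<in> carrier L. h a \<in> Q} \<subseteq> B"
  proof
    fix a assume "a \<in> {a \<in> carrier L. h a \<in> Q}"
    then show "a \<in> B" using Q(3)[of a] id[of a] L.dilates_0[OF B] by (simp add: S_def)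
  qed
  moreover have "\<zero>\<^bsub>L\<^esub> \<in> {a \<in> carrier L. h a \<in> Q}" using Q(2) id by simp
  ultimately show ?thesis by blast
qed

lemma free_locally_convex_space_finsum:
  assumes L: "free_locally_convex_space X L TL j" and a: "a \<in> carrier L"
  shows "\<exists>F (c :: 'a \<Rightarrow> real). finite F \<and> F \<subseteq> topspace X \<and> a = (\<Oplus>\<^bsub>L\<^esub>x\<in>F. c x \<odot>\<^bsub>L\<^esub> j x)"
proof -
  have lc: "locally_convex_space L TL" and j: "continuous_map X TL j"
    using L by (auto simp: free_locally_convex_space_def)
  interpret L: real_locally_convex_space L TL by (rule real_locally_convex_space.intro[OF lc])
  have jL: "j x \<in> carrier L" if "x \<in> topspace X" for x
    using that j L.additive.topspace_T by (auto simp: continuous_map_def)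
  show ?thesis
    using L a
  proof (induction rule: free_locally_convex_space_induct)
    case zero
    show ?case by (intro exI[of _ "{}"]) simp
  next
    case (step t z b)
    then obtain F c where F: "finite F" "F \<subseteq> topspace X" "b = (\<Oplus>\<^bsub>L\<^esub>x\<in>F. (c x :: real) \<odot>\<^bsub>L\<^esub> j x)"
      by blast
    define D where "D = insert z F"
    have jD: "j x \<in> carrier L" if "x \<in> D" for x using that F(2) step(1) jL by (auto simp: D_def)
    have extend: "(\<Oplus>\<^bsub>L\<^esub>x\<in>E. d x \<odot>\<^bsub>L\<^esub> j x) = (\<Oplus>\<^bsub>L\<^esub>x\<in>D. (if x \<in> E then d x else 0) \<odot>\<^bsub>L\<^esub> j x)"
      if "E \<subseteq> D" for E and d :: "'a \<Rightarrow> real"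
      using that jD F(1) by (intro L.add.finprod_mono_neutral_cong_left) (auto simp: D_def)
    have "t \<odot>\<^bsub>L\<^esub> j z = (\<Oplus>\<^bsub>L\<^esub>x\<in>{z}. t \<odot>\<^bsub>L\<^esub> j x)" using jL[OF step(1)] by simp
    also have "\<dots> = (\<Oplus>\<^bsub>L\<^esub>x\<in>D. (if x \<in> {z} then t else 0) \<odot>\<^bsub>L\<^esub> j x)"
      by (rule extend) (simp add: D_def)
    finally have "t \<odot>\<^bsub>L\<^esub> j z \<oplus>\<^bsub>L\<^esub> b = (\<Oplus>\<^bsub>L\<^esub>x\<in>D. (if x \<in> {z} then t else 0) \<odot>\<^bsub>L\<^esub> j x) \<oplus>\<^bsub>L\<^esub>
        (\<Oplus>\<^bsub>L\<^esub>x\<in>D. (if x \<in> F then c x else 0) \<odot>\<^bsub>L\<^esub> j x)"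
      using F(3) extend[of F c] by (simp add: D_def subset_insertI)
    also have "\<dots> = (\<Oplus>\<^bsub>L\<^esub>x\<in>D. (if x \<in> {z} then t else 0) \<odot>\<^bsub>L\<^esub> j x \<oplus>\<^bsub>L\<^esub> (if x \<in> F then c x else 0) \<odot>\<^bsub>L\<^esub> j x)"
      by (rule L.finsum_addf[symmetric]) (simp_all add: jD Pi_iff)
    also have "\<dots> = (\<Oplus>\<^bsub>L\<^esub>x\<in>D. ((if x \<in> {z} then t else 0) + (if x \<in> F then c x else 0)) \<odot>\<^bsub>L\<^esub> j x)"
      by (intro L.add.finprod_cong' refl Pi_I)
        (simp_all add: jD L.smult_add_left split del: if_split)
    finally show ?case using F(1,2) step(1)
      by (intro exI[of _ D] exI[of _ "\<lambda>x. (if x \<in> {z} then t else 0) + (if x \<in> F then c x else 0)"])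
        (simp add: D_def)
  qed
qed

definition real_module :: "(real, real) module" where
  "real_module = \<lparr>carrier = UNIV, monoid.mult = (\<lambda>x y. x), one = 0, ring.zero = 0, add = (+), smult = (*)\<rparr>"

lemma real_module_simps [simp]:
  "carrier real_module = UNIV" "\<zero>\<^bsub>real_module\<^esub> = 0" "x \<oplus>\<^bsub>real_module\<^esub> y = x + y"
  "c \<odot>\<^bsub>real_module\<^esub> x = c * x"
  by (simp_all add: real_module_def)

lemma module_real_module: "module real_ring real_module"
proof (rule moduleI[OF cring_real_ring])
  show "abelian_group real_module"
  proof (rule abelian_groupI)
    show "\<exists>y\<in>carrier real_module. y \<oplus>\<^bsub>real_module\<^esub> x = \<zero>\<^bsub>real_module\<^esub>" for x
      by (intro bexI[of _ "- x"]) simp_all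
  qed simp_all
qed (simp_all add: algebra_simps)

lemma locally_convex_space_real: "locally_convex_space real_module euclideanreal"
proof -
  have "continuous_map (prod_topology euclideanreal euclideanreal) euclideanreal (\<lambda>z. fst z + snd z)"
    "continuous_map (prod_topology euclideanreal euclideanreal) euclideanreal (\<lambda>z. fst z * snd z)"
    by (intro continuous_map_add continuous_map_real_mult continuous_map_fst continuous_map_snd)+
  moreover have "neighbourhood_base_at 0 (convex_in real_module) euclideanreal"
    unfolding neighbourhood_base_at_def
  proof (intro allI impI, elim conjE)
    fix W :: "real set" assume "openin euclideanreal W" "0 \<in> W"
    then obtain e where e: "e > 0" "ball 0 e \<subseteq> W" by (auto simp: open_contains_ball)
    have "convex_in real_module (ball 0 e)"
      unfolding convex_in_def
    proof (intro conjI ballI allI impI)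
      fix x y t :: real assume "x \<in> ball 0 e" "y \<in> ball 0 e" "0 \<le> t \<and> t \<le> 1"
      then have "(1 - t) *\<^sub>R x + t *\<^sub>R y \<in> ball 0 e"
        by (intro convexD[OF convex_ball]) simp_all
      then show "(1 - t) \<odot>\<^bsub>real_module\<^esub> x \<oplus>\<^bsub>real_module\<^esub> t \<odot>\<^bsub>real_module\<^esub> y \<in> ball 0 e"
        by simp
    qed simp
    then show "\<exists>U K. openin euclideanreal U \<and> convex_in real_module K \<and> 0 \<in> U \<and> U \<subseteq> K \<and> K \<subseteq> W"
      using e by (intro exI[of _ "ball 0 e"]) simp
  qed
  ultimately show ?thesis
    using module_real_module
    by (simp add: locally_convex_space_def linear_topological_space_def case_prod_unfold)
qed

lemma (in real_linear_space) linear_functional_finsum: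
  assumes h: "h \<in> linear_operators V real_module" and F: "finite F" "\<And>x. x \<in> F \<Longrightarrow> f x \<in> carrier V"
  shows "h (\<Oplus>x\<in>F. c x \<odot> f x) = (\<Sum>x\<in>F. c x * h (f x))"
  using F
proof (induction F rule: finite_induct)
  case empty
  then show ?case
    using linear_operators_zero[OF real_linear_space.intro[OF module_real_module] h] by simp
next
  case (insert x F)
  then have "(\<Oplus>x\<in>F. c x \<odot> f x) \<in> carrier V" "c x \<odot> f x \<in> carrier V" "f x \<in> carrier V"
    by (intro finsum_closed, simp_all add: Pi_iff)
  then have "h (c x \<odot> f x \<oplus> (\<Oplus>x\<in>F. c x \<odot> f x)) = c x * h (f x) + h (\<Oplus>x\<in>F. c x \<odot> f x)"
    using h unfolding linear_operators_def by simp
  with insert show ?case by (simp add: Pi_iff)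
qed

lemma free_locally_convex_space_t1_space:
  assumes L: "free_locally_convex_space X L TL j"
    and X: "completely_regular_space X" "t1_space X"
  shows "t1_space TL"
proof -
  have lc: "locally_convex_space L TL" and j: "continuous_map X TL j"
    using L by (auto simp: free_locally_convex_space_def)
  interpret L: real_locally_convex_space L TL by (rule real_locally_convex_space.intro[OF lc])
  have jL: "j x \<in> carrier L" if "x \<in> topspace X" for x
    using that j L.additive.topspace_T by (auto simp: continuous_map_def)
  show ?thesis
  proof (rule L.additive.t1_spaceI, unfold additive_group_simps)
    fix a assume a: "a \<in> carrier L" "a \<noteq> \<zero>\<^bsub>L\<^esub>"
    obtain F and c :: "'a \<Rightarrow> real"
      where F: "finite F" "F \<subseteq> topspace X" "a = (\<Oplus>\<^bsub>L\<^esub>x\<in>F. c x \<odot>\<^bsub>L\<^esub> j x)"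
      using free_locally_convex_space_finsum[OF L a(1)] by blast
    have jF: "j x \<in> carrier L" if "x \<in> F" for x using jL F(2) that by blast
    have "\<exists>x\<in>F. c x \<noteq> 0"
    proof (rule ccontr)
      assume "\<not> (\<exists>x\<in>F. c x \<noteq> 0)"
      then have "a = \<zero>\<^bsub>L\<^esub>" unfolding F(3) by (intro L.add.finprod_one_eqI) (simp add: jF)
      with a(2) show False by simp
    qed
    then obtain z where z: "z \<in> F" "c z \<noteq> 0" by blast
    obtain f where f: "continuous_map X euclideanreal f" "f z = 1" "\<And>y. y \<in> F - {z} \<Longrightarrow> f y = 0"
      using separate_point_from_finite[OF X, of z "F - {z}"] z F(1,2) by auto
    obtain h where h: "h \<in> linear_operators L real_module" "continuous_map TL euclideanreal h"
      "\<forall>x\<in>topspace X. f x = h (j x)"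
      using free_locally_convex_space_factor[OF L locally_convex_space_real f(1)] by blast
    have "h a = (\<Sum>x\<in>F. c x * h (j x))"
      unfolding F(3) by (rule L.linear_functional_finsum[OF h(1) F(1) jF])
    also have "\<dots> = (\<Sum>x\<in>F. if x = z then c z else 0)"
    proof (rule sum.cong[OF refl])
      fix x assume x: "x \<in> F"
      then have "h (j x) = f x" using h(3) F(2) by auto
      then show "c x * h (j x) = (if x = z then c z else 0)"
        using f(2) f(3)[of x] x by simp
    qed
    also have "\<dots> = c z" using F(1) z(1) by simp
    finally have ha: "h a \<noteq> 0" using z(2) by simp
    have h0: "h \<zero>\<^bsub>L\<^esub> = 0"
      using L.linear_operators_zero[OF real_linear_space.intro[OF module_real_module] h(1)] by simp
    have "openin TL {b \<in> topspace TL. h b \<in> - {h a}}"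
      by (rule openin_continuous_map_preimage[OF h(2)]) (simp add: open_Compl)
    then show "\<exists>U. openin TL U \<and> \<zero>\<^bsub>L\<^esub> \<in> U \<and> a \<notin> U"
      using ha h0 L.additive.topspace_T by (intro exI[of _ "{b \<in> topspace TL. h b \<in> - {h a}}"]) simp
  qed
qed


text \<open>The multiples \<open>t x\<close> of generators are the image of \<open>\<real> \<times> X\<close> under a continuous map, and this product
has a countable network.\<close>

lemma free_locally_convex_space_network:
  assumes L: "free_locally_convex_space X L TL j"
    and \<N>: "countable \<N>" "\<Union>\<N> \<subseteq> topspace X" "\<And>x. x \<in> topspace X \<Longrightarrow> network_at X \<N> x"
  shows "\<exists>\<B>. countable \<B> \<and> \<B> \<subseteq> Pow (carrier L) \<and> (\<forall>a\<in>carrier L. network_at TL \<B> a)"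
proof -
  have lc: "locally_convex_space L TL" and j: "continuous_map X TL j"
    using L by (auto simp: free_locally_convex_space_def)
  interpret L: real_locally_convex_space L TL by (rule real_locally_convex_space.intro[OF lc])
  have jL: "j x \<in> carrier L" if "x \<in> topspace X" for x
    using that j L.additive.topspace_T by (auto simp: continuous_map_def)
  obtain \<R> :: "real set set" where \<R>: "countable \<R>" "topological_basis \<R>"
    using ex_countable_basis by blast
  have net_real: "network_at euclideanreal \<R> t" for t
    unfolding network_at_def
  proof (intro allI impI, elim conjE)
    fix U assume "openin euclideanreal U" "t \<in> U"
    then show "\<exists>N\<in>\<R>. t \<in> N \<and> N \<subseteq> U"
      using topological_basisE[OF \<R>(2), of U t] by (metis open_openin)
  qed
  define g where "g = (\<lambda>(t, x). t \<odot>\<^bsub>L\<^esub> j x)"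
  have g: "continuous_map (prod_topology euclideanreal X) TL g"
    unfolding g_def case_prod_unfold
    by (intro L.continuous_smult continuous_map_fst continuous_map_compose[OF continuous_map_snd j, unfolded o_def])
  define \<P> where "\<P> = (\<lambda>(M, N). M \<times> N) ` (\<R> \<times> \<N>)"
  define \<M> where "\<M> = (`) g ` \<P>"
  define S where "S = g ` (UNIV \<times> topspace X)"
  have "\<exists>\<B>. countable \<B> \<and> \<B> \<subseteq> Pow (carrier (additive_group L)) \<and>
      (\<forall>a\<in>carrier (additive_group L). network_at TL \<B> a)"
  proof (rule L.additive.countable_network_generated[where S = S])
    show "countable \<M>" unfolding \<M>_def \<P>_def
      using \<R>(1) \<N>(1) by (intro countable_image countable_SIGMA)
    show "\<Union>\<M> \<subseteq> carrier (additive_group L)"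
    proof
      fix a assume "a \<in> \<Union>\<M>"
      then obtain t N x where "N \<in> \<N>" "x \<in> N" "a = t \<odot>\<^bsub>L\<^esub> j x"
        by (auto simp: \<M>_def \<P>_def g_def)
      then show "a \<in> carrier (additive_group L)" using \<N>(2) jL by auto
    qed
    show "S \<subseteq> carrier (additive_group L)" using jL by (auto simp: S_def g_def)
    show "network_at TL \<M> s" if s: "s \<in> S" for s
    proof -
      obtain t x where tx: "x \<in> topspace X" "s = g (t, x)" using s by (auto simp: S_def)
      show ?thesis
        unfolding \<M>_def \<P>_def tx(2)
        by (rule network_at_image[OF g network_at_prod[OF net_real \<N>(3)[OF tx(1)]]]) (simp add: tx(1))
    qed
    fix P a
    assume P1: "P \<one>\<^bsub>additive_group L\<^esub>"
      and closed: "\<And>b s. b \<in> carrier (additive_group L) \<Longrightarrow> s \<in> S \<Longrightarrow> P b \<Longrightarrow> P (s \<otimes>\<^bsub>additive_group L\<^esub> b)"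
      and a: "a \<in> carrier (additive_group L)"
    have "a \<in> carrier L" using a by simp
    with L show "P a"
    proof (induction rule: free_locally_convex_space_induct)
      case zero
      then show ?case using P1 by simp
    next
      case (step t x b)
      have "t \<odot>\<^bsub>L\<^esub> j x \<in> S" using step(1) by (force simp: S_def g_def)
      from closed[OF _ this step(3)] step(2) show ?case by simp
    qed
  qed
  then show ?thesis by simp
qed

text \<open>Besides the conditions on differences there are conditions \<open>2\<^sup>-\<^sup>r j N \<subseteq> V 0\<close>; they ensure that the
intersection of a sequence of neighbourhoods still absorbs the generators.\<close>

theorem free_locally_convex_space_P0_space:
  assumes X: "sequential_space X" "aleph0_space X"
    and L: "free_locally_convex_space X L TL j"
  shows "P0_space TL"
proof -
  have lc: "locally_convex_space L TL" and j: "continuous_map X TL j"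
    using L by (auto simp: free_locally_convex_space_def)
  interpret L: real_locally_convex_space L TL by (rule real_locally_convex_space.intro[OF lc])
  have top: "topspace TL = carrier L" using L.additive.topspace_T by simp
  have jL: "j x \<in> carrier L" if "x \<in> topspace X" for x
    using that j top by (auto simp: continuous_map_def)
  obtain \<N> where \<N>: "countable \<N>" "\<Union>\<N> \<subseteq> topspace X" "cs_network X \<N>"
    by (rule aleph0_space_cs_network[OF X(2)])
  have t1: "t1_space TL"
    using free_locally_convex_space_t1_space[OF L aleph0_space_completely_regular_space[OF X(2)]]
      X(2) by (simp add: aleph0_space_def t3_space_def)
  have "\<exists>\<B>. countable \<B> \<and> \<B> \<subseteq> Pow (carrier L) \<and> (\<forall>a\<in>carrier L. network_at TL \<B> a)"
    by (rule free_locally_convex_space_network[OF L \<N>(1,2)]) (rule cs_network_network_at[OF \<N>(3)])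
  then obtain \<B> where \<B>: "countable \<B>" "\<B> \<subseteq> Pow (carrier L)" "\<forall>a\<in>carrier L. network_at TL \<B> a"
    by (elim exE conjE)
  define D where "D = (\<lambda>(N, m :: nat). (differences (additive_group L) j N, m)) ` (\<N> \<times> UNIV)"
  define E where "E = (\<lambda>(N, r :: nat). ((\<lambda>x. (1 / 2 ^ r) \<odot>\<^bsub>L\<^esub> j x) ` N, 0 :: nat)) ` (\<N> \<times> UNIV)"
  define nbhd where "nbhd B \<longleftrightarrow> abs_convex L B \<and> (\<exists>Q. openin TL Q \<and> \<zero>\<^bsub>L\<^esub> \<in> Q \<and> Q \<subseteq> B)" for B
  have string: "neighbourhood_string (additive_group L) TL (dilates L B)" if "nbhd B" for B
    using that L.neighbourhood_string_dilates unfolding nbhd_def by blast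
  have "\<exists>\<N>. countable \<N> \<and> \<N> \<subseteq> Pow (topspace TL) \<and> pytkeev_network_at TL \<N> \<zero>\<^bsub>L\<^esub>"
  proof (rule pytkeev_network_at_from_strings[where \<B> = \<B> and C = "D \<union> E" and \<V> = "dilates L ` Collect nbhd"])
    show "countable (D \<union> E)"
      unfolding D_def E_def using \<N>(1) by (intro countable_Un countable_image countable_SIGMA) simp_all
    show "\<exists>V\<in>dilates L ` Collect nbhd. V 0 \<subseteq> U" if U: "openin TL U" "\<zero>\<^bsub>L\<^esub> \<in> U" for U
    proof -
      obtain B Q where B: "abs_convex L B" "openin TL Q" "\<zero>\<^bsub>L\<^esub> \<in> Q" "Q \<subseteq> B" "B \<subseteq> U"
        using L.abs_convex_neighbourhood_exists[OF U] by blast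
      have "nbhd B" using B(1-4) unfolding nbhd_def by blast
      moreover have "dilates L B 0 \<subseteq> U" using B(5) L.dilates_0[OF B(1)] by simp
      ultimately show ?thesis by (intro bexI[of _ "dilates L B"]) simp_all
    qed
    show "\<zero>\<^bsub>L\<^esub> \<in> V 0" if "V \<in> dilates L ` Collect nbhd" for V
      using that by (auto simp: nbhd_def dilates_def abs_convex_def)
    fix V W
    assume "V \<in> dilates L ` Collect nbhd" and "\<And>k. W k \<in> dilates L ` Collect nbhd"
      and tail: "\<And>E' m. (E', m) \<in> D \<union> E \<Longrightarrow> E' \<subseteq> V m \<Longrightarrow> \<forall>\<^sub>F k in sequentially. E' \<subseteq> W k m"
    then obtain B0 and B :: "nat \<Rightarrow> 'b set" where V: "V = dilates L B0" "nbhd B0"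
      and W: "\<And>k. W k = dilates L (B k)" "\<And>k. nbhd (B k)"
      unfolding image_iff mem_Collect_eq Bex_def by metis
    have acB: "abs_convex L (B k)" and acB0: "abs_convex L B0" for k
      using V(2) W(2) by (simp_all add: nbhd_def)
    have W0: "W k 0 = B k" for k using L.dilates_0[OF acB] W(1) by simp
    have V0: "V 0 = B0" using L.dilates_0[OF acB0] V(1) by simp
    have "\<exists>Q. openin TL Q \<and> \<zero>\<^bsub>L\<^esub> \<in> Q \<and> Q \<subseteq> (\<Inter>k. B k)"
    proof (rule free_locally_convex_space_neighbourhood[OF L X(1)])
      show "abs_convex L (\<Inter>k. B k)" by (rule abs_convex_Inter[OF acB])
      show "\<exists>m. (1 / 2 ^ m) \<odot>\<^bsub>L\<^esub> j x \<in> (\<Inter>k. B k)" if x: "x \<in> topspace X" for x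
      proof -
        obtain Q where Q: "openin TL Q" "\<zero>\<^bsub>L\<^esub> \<in> Q" "Q \<subseteq> B0" using V(2) unfolding nbhd_def by blast
        obtain r where r: "(1 / 2 ^ r) \<odot>\<^bsub>L\<^esub> j x \<in> Q" using L.absorbing_open[OF Q(1,2) jL[OF x]] by blast
        have "continuous_map X TL (\<lambda>y. (1 / 2 ^ r) \<odot>\<^bsub>L\<^esub> j y)"
          by (intro L.continuous_smult j) simp
        from openin_continuous_map_preimage[OF this Q(1)]
        have "openin X {y \<in> topspace X. (1 / 2 ^ r) \<odot>\<^bsub>L\<^esub> j y \<in> Q}" .
        moreover have "x \<in> {y \<in> topspace X. (1 / 2 ^ r) \<odot>\<^bsub>L\<^esub> j y \<in> Q}" using r x by simp
        ultimately obtain N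
          where N: "N \<in> \<N>" "x \<in> N" "N \<subseteq> {y \<in> topspace X. (1 / 2 ^ r) \<odot>\<^bsub>L\<^esub> j y \<in> Q}"
          using cs_network_network_at[OF \<N>(3) x] unfolding network_at_def by meson
        have "((\<lambda>x. (1 / 2 ^ r) \<odot>\<^bsub>L\<^esub> j x) ` N, 0) \<in> D \<union> E" using N(1) by (force simp: E_def)
        moreover have "(\<lambda>x. (1 / 2 ^ r) \<odot>\<^bsub>L\<^esub> j x) ` N \<subseteq> V 0" using N(3) Q(3) V0 by blast
        ultimately obtain k0 where k0: "\<And>k. k0 \<le> k \<Longrightarrow> (\<lambda>x. (1 / 2 ^ r) \<odot>\<^bsub>L\<^esub> j x) ` N \<subseteq> W k 0"
          using tail unfolding eventually_sequentially by blast
        have "\<exists>m. (1 / 2 ^ m) \<odot>\<^bsub>L\<^esub> j x \<in> B k" for k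
        proof -
          obtain Q where "openin TL Q" "\<zero>\<^bsub>L\<^esub> \<in> Q" "Q \<subseteq> B k" using W(2) unfolding nbhd_def by blast
          then show ?thesis using L.absorbing_open[OF _ _ jL[OF x], of Q] by blast
        qed
        then obtain q where q: "\<And>k. (1 / 2 ^ q k) \<odot>\<^bsub>L\<^esub> j x \<in> B k" by metis
        \<comment> \<open>\<open>r\<close> works for all \<open>k \<ge> k0\<close>, and the sum dominates the \<open>q k\<close> of the finitely many others.\<close>
        define m where "m = r + (\<Sum>k<k0. q k)"
        have "(1 / 2 ^ m) \<odot>\<^bsub>L\<^esub> j x \<in> B k" for k
        proof (cases "k < k0")
          case True
          then have "q k \<le> (\<Sum>k<k0. q k)" by (intro member_le_sum) simp_all
          then show ?thesis by (intro L.absorbing_mono[OF acB jL[OF x] q]) (simp add: m_def)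
        next
          case False
          then have "(1 / 2 ^ r) \<odot>\<^bsub>L\<^esub> j x \<in> B k" using k0[of k] N(2) W0 by auto
          then show ?thesis by (rule L.absorbing_mono[OF acB jL[OF x]]) (simp add: m_def)
        qed
        then show ?thesis by blast
      qed
      fix \<sigma> x m assume lim: "limitin X \<sigma> x sequentially"
      have "\<forall>\<^sub>F n in sequentially. \<forall>k. inv\<^bsub>additive_group L\<^esub> j x \<otimes>\<^bsub>additive_group L\<^esub> j (\<sigma> n) \<in> W k m"
      proof (rule L.additive.eventually_in_all_strings[OF j \<N>(3) _ _ _ lim])
        show "neighbourhood_string (additive_group L) TL V" unfolding V(1) by (rule string[OF V(2)])
        show "neighbourhood_string (additive_group L) TL (W k)" for k
          unfolding W(1) by (rule string[OF W(2)])
        fix N m assume "N \<in> \<N>" and sub: "differences (additive_group L) j N \<subseteq> V m"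
        then have "(differences (additive_group L) j N, m) \<in> D \<union> E" by (force simp: D_def)
        from tail[OF this sub]
        show "\<forall>\<^sub>F k in sequentially. differences (additive_group L) j N \<subseteq> W k m" .
      qed
      then show "\<forall>\<^sub>F n in sequentially. \<ominus>\<^bsub>L\<^esub> j x \<oplus>\<^bsub>L\<^esub> j (\<sigma> n) \<in> dilates L (\<Inter>k. B k) m"
        by (simp add: dilates_Inter W(1))
    qed
    then show "\<exists>Q. openin TL Q \<and> \<zero>\<^bsub>L\<^esub> \<in> Q \<and> (\<forall>k::nat. Q \<subseteq> W k 0)"
      unfolding W0 by (elim exE conjE) (intro exI conjI allI, assumption+, blast)
  qed (use \<B> t1 top in simp_all)
  then obtain \<P> where \<P>: "countable \<P>" "\<P> \<subseteq> Pow (carrier L)" "pytkeev_network_at TL \<P> \<zero>\<^bsub>L\<^esub>"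
    using top by auto
  show ?thesis
    by (rule L.additive.P0_space_from_one[OF t1 \<B>(1) _ _ \<P>(1)]) (use \<B>(2,3) \<P>(2,3) in simp_all)
qed

theorem theorem3p13:
  fixes X :: "'a topology"
    and A :: "'b monoid" and TA :: "'b topology" and i :: "'a \<Rightarrow> 'b"
    and L :: "(real, 'c) module" and TL :: "'c topology" and j :: "'a \<Rightarrow> 'c"
  assumes "sequential_space X" and "aleph0_space X"
  shows "(free_abelian_topological_group X A TA i \<longrightarrow> P0_space TA) \<and>
         (free_locally_convex_space X L TL j \<longrightarrow> P0_space TL)"
proof (intro conjI impI)
  assume "free_abelian_topological_group X A TA i"
  with assms show "P0_space TA" by (rule free_abelian_topological_group_P0_space)
next
  assume "free_locally_convex_space X L TL j"
  with assms show "P0_space TL" by (rule free_locally_convex_space_P0_space)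
qed

end
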